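(* Let $c\ge 1$, let $\mathcal N_c$ be the variety of nilpotent groups of class at most $c$, and let $\mathcal V$ be an arbitrary variety of groups. Let $A$ and $B$ be groups with free presentations $1\to R_1\to F_1\xrightarrow{\nu_1}A\to1$ and $1\to R_2\to F_2\xrightarrow{\nu_2}B\to1$, let $K=F_1*B$, and let $T_V$ be the subgroup of $K$ defined in the context. Then there exists an epimorphism $$\mathcal N_cM(A\,\mathrm{Wr}_V\,B)\longrightarrow\mathcal N_cM(B)\oplus\frac{T_V\cap\gamma_{c+1}(K)}{[T_V,\,_cK]},$$ where $A\,\mathrm{Wr}_V\,B$ is the $\mathcal V$-verbal wreath product of $A$ by $B$. Also, in the finite case (that is, if the group $A\,\mathrm{Wr}_V\,B$ is finite), $\mathcal N_cM(A\,\mathrm{Wr}_V\,B)$ has a subgroup isomorphic to $$\mathcal N_cM(B)\oplus\frac{T_V\cap\gamma_{c+1}(K)}{[T_V,\,_cK]}.$$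
   Context: Conventions: commutators of several entries are left-normed; for subgroups, $[X,\,_cY]=[X,Y,\dots,Y]$ with $c$ copies of $Y$; $\gamma_{c+1}(X)$ is the $(c+1)$-st term of the lower central series; for a subset $X$ of a group $Y$, $X^Y$ is the normal closure of $X$ in $Y$; $V(X)$ is the verbal subgroup of $X$ for the set of laws $V$ defining $\mathcal V$. For a group $G\cong F/R$ with $F$ free, $\mathcal N_cM(G)=(R\cap\gamma_{c+1}(F))/[R,\,_cF]$ (the Baer invariant with respect to $\mathcal N_c$), which is independent of the choice of free presentation. $\mathcal V$-verbal wreath product: for $b\in B$ let $A_b$ be an isomorphic copy of $A$, with $a_b\in A_b$ corresponding to $a\in A$. Let $C=\prod^*_{b\in B}A_b$ be the free product, $[A_b]^*$ its cartesian subgroup (the kernel of the natural map from $C$ onto the restricted direct product of the $A_b$), $C_V=V(C)\cap[A_b]^*$, and $G_V=C/C_V$ (the $\mathcal V$-verbal product of the $A_b$). For fixed $b'\in B$ the map $a_b\mapsto a_{bb'}$ ($a\in A$, $b\in B$) induces an automorphism $\theta_Vb'$ of $G_V$; $A\,\mathrm{Wr}_V\,B$ is the semidirect product of the normal subgroup $G_V$ by $B$ under $\theta_V$. In $F=F_1*F_2$ let $H=F_1^{F_2}$ be the subgroup generated by all conjugates $F_1^{u}$, $u\in F_2$ (that is, the normal closure $F_1^F$). Put $$R_V=V(H)\cap\langle[x,y]: x\in(F_1^u)^H,\ y\in(F_1^v)^H,\ u,v\in F_2\rangle,$$ where $(F_1^u)^H$ is the normal closure of $F_1^u$ in $H$,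 and $$S_V=[R_2,F_1]^F\,R_1^F\,R_V .$$ Let $\delta:F_1*F_2\to K=F_1*B$ be the natural epimorphism (the identity on $F_1$, and $\nu_2$ on $F_2$), and put $T_V=\delta(S_V)$.
   Formalization: In R_V the commutators [x,y] are taken only for u,v in F_2 with ν_2(u) ≠ ν_2(v); with all u,v allowed the claim is false (B = F_2 = 1, A = Q_8, c = 1, V abelian: M(Q_8) = 0 cannot map onto Z/2). *)

theory Defs
  imports "HOL-Algebra.Product_Groups" "HOL-Algebra.Weak_Morphisms"
begin

section \<open>Free products and free groups\<close>

text \<open>
  The free product of a family of groups is realised on its normal forms: words
  \<open>[(i\<^sub>1, g\<^sub>1), \<dots>, (i\<^sub>n, g\<^sub>n)]\<close> of nontrivial elements in which neighbouring letters come from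
  different factors.  Multiplication is concatenation followed by reduction.
\<close>

fun fp_reduced :: "'i set \<Rightarrow> ('i \<Rightarrow> 'a monoid) \<Rightarrow> ('i \<times> 'a) list \<Rightarrow> bool" where
  "fp_reduced I G [] = True"
| "fp_reduced I G ((i, g) # w) =
     (i \<in> I \<and> g \<in> carrier (G i) \<and> g \<noteq> \<one>\<^bsub>G i\<^esub> \<and> (w = [] \<or> fst (hd w) \<noteq> i) \<and> fp_reduced I G w)"

fun fp_cons :: "('i \<Rightarrow> 'a monoid) \<Rightarrow> 'i \<times> 'a \<Rightarrow> ('i \<times> 'a) list \<Rightarrow> ('i \<times> 'a) list" where
  "fp_cons G (i, g) [] = (if g = \<one>\<^bsub>G i\<^esub> then [] else [(i, g)])"
| "fp_cons G (i, g) ((j, h) # w) =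
     (if g = \<one>\<^bsub>G i\<^esub> then (j, h) # w
      else if i = j then (if g \<otimes>\<^bsub>G i\<^esub> h = \<one>\<^bsub>G i\<^esub> then w else (i, g \<otimes>\<^bsub>G i\<^esub> h) # w)
      else (i, g) # (j, h) # w)"

definition free_product :: "'i set \<Rightarrow> ('i \<Rightarrow> 'a monoid) \<Rightarrow> ('i \<times> 'a) list monoid" where
  "free_product I G =
     \<lparr>carrier = {w. fp_reduced I G w}, monoid.mult = (\<lambda>u v. foldr (fp_cons G) u v), one = []\<rparr>"

definition fp_incl :: "('i \<Rightarrow> 'a monoid) \<Rightarrow> 'i \<Rightarrow> 'a \<Rightarrow> ('i \<times> 'a) list" where
  "fp_incl G i g = (if g = \<one>\<^bsub>G i\<^esub> then [] else [(i, g)])"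

text \<open>The homomorphism out of a free product induced by homomorphisms \<open>\<phi> i\<close> on the factors.\<close>

definition fp_lift :: "'h monoid \<Rightarrow> ('i \<Rightarrow> 'a \<Rightarrow> 'h) \<Rightarrow> ('i \<times> 'a) list \<Rightarrow> 'h" where
  "fp_lift H \<phi> w = foldr (\<lambda>(i, g) y. \<phi> i g \<otimes>\<^bsub>H\<^esub> y) w \<one>\<^bsub>H\<^esub>"

definition free_product2 :: "'p monoid \<Rightarrow> 'q monoid \<Rightarrow> (bool \<times> ('p + 'q)) list monoid"
    (infixr \<open>\<circledast>\<close> 80) where
  "P \<circledast> Q = free_product UNIV (case_bool (image_group Inl P) (image_group Inr Q))"

definition fp_inl :: "'p monoid \<Rightarrow> 'q monoid \<Rightarrow> 'p \<Rightarrow> (bool \<times> ('p + 'q)) list" where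
  "fp_inl P Q p = fp_incl (case_bool (image_group Inl P) (image_group Inr Q)) True (Inl p)"

definition fp_inr :: "'p monoid \<Rightarrow> 'q monoid \<Rightarrow> 'q \<Rightarrow> (bool \<times> ('p + 'q)) list" where
  "fp_inr P Q q = fp_incl (case_bool (image_group Inl P) (image_group Inr Q)) False (Inr q)"

definition fp_lift2 ::
    "'h monoid \<Rightarrow> ('p \<Rightarrow> 'h) \<Rightarrow> ('q \<Rightarrow> 'h) \<Rightarrow> (bool \<times> ('p + 'q)) list \<Rightarrow> 'h" where
  "fp_lift2 H f g = fp_lift H (case_bool (f \<circ> projl) (g \<circ> projr))"

text \<open>
  The free group on \<open>X\<close>: reduced words \<open>x\<^sub>1\<^bsup>n\<^sub>1\<^esup> \<dots> x\<^sub>k\<^bsup>n\<^sub>k\<^esup>\<close> with nonzero exponents and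
  consecutive letters distinct.
\<close>

definition free_group :: "'x set \<Rightarrow> ('x \<times> int) list monoid" where
  "free_group X = free_product X (\<lambda>_. integer_group)"

definition word_eval :: "'a monoid \<Rightarrow> ('x \<Rightarrow> 'a) \<Rightarrow> ('x \<times> int) list \<Rightarrow> 'a" where
  "word_eval G s = fp_lift G (\<lambda>x n. s x [^]\<^bsub>G\<^esub> n)"

definition free_basis :: "'a monoid \<Rightarrow> 'a set \<Rightarrow> bool" where
  "free_basis F X \<longleftrightarrow>
     group F \<and> X \<subseteq> carrier F \<and> word_eval F (\<lambda>x. x) \<in> iso (free_group X) F"

definition is_free_group :: "'a monoid \<Rightarrow> bool" where
  "is_free_group F \<longleftrightarrow> (\<exists>X. free_basis F X)"

text \<open>\<open>1 \<rightarrow> ker \<nu> \<rightarrow> F \<rightarrow> G \<rightarrow> 1\<close> with \<open>F\<close> free.\<close>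

definition free_presentation :: "'f monoid \<Rightarrow> ('f \<Rightarrow> 'a) \<Rightarrow> 'a monoid \<Rightarrow> bool" where
  "free_presentation F \<nu> G \<longleftrightarrow> is_free_group F \<and> group G \<and> \<nu> \<in> epi F G"


section \<open>Commutators, normal closures and verbal subgroups\<close>

definition conj_set :: "'a monoid \<Rightarrow> 'a set \<Rightarrow> 'a \<Rightarrow> 'a set" where
  "conj_set G X u = (\<lambda>x. inv\<^bsub>G\<^esub> u \<otimes>\<^bsub>G\<^esub> x \<otimes>\<^bsub>G\<^esub> u) ` X"

definition normal_closure :: "'a monoid \<Rightarrow> 'a set \<Rightarrow> 'a set" where
  "normal_closure G X = generate G (\<Union>u\<in>carrier G. conj_set G X u)"

definition commutator :: "'a monoid \<Rightarrow> 'a \<Rightarrow> 'a \<Rightarrow> 'a" where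
  "commutator G x y = inv\<^bsub>G\<^esub> x \<otimes>\<^bsub>G\<^esub> inv\<^bsub>G\<^esub> y \<otimes>\<^bsub>G\<^esub> x \<otimes>\<^bsub>G\<^esub> y"

definition commutator_subgroup :: "'a monoid \<Rightarrow> 'a set \<Rightarrow> 'a set \<Rightarrow> 'a set" where
  "commutator_subgroup G X Y = generate G {commutator G x y |x y. x \<in> X \<and> y \<in> Y}"

text \<open>\<open>[X, Y, \<dots>, Y]\<close>, left-normed, with \<open>c\<close> copies of \<open>Y\<close>.\<close>

definition iter_commutator :: "'a monoid \<Rightarrow> 'a set \<Rightarrow> nat \<Rightarrow> 'a set \<Rightarrow> 'a set" where
  "iter_commutator G X c Y = ((\<lambda>Z. commutator_subgroup G Z Y) ^^ c) X"

text \<open>Indexed from 1: \<open>lower_central G 1 = carrier G\<close>.\<close>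

definition lower_central :: "'a monoid \<Rightarrow> nat \<Rightarrow> 'a set" where
  "lower_central G n = iter_commutator G (carrier G) (n - 1) (carrier G)"

text \<open>
  A variety is given by a set \<open>V\<close> of laws, i.e. of elements of the free group on countably many
  generators; \<open>verbal_subgroup V G\<close> is generated by all values in \<open>G\<close> of these laws.
\<close>

type_synonym law = "(nat \<times> int) list"

definition verbal_subgroup :: "law set \<Rightarrow> 'a monoid \<Rightarrow> 'a set" where
  "verbal_subgroup V G = generate G {word_eval G s w |s w. s \<in> UNIV \<rightarrow> carrier G \<and> w \<in> V}"


section \<open>The Baer invariant with respect to nilpotent groups of class at most c\<close>

definition gamma_quotient :: "nat \<Rightarrow> 'f monoid \<Rightarrow> 'f set \<Rightarrow> 'f set monoid" where
  "gamma_quotient c F R =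
     F\<lparr>carrier := R \<inter> lower_central F (c + 1)\<rparr> Mod iter_commutator F R c (carrier F)"

text \<open>
  The invariant of \<open>G\<close> computed from a free presentation \<open>\<nu> : F \<rightarrow> G\<close>.  Up to isomorphism it does
  not depend on the presentation.
\<close>

definition nilpotent_baer_invariant ::
    "nat \<Rightarrow> 'f monoid \<Rightarrow> ('f \<Rightarrow> 'a) \<Rightarrow> 'a monoid \<Rightarrow> 'f set monoid" where
  "nilpotent_baer_invariant c F \<nu> G = gamma_quotient c F (kernel F G \<nu>)"


section \<open>Verbal products and verbal wreath products\<close>

definition cartesian_subgroup :: "'i set \<Rightarrow> ('i \<Rightarrow> 'a monoid) \<Rightarrow> ('i \<times> 'a) list set" where
  "cartesian_subgroup I G = kernel (free_product I G) (sum_group I G)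
     (fp_lift (sum_group I G) (\<lambda>i g. \<lambda>j\<in>I. if j = i then g else \<one>\<^bsub>G j\<^esub>))"

definition verbal_kernel :: "law set \<Rightarrow> 'i set \<Rightarrow> ('i \<Rightarrow> 'a monoid) \<Rightarrow> ('i \<times> 'a) list set" where
  "verbal_kernel V I G = verbal_subgroup V (free_product I G) \<inter> cartesian_subgroup I G"

definition verbal_product ::
    "law set \<Rightarrow> 'i set \<Rightarrow> ('i \<Rightarrow> 'a monoid) \<Rightarrow> ('i \<times> 'a) list set monoid" where
  "verbal_product V I G = free_product I G Mod verbal_kernel V I G"

text \<open>
  Semidirect product of a normal subgroup \<open>N\<close> by \<open>B\<close>, where \<open>B\<close> acts on the right via \<open>\<theta>\<close>
  (so \<open>\<theta> (b b') = \<theta> b' \<circ> \<theta> b\<close>).  The pair \<open>(b, x)\<close> stands for the product \<open>b x\<close>, and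
  \<open>b\<^sup>-\<^sup>1 x b = \<theta> b x\<close>.
\<close>

definition semidirect_product ::
    "'b monoid \<Rightarrow> 'n monoid \<Rightarrow> ('b \<Rightarrow> 'n \<Rightarrow> 'n) \<Rightarrow> ('b \<times> 'n) monoid" where
  "semidirect_product B N \<theta> =
     \<lparr>carrier = carrier B \<times> carrier N,
      monoid.mult = (\<lambda>(b, x) (b', x'). (b \<otimes>\<^bsub>B\<^esub> b', \<theta> b' x \<otimes>\<^bsub>N\<^esub> x')),
      one = (\<one>\<^bsub>B\<^esub>, \<one>\<^bsub>N\<^esub>)\<rparr>"

definition wreath_shift ::
    "'a monoid \<Rightarrow> 'b monoid \<Rightarrow> 'b \<Rightarrow> ('b \<times> 'a) list \<Rightarrow> ('b \<times> 'a) list" where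
  "wreath_shift A B b' = fp_lift (free_product (carrier B) (\<lambda>_. A))
     (\<lambda>b a. fp_incl (\<lambda>_. A) (b \<otimes>\<^bsub>B\<^esub> b') a)"

text \<open>
  The elements of the verbal product are cosets of \<open>C\<^sub>V\<close>, which the automorphism
  \<open>a\<^sub>b \<mapsto> a\<^sub>b\<^sub>b\<^sub>'\<close> of the free product leaves invariant; the induced automorphism therefore sends a
  coset to its image.
\<close>

definition verbal_wreath ::
    "law set \<Rightarrow> 'a monoid \<Rightarrow> 'b monoid \<Rightarrow> ('b \<times> ('b \<times> 'a) list set) monoid" where
  "verbal_wreath V A B =
     semidirect_product B (verbal_product V (carrier B) (\<lambda>_. A)) (\<lambda>b. image (wreath_shift A B b))"


section \<open>The subgroups \<open>S\<^sub>V\<close> and \<open>T\<^sub>V\<close>\<close>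

definition base_subgroup :: "'f monoid \<Rightarrow> 'e monoid \<Rightarrow> (bool \<times> ('f + 'e)) list set" where
  "base_subgroup F1 F2 = generate (F1 \<circledast> F2)
     (\<Union>u\<in>fp_inr F1 F2 ` carrier F2. conj_set (F1 \<circledast> F2) (fp_inl F1 F2 ` carrier F1) u)"

text \<open>
  In \<open>R\<^sub>V\<close> the commutators are taken between conjugates \<open>F\<^sub>1\<^sup>u\<close> and \<open>F\<^sub>1\<^sup>v\<close> that lie over different
  factors \<open>A\<^sub>b\<close> of the wreath product, i.e. with \<open>\<nu>2 u \<noteq> \<nu>2 v\<close>; this matches the cartesian
  subgroup in the definition of the verbal product.  If \<open>u = v\<close> were allowed, or merely
  \<open>u \<noteq> v\<close> required, then \<open>F\<^sub>1 \<circledast> B\<close> modulo \<open>T\<^sub>V\<close> would in general not be the verbal wreath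
  product (for \<open>B\<close> trivial and \<open>V\<close> all laws it would be \<open>A\<close> made abelian instead of \<open>A\<close>).
\<close>

definition R_sub ::
    "law set \<Rightarrow> 'f monoid \<Rightarrow> 'e monoid \<Rightarrow> ('e \<Rightarrow> 'b) \<Rightarrow> (bool \<times> ('f + 'e)) list set" where
  "R_sub V F1 F2 \<nu>2 =
     (let F = F1 \<circledast> F2;
          H = F\<lparr>carrier := base_subgroup F1 F2\<rparr>;
          N = (\<lambda>u. normal_closure H (conj_set F (fp_inl F1 F2 ` carrier F1) (fp_inr F1 F2 u)))
      in verbal_subgroup V H \<inter>
         generate F {commutator F x y |x y u v. u \<in> carrier F2 \<and> v \<in> carrier F2 \<and> \<nu>2 u \<noteq> \<nu>2 v \<and>
                                                x \<in> N u \<and> y \<in> N v})"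

definition S_sub ::
    "law set \<Rightarrow> 'a monoid \<Rightarrow> 'b monoid \<Rightarrow> 'f monoid \<Rightarrow> ('f \<Rightarrow> 'a) \<Rightarrow> 'e monoid \<Rightarrow> ('e \<Rightarrow> 'b)
     \<Rightarrow> (bool \<times> ('f + 'e)) list set" where
  "S_sub V A B F1 \<nu>1 F2 \<nu>2 =
     (let F = F1 \<circledast> F2;
          R1 = fp_inl F1 F2 ` kernel F1 A \<nu>1;
          R2 = fp_inr F1 F2 ` kernel F2 B \<nu>2
      in normal_closure F (commutator_subgroup F R2 (fp_inl F1 F2 ` carrier F1))
           <#>\<^bsub>F\<^esub> normal_closure F R1 <#>\<^bsub>F\<^esub> R_sub V F1 F2 \<nu>2)"

definition delta_map ::
    "'b monoid \<Rightarrow> 'f monoid \<Rightarrow> ('e \<Rightarrow> 'b) \<Rightarrow> (bool \<times> ('f + 'e)) list \<Rightarrow> (bool \<times> ('f + 'b)) list" where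
  "delta_map B F1 \<nu>2 = fp_lift2 (F1 \<circledast> B) (fp_inl F1 B) (fp_inr F1 B \<circ> \<nu>2)"

definition T_sub ::
    "law set \<Rightarrow> 'a monoid \<Rightarrow> 'b monoid \<Rightarrow> 'f monoid \<Rightarrow> ('f \<Rightarrow> 'a) \<Rightarrow> 'e monoid \<Rightarrow> ('e \<Rightarrow> 'b)
     \<Rightarrow> (bool \<times> ('f + 'b)) list set" where
  "T_sub V A B F1 \<nu>1 F2 \<nu>2 = delta_map B F1 \<nu>2 ` S_sub V A B F1 \<nu>1 F2 \<nu>2"

end

theory Submission
  imports Defs "HOL-Computational_Algebra.Primes" "HOL-Algebra.Multiplicative_Group"
begin

text \<open>
  Put \<open>K = F\<^sub>1 * B\<close>.  Sending \<open>f\<close> in \<open>F\<^sub>1\<close> to the copy of \<open>\<nu>\<^sub>1 f\<close> at the index \<open>1\<close>, and \<open>b\<close> to \<open>b\<close>,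
  gives an epimorphism \<open>\<psi>\<close> from \<open>K\<close> onto the verbal wreath product, and the point of the group
  \<open>T\<^sub>V\<close> is that it is exactly the kernel of \<open>\<psi>\<close> (\<open>kernel_eq_T_sub\<close>).  Once this is known, the theorem is
  about an arbitrary group \<open>G\<close> that is a quotient of \<open>K\<close> and retracts compatibly onto \<open>B\<close>.

  The kernel.  Let \<open>C\<^sub>1\<close> be the free product of copies of \<open>F\<^sub>1\<close>, and \<open>C\<close> that of copies of \<open>A\<close>, both
  indexed by \<open>B\<close>.  Every element of \<open>K\<close> is an element of \<open>B\<close> times the image of some \<open>w\<close> in \<open>C\<^sub>1\<close>,
  where \<open>f\<^sub>b\<close> maps to \<open>b\<^sup>-\<^sup>1 f b\<close>; it lies in the kernel of \<open>\<psi>\<close> iff the factor from \<open>B\<close> is trivial and the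
  image of \<open>w\<close> in \<open>C\<close> lies in \<open>V(C)\<close> and in the cartesian subgroup.  Lift that image to \<open>v\<close> in
  \<open>V(C\<^sub>1)\<close>.  Modulo commutators of elements from different factors, \<open>v\<close> is the product of its components
  (\<open>diagonal_decomposition\<close>).  These components lie in the verbal subgroup of \<open>F\<^sub>1\<close>, and \<open>\<nu>\<^sub>1\<close> kills them.
  So \<open>w\<close> is a product of an element that lies in \<open>V(C\<^sub>1)\<close> and is a product of mixed commutators, and of
  elements killed in \<open>C\<close>.  The former contributes to \<open>R\<^sub>V\<close>, the latter to the normal closure of \<open>R\<^sub>1\<close>.
  To transport the former into \<open>F\<^sub>1 * F\<^sub>2\<close>, a section of \<open>\<nu>\<^sub>2\<close> as a map of sets suffices, because
  \<open>C\<^sub>1\<close> is a free product.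

  The epimorphism.  Let \<open>W\<close> be free over \<open>G\<close> with kernel \<open>R\<close>.  Lifting the projection of \<open>W\<close> along
  \<open>K \<rightarrow> G\<close> and along \<open>E \<rightarrow> B\<close> yields a map from the invariant of \<open>G\<close> to the direct sum.  It is onto because an
  element of the sum is represented in \<open>F\<^sub>1 * E\<close>, which in turn maps to \<open>W\<close> over \<open>G\<close>; the two ways to
  return from \<open>F\<^sub>1 * E\<close> to \<open>K\<close> agree modulo \<open>T\<^sub>V\<close>, and homomorphisms that agree modulo a normal subgroup
  \<open>T\<close> agree on \<open>\<gamma>\<^sub>c\<^sub>+\<^sub>1\<close> modulo \<open>[T, K, \<dots>, K]\<close> (\<open>homs_cong_lower_central\<close>).

  The finite case.  If \<open>G\<close> is finite, then so is \<open>\<gamma>\<^sub>c\<^sub>+\<^sub>1(W)/[R, W, \<dots>, W]\<close>, by Baer's extension of Schur's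
  theorem (\<open>finite_lower_central_mod\<close>).  The invariant is therefore a finite abelian group, and every quotient
  of a finite abelian group is isomorphic to one of its subgroups (\<open>quotient_embeds_finite_abelian\<close>).
\<close>

section \<open>Free products of groups\<close>

locale group_family =
  fixes I :: "'i set" and G :: "'i \<Rightarrow> 'a monoid"
  assumes groups [simp, intro]: "i \<in> I \<Longrightarrow> group (G i)"
begin

abbreviation "FP \<equiv> free_product I G"

lemma FP_simps: "carrier FP = {w. fp_reduced I G w}"
  "u \<otimes>\<^bsub>FP\<^esub> v = foldr (fp_cons G) u v" "\<one>\<^bsub>FP\<^esub> = []"
  by (simp_all add: free_product_def)

lemma fp_cons_one: "fp_cons G (i, \<one>\<^bsub>G i\<^esub>) w = w"
  by (cases w) auto

lemma fp_reduced_fp_cons: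
  assumes "i \<in> I" "g \<in> carrier (G i)" "fp_reduced I G w"
  shows "fp_reduced I G (fp_cons G (i, g) w)"
proof -
  interpret group "G i" using assms by simp
  show ?thesis using assms
    by (cases "(G, (i, g), w)" rule: fp_cons.cases) (auto dest: hd_in_set)
qed

text \<open>
  Letters act on reduced words by \<open>fp_cons\<close>.  That this is an action of each factor replaces the usual case
  distinctions in proving associativity of reduced concatenation (van der Waerden's trick).
\<close>
lemma fp_cons_fp_cons:
  assumes i: "i \<in> I" and g: "g \<in> carrier (G i)" and h: "h \<in> carrier (G i)" and w: "fp_reduced I G w"
  shows "fp_cons G (i, g) (fp_cons G (i, h) w) = fp_cons G (i, g \<otimes>\<^bsub>G i\<^esub> h) w"
proof -
  interpret group "G i" using i by simp
  show ?thesis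
  proof (cases w)
    case Nil
    then show ?thesis using g h by auto
  next
    case (Cons a w')
    obtain j k where a: "a = (j, k)" by force
    show ?thesis
    proof (cases "j = i")
      case False
      then show ?thesis using Cons a g h by auto
    next
      case True
      then have k: "k \<in> carrier (G i)" "k \<noteq> \<one>\<^bsub>G i\<^esub>" "fp_reduced I G w'" "w' = [] \<or> fst (hd w') \<noteq> i"
        using w Cons a by auto
      have w'_cons: "fp_cons G (i, x) w' = (if x = \<one>\<^bsub>G i\<^esub> then w' else (i, x) # w')" for x
        using k(4) by (cases w') auto
      have Cons_eq: "fp_cons G (i, x) w = fp_cons G (i, x \<otimes>\<^bsub>G i\<^esub> k) w'" if "x \<in> carrier (G i)" for x
        using Cons a True k that by (auto simp: w'_cons)
      have "fp_cons G (i, g) (fp_cons G (i, x) w') = fp_cons G (i, g \<otimes>\<^bsub>G i\<^esub> x) w'" if "x \<in> carrier (G i)" for x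
        using that g k by (auto simp: w'_cons)
      then show ?thesis
        using g h k by (simp add: Cons_eq m_assoc)
    qed
  qed
qed

lemma fp_reduced_mult:
  "fp_reduced I G u \<Longrightarrow> fp_reduced I G v \<Longrightarrow> fp_reduced I G (foldr (fp_cons G) u v)"
  by (induction u) (auto intro: fp_reduced_fp_cons)

lemma foldr_fp_cons_fp_cons:
  assumes "i \<in> I" "g \<in> carrier (G i)" "fp_reduced I G v" "fp_reduced I G w"
  shows "foldr (fp_cons G) (fp_cons G (i, g) v) w = fp_cons G (i, g) (foldr (fp_cons G) v w)"
proof (cases v)
  case Nil
  then show ?thesis by (simp add: fp_cons_one)
next
  case (Cons a v')
  obtain j h where a: "a = (j, h)" by force
  interpret group "G i" using assms(1) by simp
  show ?thesis
  proof (cases "j = i")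
    case True
    have "fp_cons G (i, g) (foldr (fp_cons G) v w)
        = fp_cons G (i, g \<otimes>\<^bsub>G i\<^esub> h) (foldr (fp_cons G) v' w)"
      using assms Cons a True by (auto intro!: fp_cons_fp_cons fp_reduced_mult)
    then have eq: "fp_cons G (i, g \<otimes>\<^bsub>G i\<^esub> h) (foldr (fp_cons G) v' w) = fp_cons G (i, g) (foldr (fp_cons G) v w)"
      by (rule sym)
    consider "g = \<one>\<^bsub>G i\<^esub>" | "g \<noteq> \<one>\<^bsub>G i\<^esub>" "g \<otimes>\<^bsub>G i\<^esub> h = \<one>\<^bsub>G i\<^esub>"
      | "g \<noteq> \<one>\<^bsub>G i\<^esub>" "g \<otimes>\<^bsub>G i\<^esub> h \<noteq> \<one>\<^bsub>G i\<^esub>" by blast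
    then show ?thesis
    proof cases
      case 2
      then have "fp_cons G (i, g) v = v'" by (simp add: Cons a True)
      then show ?thesis using eq 2(2) by (simp only: fp_cons_one)
    next
      case 3
      then have "fp_cons G (i, g) v = (i, g \<otimes>\<^bsub>G i\<^esub> h) # v'" by (simp add: Cons a True)
      then show ?thesis using eq by (simp only: foldr.simps o_apply)
    qed (simp only: fp_cons_one)
  next
    case False
    then show ?thesis unfolding Cons a
      by (cases "g = \<one>\<^bsub>G i\<^esub>") (simp_all add: fp_cons_one)
  qed
qed

lemma mult_assoc:
  "fp_reduced I G u \<Longrightarrow> fp_reduced I G v \<Longrightarrow> fp_reduced I G w \<Longrightarrow>
   foldr (fp_cons G) (foldr (fp_cons G) u v) w = foldr (fp_cons G) u (foldr (fp_cons G) v w)"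
proof (induction u)
  case (Cons a u)
  obtain i g where a: "a = (i, g)" by force
  then have r: "i \<in> I" "g \<in> carrier (G i)" "fp_reduced I G u" using Cons.prems by auto
  have "foldr (fp_cons G) (foldr (fp_cons G) (a # u) v) w
      = foldr (fp_cons G) (fp_cons G (i, g) (foldr (fp_cons G) u v)) w" by (simp add: a)
  also have "\<dots> = fp_cons G (i, g) (foldr (fp_cons G) (foldr (fp_cons G) u v) w)"
    by (rule foldr_fp_cons_fp_cons) (use r Cons.prems fp_reduced_mult in blast)+
  also have "\<dots> = fp_cons G (i, g) (foldr (fp_cons G) u (foldr (fp_cons G) v w))"
    using Cons.IH r Cons.prems by simp
  finally show ?case by (simp add: a)
qed auto

lemma mult_Nil: "fp_reduced I G w \<Longrightarrow> foldr (fp_cons G) w [] = w"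
proof (induction w)
  case (Cons a w)
  then show ?case by (cases a; cases w) auto
qed auto

lemma fp_incl_mult: "fp_incl G i g = fp_cons G (i, g) []"
  by (simp add: fp_incl_def)

lemma incl_mult: "foldr (fp_cons G) (fp_incl G i g) w = fp_cons G (i, g) w"
  by (auto simp: fp_incl_def fp_cons_one)

lemma fp_incl_closed: "i \<in> I \<Longrightarrow> g \<in> carrier (G i) \<Longrightarrow> fp_incl G i g \<in> carrier FP"
  by (simp add: FP_simps fp_incl_def)

lemma monoid_FP: "monoid FP"
  by (rule monoidI) (simp_all add: FP_simps mult_assoc mult_Nil fp_reduced_mult)

lemma fp_incl_hom: "i \<in> I \<Longrightarrow> fp_incl G i \<in> hom (G i) FP"
proof (rule homI)
  fix g h assume *: "i \<in> I" "g \<in> carrier (G i)" "h \<in> carrier (G i)"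
  then interpret group "G i" by simp
  show "fp_incl G i (g \<otimes>\<^bsub>G i\<^esub> h) = fp_incl G i g \<otimes>\<^bsub>FP\<^esub> fp_incl G i h"
    using fp_cons_fp_cons[OF *, of "[]"] l_one[OF *(3)] r_one[OF *(2)] unfolding FP_simps incl_mult fp_incl_mult by simp
qed (rule fp_incl_closed)

lemma FP_induct [consumes 1, case_names one mult]:
  assumes "w \<in> carrier FP" and "P \<one>\<^bsub>FP\<^esub>"
    and step: "\<And>i g w. i \<in> I \<Longrightarrow> g \<in> carrier (G i) \<Longrightarrow> w \<in> carrier FP \<Longrightarrow> P w \<Longrightarrow> P (fp_incl G i g \<otimes>\<^bsub>FP\<^esub> w)"
  shows "P w"
proof -
  have "fp_reduced I G w" using assms(1) by (simp add: FP_simps)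
  then show ?thesis
  proof (induction w)
    case Nil
    then show ?case using assms(2) by (simp add: FP_simps)
  next
    case (Cons a w)
    obtain i g where a: "a = (i, g)" by force
    have "P (fp_incl G i g \<otimes>\<^bsub>FP\<^esub> w)"
      using Cons a by (intro step) (auto simp: FP_simps)
    moreover have "fp_incl G i g \<otimes>\<^bsub>FP\<^esub> w = a # w"
      using Cons.prems unfolding FP_simps incl_mult a by (cases w) auto
    ultimately show ?case by simp
  qed
qed

lemma group_FP [simp, intro]: "group FP"
proof -
  interpret monoid FP by (rule monoid_FP)
  have "\<exists>y\<in>carrier FP. y \<otimes>\<^bsub>FP\<^esub> w = \<one>\<^bsub>FP\<^esub>" if "w \<in> carrier FP" for w
    using that
  proof (induction w rule: FP_induct)
    case (mult i g w)
    interpret Gi: group "G i" using mult by simp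
    obtain y where y: "y \<in> carrier FP" "y \<otimes>\<^bsub>FP\<^esub> w = \<one>\<^bsub>FP\<^esub>" using mult by blast
    let ?h = "fp_incl G i (inv\<^bsub>G i\<^esub> g)"
    have h: "?h \<in> carrier FP" "fp_incl G i g \<in> carrier FP" using mult by (auto intro: fp_incl_closed)
    have "?h \<otimes>\<^bsub>FP\<^esub> fp_incl G i g = fp_incl G i (inv\<^bsub>G i\<^esub> g \<otimes>\<^bsub>G i\<^esub> g)"
      using hom_mult[OF fp_incl_hom, of i "inv\<^bsub>G i\<^esub> g" g] mult by simp
    then have hg: "?h \<otimes>\<^bsub>FP\<^esub> fp_incl G i g = \<one>\<^bsub>FP\<^esub>" using mult by (simp add: FP_simps(3) fp_incl_def)
    have "(y \<otimes>\<^bsub>FP\<^esub> ?h) \<otimes>\<^bsub>FP\<^esub> (fp_incl G i g \<otimes>\<^bsub>FP\<^esub> w) = y \<otimes>\<^bsub>FP\<^esub> ((?h \<otimes>\<^bsub>FP\<^esub> fp_incl G i g) \<otimes>\<^bsub>FP\<^esub> w)"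
      using y h mult by (simp add: m_assoc)
    also have "\<dots> = \<one>\<^bsub>FP\<^esub>" using hg y mult by simp
    finally show ?case using y h by (metis m_closed)
  qed (auto intro!: bexI[of _ "\<one>\<^bsub>FP\<^esub>"])
  then show ?thesis by (intro groupI) (auto simp: m_assoc)
qed

lemma fp_lift_hom:
  assumes H: "group H" and \<phi>: "\<And>i. i \<in> I \<Longrightarrow> \<phi> i \<in> hom (G i) H"
  shows "fp_lift H \<phi> \<in> hom FP H"
    and "\<And>i g. i \<in> I \<Longrightarrow> g \<in> carrier (G i) \<Longrightarrow> fp_lift H \<phi> (fp_incl G i g) = \<phi> i g"
proof -
  interpret H: group H by fact
  have one: "\<phi> i \<one>\<^bsub>G i\<^esub> = \<one>\<^bsub>H\<^esub>" if "i \<in> I" for i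
    using that assms by (intro hom_one) auto
  have closed: "\<phi> i g \<in> carrier H" if "i \<in> I" "g \<in> carrier (G i)" for i g
    using \<phi>[OF that(1)] that(2) by (auto simp: hom_def)
  have lift_closed: "fp_lift H \<phi> w \<in> carrier H" if "fp_reduced I G w" for w
    using that by (induction w) (auto simp: fp_lift_def closed)
  have cons: "fp_lift H \<phi> (fp_cons G (i, g) w) = \<phi> i g \<otimes>\<^bsub>H\<^esub> fp_lift H \<phi> w"
    if i: "i \<in> I" and g: "g \<in> carrier (G i)" and w: "fp_reduced I G w" for i g w
  proof (cases w)
    case Nil
    then show ?thesis using i g by (simp add: fp_lift_def one)
  next
    case (Cons a w')
    obtain j h where a: "a = (j, h)" by force
    have l: "fp_lift H \<phi> ((j, h) # w) = \<phi> j h \<otimes>\<^bsub>H\<^esub> fp_lift H \<phi> w" for j h w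
      by (simp add: fp_lift_def)
    have w': "fp_lift H \<phi> w' \<in> carrier H" and h: "j \<in> I" "h \<in> carrier (G j)"
      using w Cons a lift_closed by auto
    have "\<phi> i g \<otimes>\<^bsub>H\<^esub> (\<phi> i h \<otimes>\<^bsub>H\<^esub> fp_lift H \<phi> w') = \<phi> i (g \<otimes>\<^bsub>G i\<^esub> h) \<otimes>\<^bsub>H\<^esub> fp_lift H \<phi> w'" if "i = j"
      using that i g h w' \<phi>[OF i] closed by (simp add: hom_mult H.m_assoc)
    moreover have "fp_cons G (i, g) w = (i, g) # (j, h) # w'" if "i \<noteq> j" "g \<noteq> \<one>\<^bsub>G i\<^esub>"
      using that by (simp add: Cons a)
    ultimately show ?thesis using i g h w' closed one
      by (cases "i = j") (auto simp: Cons a l)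
  qed
  have mult: "fp_lift H \<phi> (foldr (fp_cons G) u v) = fp_lift H \<phi> u \<otimes>\<^bsub>H\<^esub> fp_lift H \<phi> v"
    if "fp_reduced I G u" "fp_reduced I G v" for u v
    using that(1)
  proof (induction u)
    case (Cons a u)
    obtain i g where a: "a = (i, g)" by force
    have "fp_lift H \<phi> (a # u) = \<phi> i g \<otimes>\<^bsub>H\<^esub> fp_lift H \<phi> u" by (simp add: a fp_lift_def)
    then show ?case using Cons a that(2)
      by (simp add: cons fp_reduced_mult H.m_assoc closed lift_closed)
  qed (use that lift_closed in \<open>simp add: fp_lift_def\<close>)
  show "fp_lift H \<phi> \<in> hom FP H"
    by (rule homI) (auto simp: FP_simps lift_closed mult)
  show "fp_lift H \<phi> (fp_incl G i g) = \<phi> i g" if "i \<in> I" "g \<in> carrier (G i)" for i g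
    using that closed one by (auto simp: fp_incl_def fp_lift_def)
qed

text \<open>
  Uniqueness in the universal property of the free product; existence is \<open>fp_lift_hom\<close>.
\<close>
lemma FP_hom_eqI:
  assumes "group H" "f \<in> hom FP H" "f' \<in> hom FP H" "w \<in> carrier FP"
    and "\<And>i g. i \<in> I \<Longrightarrow> g \<in> carrier (G i) \<Longrightarrow> f (fp_incl G i g) = f' (fp_incl G i g)"
  shows "f w = f' w"
  using assms(4)
proof (induction w rule: FP_induct)
  case one
  show ?case using assms by (metis hom_one group_FP)
next
  case (mult i g w)
  then show ?case using assms by (simp add: hom_mult fp_incl_closed)
qed

end

text \<open>
  The binary free product is indexed by \<^typ>\<open>bool\<close>, its factors being renamed into a sum type.
\<close>
lemma image_group_inj:
  assumes "inj f"
  shows "group P \<Longrightarrow> group (image_group f P)" and "f \<in> hom P (image_group f P)"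
proof -
  have "f \<in> iso P (image_group f P)"
    using assms by (intro inj_imp_image_group_iso) (auto intro: inj_on_subset)
  then show "f \<in> hom P (image_group f P)" and "group P \<Longrightarrow> group (image_group f P)"
    using group.iso_imp_img_group[of P f "image_group f P"]
    by (simp_all add: iso_def image_group_def)
qed

lemma group_family2:
  assumes "group P" "group Q"
  shows "group_family UNIV (case_bool (image_group Inl P) (image_group Inr Q))"
proof (rule group_family.intro)
  fix i :: bool
  show "group (case i of True \<Rightarrow> image_group Inl P | False \<Rightarrow> image_group Inr Q)"
    using image_group_inj(1)[OF inj_Inl assms(1)] image_group_inj(1)[OF inj_Inr assms(2)] by (cases i) simp_all
qed

lemma group_free_product2 [simp]: "group P \<Longrightarrow> group Q \<Longrightarrow> group (P \<circledast> Q)"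
  unfolding free_product2_def by (intro group_family.group_FP group_family2)

lemma fp_inl_hom: "group P \<Longrightarrow> group Q \<Longrightarrow> fp_inl P Q \<in> hom P (P \<circledast> Q)"
proof -
  assume "group P" "group Q"
  then have "fp_incl (case_bool (image_group Inl P) (image_group Inr Q)) True \<in> hom (image_group Inl P) (P \<circledast> Q)"
    unfolding free_product2_def using group_family.fp_incl_hom[OF group_family2, of P Q True] by simp
  then show ?thesis
    using hom_compose[OF image_group_inj(2)[OF inj_Inl]] by (simp add: fp_inl_def[abs_def] comp_def)
qed

lemma fp_inr_hom: "group P \<Longrightarrow> group Q \<Longrightarrow> fp_inr P Q \<in> hom Q (P \<circledast> Q)"
proof -
  assume "group P" "group Q"
  then have "fp_incl (case_bool (image_group Inl P) (image_group Inr Q)) False \<in> hom (image_group Inr Q) (P \<circledast> Q)"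
    unfolding free_product2_def using group_family.fp_incl_hom[OF group_family2, of P Q False] by simp
  then show ?thesis
    using hom_compose[OF image_group_inj(2)[OF inj_Inr]] by (simp add: fp_inr_def[abs_def] comp_def)
qed

lemma free_product2_induct [consumes 3, case_names one inl inr]:
  assumes "group P" "group Q" "w \<in> carrier (P \<circledast> Q)" "S \<one>\<^bsub>P \<circledast> Q\<^esub>"
    and inl: "\<And>p w. p \<in> carrier P \<Longrightarrow> w \<in> carrier (P \<circledast> Q) \<Longrightarrow> S w \<Longrightarrow> S (fp_inl P Q p \<otimes>\<^bsub>P \<circledast> Q\<^esub> w)"
    and inr: "\<And>q w. q \<in> carrier Q \<Longrightarrow> w \<in> carrier (P \<circledast> Q) \<Longrightarrow> S w \<Longrightarrow> S (fp_inr P Q q \<otimes>\<^bsub>P \<circledast> Q\<^esub> w)"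
  shows "S w"
proof -
  interpret group_family UNIV "case_bool (image_group Inl P) (image_group Inr Q)"
    using assms by (intro group_family2)
  have "w \<in> carrier FP" using assms(3) by (simp add: free_product2_def)
  then show ?thesis
  proof (induction w rule: FP_induct)
    case one
    then show ?case using assms(4) by (simp add: free_product2_def)
  next
    case (mult i g w)
    show ?case
    proof (cases i)
      case True
      then obtain p where "g = Inl p" "p \<in> carrier P" using mult by (auto simp: image_group_def)
      then show ?thesis using inl[of p w] mult True by (simp add: free_product2_def fp_inl_def)
    next
      case False
      then obtain p where "g = Inr p" "p \<in> carrier Q" using mult by (auto simp: image_group_def)
      then show ?thesis using inr[of p w] mult False by (simp add: free_product2_def fp_inr_def)
    qed
  qed
qed

lemma fp_lift2_hom:
  assumes "group P" "group Q" "group H" "f \<in> hom P H" "g \<in> hom Q H"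
  shows "fp_lift2 H f g \<in> hom (P \<circledast> Q) H"
    and "\<And>p. p \<in> carrier P \<Longrightarrow> fp_lift2 H f g (fp_inl P Q p) = f p"
    and "\<And>q. q \<in> carrier Q \<Longrightarrow> fp_lift2 H f g (fp_inr P Q q) = g q"
proof -
  interpret group_family UNIV "case_bool (image_group Inl P) (image_group Inr Q)"
    using assms by (intro group_family2)
  let ?\<phi> = "case_bool (f \<circ> projl) (g \<circ> projr)"
  have \<phi>: "?\<phi> i \<in> hom (case_bool (image_group Inl P) (image_group Inr Q) i) H" for i
    using assms(4,5) by (auto simp: hom_def image_group_def Pi_def inv_into_f_f split: bool.splits)
  note lift = fp_lift_hom[OF assms(3) \<phi>]
  show "fp_lift2 H f g \<in> hom (P \<circledast> Q) H"
    unfolding fp_lift2_def free_product2_def by (rule lift(1))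
  show "fp_lift2 H f g (fp_inl P Q p) = f p" if "p \<in> carrier P" for p
    using lift(2)[of True "Inl p"] that by (simp add: fp_lift2_def fp_inl_def image_group_def)
  show "fp_lift2 H f g (fp_inr P Q p) = g p" if "p \<in> carrier Q" for p
    using lift(2)[of False "Inr p"] that by (simp add: fp_lift2_def fp_inr_def image_group_def)
qed

lemma free_product2_hom_eqI:
  assumes "group P" "group Q" "group H" "f \<in> hom (P \<circledast> Q) H" "f' \<in> hom (P \<circledast> Q) H" "w \<in> carrier (P \<circledast> Q)"
    and "\<And>p. p \<in> carrier P \<Longrightarrow> f (fp_inl P Q p) = f' (fp_inl P Q p)"
    and "\<And>q. q \<in> carrier Q \<Longrightarrow> f (fp_inr P Q q) = f' (fp_inr P Q q)"
  shows "f w = f' w"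
  using assms(1,2,6)
proof (induction w rule: free_product2_induct)
  case one
  show ?case using assms by (metis hom_one group_free_product2)
next
  case (inl p w)
  have "fp_inl P Q p \<in> carrier (P \<circledast> Q)" by (rule hom_in_carrier[OF fp_inl_hom[OF assms(1,2)] inl(1)])
  then show ?case using inl assms(7,8) by (simp add: hom_mult[OF assms(4)] hom_mult[OF assms(5)])
next
  case (inr q w)
  have "fp_inr P Q q \<in> carrier (P \<circledast> Q)" by (rule hom_in_carrier[OF fp_inr_hom[OF assms(1,2)] inr(1)])
  then show ?case using inr assms(7,8) by (simp add: hom_mult[OF assms(4)] hom_mult[OF assms(5)])
qed

lemma free_product2_generated:
  assumes "group P" "group Q" and S: "subgroup S (P \<circledast> Q)"
    and "\<And>p. p \<in> carrier P \<Longrightarrow> fp_inl P Q p \<in> S" "\<And>q. q \<in> carrier Q \<Longrightarrow> fp_inr P Q q \<in> S"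
  shows "carrier (P \<circledast> Q) \<subseteq> S"
proof
  fix w assume "w \<in> carrier (P \<circledast> Q)"
  with assms(1,2) show "w \<in> S"
    by (induction w rule: free_product2_induct)
      (use assms(4,5) subgroup.one_closed[OF S] subgroup.m_closed[OF S] in metis)+
qed

section \<open>Lifting homomorphisms from free groups\<close>

text \<open>
  Free groups are projective: choose preimages of the images of the basis elements.
\<close>
lemma free_group_lift:
  fixes F :: "'f monoid" and G :: "'g monoid" and Q :: "'q monoid"
  assumes F: "is_free_group F" and "group G" and epi: "\<omega> \<in> epi G Q" and "group Q" and f: "f \<in> hom F Q"
  obtains h where "h \<in> hom F G" "\<And>x. x \<in> carrier F \<Longrightarrow> \<omega> (h x) = f x"
proof -
  interpret G: group G by fact
  interpret Q: group Q by fact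
  obtain X where X: "free_basis F X" using F by (auto simp: is_free_group_def)
  then have gF: "group F" and XF: "X \<subseteq> carrier F" and iso: "word_eval F (\<lambda>x. x) \<in> iso (free_group X) F"
    by (auto simp: free_basis_def)
  interpret F: group F by fact
  interpret group_family X "\<lambda>_. integer_group" by (rule group_family.intro) (rule group_integer_group)
  have \<omega>: "\<omega> \<in> hom G Q" and surj: "\<omega> ` carrier G = carrier Q" using epi by (auto simp: epi_def)
  have "\<exists>s. \<forall>x\<in>X. s x \<in> carrier G \<and> \<omega> (s x) = f x"
    using XF hom_in_carrier[OF f] surj by (intro bchoice) (metis imageE subset_iff)
  then obtain s where s: "\<And>x. x \<in> X \<Longrightarrow> s x \<in> carrier G" "\<And>x. x \<in> X \<Longrightarrow> \<omega> (s x) = f x" by auto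
  have powhom1: "(\<lambda>n. x [^]\<^bsub>G\<^esub> (n::int)) \<in> hom integer_group G" if "x \<in> carrier G" for x
    using that by (auto simp: hom_def G.int_pow_mult)
  have powhom2: "(\<lambda>n. x [^]\<^bsub>F\<^esub> (n::int)) \<in> hom integer_group F" if "x \<in> carrier F" for x
    using that by (auto simp: hom_def F.int_pow_mult)
  have "\<And>x. x \<in> X \<Longrightarrow> (\<lambda>n. s x [^]\<^bsub>G\<^esub> n) \<in> hom integer_group G" by (intro powhom1 s(1))
  note lift = fp_lift_hom[OF assms(2) this]
  have ws: "word_eval G s \<in> hom FP G" "\<And>x n. x \<in> X \<Longrightarrow> word_eval G s (fp_incl (\<lambda>_. integer_group) x n) = s x [^]\<^bsub>G\<^esub> n"
    unfolding word_eval_def by (rule lift(1), assumption) (rule lift(2), simp_all)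
  have "\<And>x. x \<in> X \<Longrightarrow> (\<lambda>n. x [^]\<^bsub>F\<^esub> n) \<in> hom integer_group F" using XF by (intro powhom2) blast
  note lift = fp_lift_hom[OF gF this]
  have we: "word_eval F (\<lambda>x. x) \<in> hom FP F" "\<And>x n. x \<in> X \<Longrightarrow> word_eval F (\<lambda>x. x) (fp_incl (\<lambda>_. integer_group) x n) = x [^]\<^bsub>F\<^esub> n"
    unfolding word_eval_def by (rule lift(1), assumption) (rule lift(2), simp_all)
  define \<mu> where "\<mu> = inv_into (carrier FP) (word_eval F (\<lambda>x. x))"
  have iso': "word_eval F (\<lambda>x. x) \<in> iso FP F" using iso by (simp add: free_group_def)
  have \<mu>: "\<mu> \<in> hom F FP"
    unfolding \<mu>_def using group.iso_set_sym[OF group_FP iso'] by (simp add: iso_def)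
  have \<mu>_inv: "word_eval F (\<lambda>x. x) (\<mu> y) = y" if "y \<in> carrier F" for y
    unfolding \<mu>_def using iso' that by (intro f_inv_into_f) (auto simp: iso_def bij_betw_def)
  have key: "\<omega> (word_eval G s w) = f (word_eval F (\<lambda>x. x) w)" if "w \<in> carrier FP" for w
  proof -
    have "(\<omega> \<circ> word_eval G s) w = (f \<circ> word_eval F (\<lambda>x. x)) w"
    proof (rule FP_hom_eqI[OF assms(4)])
      show "\<omega> \<circ> word_eval G s \<in> hom FP Q" "f \<circ> word_eval F (\<lambda>x. x) \<in> hom FP Q"
        using hom_compose[OF ws(1) \<omega>] hom_compose[OF we(1) f] by auto
      fix x and n :: int assume "x \<in> X"
      interpret \<omega>: group_hom G Q \<omega> using \<omega> by unfold_locales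
      interpret f: group_hom F Q f using f by unfold_locales
      show "(\<omega> \<circ> word_eval G s) (fp_incl (\<lambda>_. integer_group) x n) =
          (f \<circ> word_eval F (\<lambda>x. x)) (fp_incl (\<lambda>_. integer_group) x n)"
        using \<open>x \<in> X\<close> s XF by (auto simp: ws we \<omega>.hom_int_pow f.hom_int_pow subset_iff)
    qed (fact that)
    then show ?thesis by simp
  qed
  show ?thesis
  proof (rule that[of "word_eval G s \<circ> \<mu>"])
    show "word_eval G s \<circ> \<mu> \<in> hom F G" using hom_compose[OF \<mu> ws(1)] .
    show "\<omega> ((word_eval G s \<circ> \<mu>) x) = f x" if "x \<in> carrier F" for x
      using key[of "\<mu> x"] \<mu>_inv[OF that] hom_in_carrier[OF \<mu> that] by simp
  qed
qed

section \<open>Commutator subgroups\<close>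

text \<open>
  The commutator operations are defined for records without further fields, hence this specialisation of
  \<^locale>\<open>group\<close>, and likewise of \<^locale>\<open>group_hom\<close> below.
\<close>
locale plain_group = group G for G :: "'a monoid" (structure)
begin

abbreviation comm where "comm \<equiv> commutator G"

lemma comm_closed [simp, intro]: "x \<in> carrier G \<Longrightarrow> y \<in> carrier G \<Longrightarrow> comm x y \<in> carrier G"
  by (simp add: commutator_def)

lemma inv_mult_cancel: "x \<in> carrier G \<Longrightarrow> y \<in> carrier G \<Longrightarrow> inv x \<otimes> (x \<otimes> y) = y"
  "x \<in> carrier G \<Longrightarrow> y \<in> carrier G \<Longrightarrow> x \<otimes> (inv x \<otimes> y) = y"
  by (simp_all flip: m_assoc)

lemmas group_simps = m_assoc inv_mult_group inv_mult_cancel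

lemma comm_mult_left:
  "\<lbrakk>x \<in> carrier G; x' \<in> carrier G; y \<in> carrier G\<rbrakk> \<Longrightarrow>
    comm (x \<otimes> x') y = (inv x' \<otimes> comm x y \<otimes> x') \<otimes> comm x' y"
  by (simp add: commutator_def group_simps)

lemma comm_mult_right:
  "\<lbrakk>x \<in> carrier G; y \<in> carrier G; y' \<in> carrier G\<rbrakk> \<Longrightarrow>
    comm x (y \<otimes> y') = comm x y' \<otimes> (inv y' \<otimes> comm x y \<otimes> y')"
  by (simp add: commutator_def group_simps)

lemma comm_inv_left:
  "\<lbrakk>x \<in> carrier G; y \<in> carrier G\<rbrakk> \<Longrightarrow> comm (inv x) y = x \<otimes> inv (comm x y) \<otimes> inv x"
  by (simp add: commutator_def group_simps)

lemma inv_comm: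
  "\<lbrakk>x \<in> carrier G; y \<in> carrier G\<rbrakk> \<Longrightarrow> inv (comm x y) = comm y x"
  by (simp add: commutator_def group_simps)

lemma comm_conj:
  "\<lbrakk>x \<in> carrier G; y \<in> carrier G; g \<in> carrier G\<rbrakk> \<Longrightarrow>
    g \<otimes> comm x y \<otimes> inv g = comm (g \<otimes> x \<otimes> inv g) (g \<otimes> y \<otimes> inv g)"
  by (simp add: commutator_def group_simps)

lemma hall_witt:
  assumes "x \<in> carrier G" "y \<in> carrier G" "z \<in> carrier G"
  shows "(inv y \<otimes> comm (comm x (inv y)) z \<otimes> y) \<otimes> (inv z \<otimes> comm (comm y (inv z)) x \<otimes> z)
    \<otimes> (inv x \<otimes> comm (comm z (inv x)) y \<otimes> x) = \<one>"
  using assms by (simp add: commutator_def group_simps)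

lemma normal_closed:
  assumes "N \<lhd> G" shows "subgroup N G" "N \<subseteq> carrier G" "\<one> \<in> N"
    "\<And>x y. x \<in> N \<Longrightarrow> y \<in> N \<Longrightarrow> x \<otimes> y \<in> N" "\<And>x. x \<in> N \<Longrightarrow> inv x \<in> N"
    "\<And>g x. g \<in> carrier G \<Longrightarrow> x \<in> N \<Longrightarrow> g \<otimes> x \<otimes> inv g \<in> N"
    "\<And>g x. g \<in> carrier G \<Longrightarrow> x \<in> N \<Longrightarrow> inv g \<otimes> x \<otimes> g \<in> N"
proof -
  interpret N: normal N G by fact
  show "subgroup N G" by unfold_locales
  show "N \<subseteq> carrier G" by (rule N.subset)
  show "\<one> \<in> N" by simp
  show "\<And>x y. x \<in> N \<Longrightarrow> y \<in> N \<Longrightarrow> x \<otimes> y \<in> N" by simp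
  show "\<And>x. x \<in> N \<Longrightarrow> inv x \<in> N" by simp
  show "\<And>g x. g \<in> carrier G \<Longrightarrow> x \<in> N \<Longrightarrow> g \<otimes> x \<otimes> inv g \<in> N" by (rule N.inv_op_closed2)
  show "\<And>g x. g \<in> carrier G \<Longrightarrow> x \<in> N \<Longrightarrow> inv g \<otimes> x \<otimes> g \<in> N" by (rule N.inv_op_closed1)
qed

lemma rcos_eq_iff:
  assumes "N \<lhd> G" "a \<in> carrier G" "b \<in> carrier G"
  shows "N #> a = N #> b \<longleftrightarrow> a \<otimes> inv b \<in> N"
proof -
  interpret N: normal N G by fact
  show ?thesis
    using assms by (metis N.rcos_module N.is_subgroup is_group repr_independence rcos_self)
qed

text \<open>
  With this subgroup, an inclusion of commutator subgroups in a normal subgroup can be checked on generators.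
\<close>
lemma subgroup_mod_centraliser:
  assumes N: "N \<lhd> G" and Y: "Y \<subseteq> carrier G"
  shows "subgroup {x \<in> carrier G. \<forall>y\<in>Y. comm x y \<in> N} G"
proof (rule subgroupI)
  note n = normal_closed[OF N]
  show "{x \<in> carrier G. \<forall>y\<in>Y. comm x y \<in> N} \<noteq> {}"
    using n(3) Y by (auto intro!: exI[of _ "\<one>"] simp: commutator_def subset_iff)
  show "inv a \<in> {x \<in> carrier G. \<forall>y\<in>Y. comm x y \<in> N}" if "a \<in> {x \<in> carrier G. \<forall>y\<in>Y. comm x y \<in> N}" for a
    using that Y n by (auto simp: comm_inv_left subset_iff)
  show "a \<otimes> b \<in> {x \<in> carrier G. \<forall>y\<in>Y. comm x y \<in> N}" if "a \<in> {x \<in> carrier G. \<forall>y\<in>Y. comm x y \<in> N}"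
     "b \<in> {x \<in> carrier G. \<forall>y\<in>Y. comm x y \<in> N}" for a b
    using that Y n by (auto simp: comm_mult_left subset_iff)
qed auto

lemma comm_swap_mem:
  assumes "N \<lhd> G" "x \<in> carrier G" "y \<in> carrier G"
  shows "comm x y \<in> N \<longleftrightarrow> comm y x \<in> N"
  using assms normal_closed(5)[OF assms(1)] inv_comm by metis

lemma commutator_subgroup_mem:
  "x \<in> X \<Longrightarrow> y \<in> Y \<Longrightarrow> comm x y \<in> commutator_subgroup G X Y"
  by (auto simp: commutator_subgroup_def intro: generate.incl)

lemma commutator_subgroup_le:
  assumes "subgroup N G" "\<And>x y. x \<in> X \<Longrightarrow> y \<in> Y \<Longrightarrow> comm x y \<in> N"
  shows "commutator_subgroup G X Y \<subseteq> N"
  unfolding commutator_subgroup_def using assms by (intro generate_subgroup_incl) auto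

lemma commutator_subgroup_normal:
  assumes X: "X \<lhd> G" and Y: "Y \<lhd> G" shows "commutator_subgroup G X Y \<lhd> G"
  unfolding commutator_subgroup_def
proof (rule normal_generateI)
  note x = normal_closed[OF X] and y = normal_closed[OF Y]
  show "{comm u v |u v. u \<in> X \<and> v \<in> Y} \<subseteq> carrier G" using x(2) y(2) by auto
  fix h g assume "h \<in> {comm u v |u v. u \<in> X \<and> v \<in> Y}" and g: "g \<in> carrier G"
  then obtain u v where "h = comm u v" "u \<in> X" "v \<in> Y" by auto
  moreover from this g have "g \<otimes> h \<otimes> inv g = comm (g \<otimes> u \<otimes> inv g) (g \<otimes> v \<otimes> inv g)"
    using x(2) y(2) by (auto intro: comm_conj)
  ultimately show "g \<otimes> h \<otimes> inv g \<in> {comm u v |u v. u \<in> X \<and> v \<in> Y}"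
    using x(6) y(6) g by blast
qed

lemma commutator_subgroup_mono:
  "X \<subseteq> X' \<Longrightarrow> Y \<subseteq> Y' \<Longrightarrow> commutator_subgroup G X Y \<subseteq> commutator_subgroup G X' Y'"
  unfolding commutator_subgroup_def by (rule mono_generate) auto

lemma commutator_subgroup_incl_left:
  assumes X: "X \<lhd> G" and Y: "Y \<subseteq> carrier G" shows "commutator_subgroup G X Y \<subseteq> X"
proof (rule commutator_subgroup_le)
  note x = normal_closed[OF X]
  fix u v assume *: "u \<in> X" "v \<in> Y"
  then have "inv u \<otimes> (inv v \<otimes> u \<otimes> v) \<in> X" using x(4,5,7) Y by auto
  then show "comm u v \<in> X" using * x(2) Y by (simp add: commutator_def m_assoc subset_iff)
qed (use normal_closed[OF X] in auto)

lemma carrier_normal: "carrier G \<lhd> G"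
  by (rule normal_invI[OF subgroup_self]) auto

text \<open>
  The Hall-Witt identity writes a conjugate of \<open>[[w, u], v]\<close> as a product of conjugates of elements of the other
  two commutator subgroups.
\<close>
lemma three_subgroups:
  assumes X: "X \<lhd> G" and Y: "Y \<lhd> G" and Z: "Z \<lhd> G" and N: "N \<lhd> G"
    and 1: "commutator_subgroup G (commutator_subgroup G X Y) Z \<subseteq> N"
    and 2: "commutator_subgroup G (commutator_subgroup G Y Z) X \<subseteq> N"
  shows "commutator_subgroup G (commutator_subgroup G Z X) Y \<subseteq> N"
proof -
  note x = normal_closed[OF X] and y = normal_closed[OF Y] and z = normal_closed[OF Z] and n = normal_closed[OF N]
  have basic: "comm (comm w u) v \<in> N" if u: "u \<in> X" and v: "v \<in> Y" and w: "w \<in> Z" for u v w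
  proof -
    have c: "inv u \<in> carrier G" "v \<in> carrier G" "w \<in> carrier G" "inv v \<in> carrier G" "inv w \<in> carrier G" "u \<in> carrier G"
      using u v w x(2) y(2) z(2) by auto
    have "comm (comm (inv u) (inv v)) w \<in> N"
      by (intro subsetD[OF 1] commutator_subgroup_mem x(5)[OF u] y(5)[OF v] w)
    moreover have "comm (comm v (inv w)) (inv u) \<in> N"
      by (intro subsetD[OF 2] commutator_subgroup_mem x(5)[OF u] z(5)[OF w] v)
    ultimately have a: "comm (comm (inv u) (inv v)) w \<in> N" "comm (comm v (inv w)) (inv u) \<in> N" .
    let ?a = "inv v \<otimes> comm (comm (inv u) (inv v)) w \<otimes> v"
    let ?b = "inv w \<otimes> comm (comm v (inv w)) (inv u) \<otimes> w"
    let ?c = "comm (comm w u) v"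
    have ab: "?a \<otimes> ?b \<in> N" by (intro n(4) n(7) a c)
    have "?a \<otimes> ?b \<otimes> (u \<otimes> ?c \<otimes> inv u) = \<one>"
      using hall_witt[of "inv u" v w] c by simp
    moreover have ab_c: "?a \<otimes> ?b \<in> carrier G" and "u \<otimes> ?c \<otimes> inv u \<in> carrier G" using c by auto
    ultimately have "inv (?a \<otimes> ?b) = u \<otimes> ?c \<otimes> inv u" by (metis inv_equality inv_inv)
    then have "u \<otimes> ?c \<otimes> inv u \<in> N" using ab n(5) by metis
    then have "inv u \<otimes> (u \<otimes> ?c \<otimes> inv u) \<otimes> u \<in> N" by (intro n(7) c)
    then show ?thesis using c by (simp add: group_simps)
  qed
  have "commutator_subgroup G Z X \<subseteq> {x \<in> carrier G. \<forall>y\<in>Y. comm x y \<in> N}"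
    using basic x(2) z(2) by (intro commutator_subgroup_le subgroup_mod_centraliser N y(2)) auto
  then show ?thesis by (intro commutator_subgroup_le n(1)) auto
qed

lemma commutator_subgroup_commute:
  assumes "X \<subseteq> carrier G" "Y \<subseteq> carrier G"
  shows "commutator_subgroup G X Y = commutator_subgroup G Y X"
proof -
  have "commutator_subgroup G X Y \<subseteq> commutator_subgroup G Y X" if "X \<subseteq> carrier G" "Y \<subseteq> carrier G" for X Y
  proof (rule commutator_subgroup_le)
    show s: "subgroup (commutator_subgroup G Y X) G"
      unfolding commutator_subgroup_def using that by (intro generate_is_subgroup) auto
    fix x y assume "x \<in> X" "y \<in> Y"
    then have "inv (comm y x) \<in> commutator_subgroup G Y X"
      by (intro subgroup.m_inv_closed[OF s] commutator_subgroup_mem)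
    then show "comm x y \<in> commutator_subgroup G Y X"
      using that \<open>x \<in> X\<close> \<open>y \<in> Y\<close> by (simp add: inv_comm subset_iff)
  qed
  then show ?thesis using assms by blast
qed

abbreviation icomm where "icomm X c \<equiv> iter_commutator G X c (carrier G)"

lemma icomm_0: "icomm X 0 = X" by (simp add: iter_commutator_def)
lemma icomm_Suc: "icomm X (Suc c) = commutator_subgroup G (icomm X c) (carrier G)" by (simp add: iter_commutator_def)
lemma icomm_Suc2: "icomm X (Suc c) = icomm (commutator_subgroup G X (carrier G)) c"
  unfolding iter_commutator_def funpow_Suc_right by simp

lemma icomm_normal: "X \<lhd> G \<Longrightarrow> icomm X c \<lhd> G"
  by (induction c) (auto simp: icomm_0 icomm_Suc intro: commutator_subgroup_normal carrier_normal)

lemma icomm_mono: "X \<subseteq> Y \<Longrightarrow> icomm X c \<subseteq> icomm Y c"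
  by (induction c) (simp_all add: icomm_0 icomm_Suc commutator_subgroup_mono)

lemma icomm_le: "X \<lhd> G \<Longrightarrow> icomm X c \<subseteq> X"
proof (induction c)
  case (Suc c)
  have "icomm X (Suc c) \<subseteq> icomm X c"
    unfolding icomm_Suc by (rule commutator_subgroup_incl_left[OF icomm_normal[OF Suc.prems]]) simp
  then show ?case using Suc by auto
qed (simp add: icomm_0)

text \<open>
  \<open>icomm (carrier G) c\<close> is \<open>\<gamma>\<^sub>c\<^sub>+\<^sub>1(G)\<close>.  In the induction step, \<open>[[L, G], R]\<close> with \<open>L = \<gamma>\<^sub>c\<^sub>+\<^sub>1(G)\<close> is controlled by
  \<open>[[R, L], G]\<close> and \<open>[[G, R], L]\<close>; for the second, the induction hypothesis is applied to \<open>[R, G]\<close> in place of \<open>R\<close>.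
\<close>
lemma comm_lower_central:
  assumes "R \<lhd> G"
  shows "commutator_subgroup G R (icomm (carrier G) c) \<subseteq> icomm R (Suc c)"
  using assms
proof (induction c arbitrary: R)
  case 0
  show ?case by (simp add: icomm_0 icomm_Suc)
next
  case (Suc c)
  let ?C = "carrier G" and ?L = "icomm (carrier G) c" and ?N = "icomm R (Suc (Suc c))"
  note R = Suc.prems
  have norm: "?L \<lhd> G" "?C \<lhd> G" "?N \<lhd> G" by (auto intro: icomm_normal carrier_normal R)
  note sub = normal_closed(2)[OF norm(1)] normal_closed(2)[OF R]
  have "commutator_subgroup G (commutator_subgroup G R ?L) ?C \<subseteq> ?N"
    unfolding icomm_Suc[of R "Suc c"] by (rule commutator_subgroup_mono[OF Suc.IH[OF R]]) simp
  moreover have "commutator_subgroup G (commutator_subgroup G ?C R) ?L \<subseteq> ?N"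
    unfolding icomm_Suc2[of R "Suc c"] commutator_subgroup_commute[OF subset_refl sub(2)]
    by (rule Suc.IH) (rule commutator_subgroup_normal[OF R norm(2)])
  ultimately have "commutator_subgroup G (commutator_subgroup G ?L ?C) R \<subseteq> ?N"
    by (intro three_subgroups[OF norm(2) R norm(1) norm(3)])
  then show ?case
    unfolding icomm_Suc[of ?C c]
    using commutator_subgroup_commute[of "commutator_subgroup G ?L ?C" R] sub(2)
      normal_closed(2)[OF commutator_subgroup_normal[OF norm(1,2)]] by simp
qed

end

locale plain_group_hom = group_hom G H h
  for G :: "'a monoid" (structure) and H :: "'b monoid" (structure) and h
begin

sublocale G: plain_group G by (rule plain_group.intro) (rule G.group_axioms)
sublocale H: plain_group H by (rule plain_group.intro) (rule H.group_axioms)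

lemma hom_comm: "x \<in> carrier G \<Longrightarrow> y \<in> carrier G \<Longrightarrow> h (commutator G x y) = commutator H (h x) (h y)"
  by (simp add: commutator_def)

lemma hom_commutator_subgroup:
  assumes "X \<subseteq> carrier G" "Y \<subseteq> carrier G"
  shows "h ` commutator_subgroup G X Y = commutator_subgroup H (h ` X) (h ` Y)"
proof -
  have "h ` {commutator G x y |x y. x \<in> X \<and> y \<in> Y} = (\<lambda>(x, y). h (commutator G x y)) ` (X \<times> Y)"
    by force
  also have "\<dots> = (\<lambda>(x, y). commutator H (h x) (h y)) ` (X \<times> Y)"
    using assms by (intro image_cong) (auto simp: hom_comm subset_iff)
  also have "\<dots> = {commutator H x y |x y. x \<in> h ` X \<and> y \<in> h ` Y}"
    by force
  finally have eq: "h ` {commutator G x y |x y. x \<in> X \<and> y \<in> Y}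
      = {commutator H x y |x y. x \<in> h ` X \<and> y \<in> h ` Y}" .
  have "{commutator G x y |x y. x \<in> X \<and> y \<in> Y} \<subseteq> carrier G"
    using assms by auto
  from generate_img[OF this] show ?thesis unfolding commutator_subgroup_def eq by (rule sym)
qed

lemma hom_icomm_le:
  assumes "X \<lhd> G" shows "h ` iter_commutator G X c (carrier G) \<subseteq> iter_commutator H (h ` X) c (carrier H)"
proof (induction c)
  case 0
  then show ?case by (simp add: iter_commutator_def)
next
  case (Suc c)
  have "h ` iter_commutator G X (Suc c) (carrier G)
    = commutator_subgroup H (h ` iter_commutator G X c (carrier G)) (h ` carrier G)"
    unfolding G.icomm_Suc
    using G.normal_closed(2)[OF G.icomm_normal[OF assms]] by (intro hom_commutator_subgroup) auto
  also have "\<dots> \<subseteq> iter_commutator H (h ` X) (Suc c) (carrier H)"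
    unfolding H.icomm_Suc using Suc by (intro H.commutator_subgroup_mono) auto
  finally show ?case .
qed

lemma hom_icomm:
  assumes "X \<lhd> G" and "h ` carrier G = carrier H"
  shows "h ` iter_commutator G X c (carrier G) = iter_commutator H (h ` X) c (carrier H)"
proof (induction c)
  case 0
  then show ?case by (simp add: iter_commutator_def)
next
  case (Suc c)
  have "h ` iter_commutator G X (Suc c) (carrier G)
    = commutator_subgroup H (h ` iter_commutator G X c (carrier G)) (h ` carrier G)"
    unfolding G.icomm_Suc
    using G.normal_closed(2)[OF G.icomm_normal[OF assms(1)]] by (intro hom_commutator_subgroup) auto
  then show ?case
    unfolding H.icomm_Suc using Suc assms(2) by simp
qed

end

lemma plain_group_homI:
  "group G \<Longrightarrow> group H \<Longrightarrow> h \<in> hom G H \<Longrightarrow> plain_group_hom G H h"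
  by (intro plain_group_hom.intro group_hom.intro group_hom_axioms.intro)

text \<open>
  Induction on \<open>c\<close>: if \<open>\<alpha> x = s (\<beta> x)\<close> with \<open>s\<close> in \<open>[T, K, \<dots>, K]\<close> and \<open>\<alpha> y = t (\<beta> y)\<close> with \<open>t\<close> in \<open>T\<close>, then
  \<open>[\<alpha> x, \<alpha> y]\<close> differs from \<open>[\<beta> x, \<beta> y]\<close> by conjugates of \<open>[s, \<alpha> y]\<close> and \<open>[\<beta> x, t]\<close>.  The former is
  in the next term by definition, the latter by \<open>comm_lower_central\<close>.
\<close>
lemma homs_cong_lower_central:
  assumes \<alpha>: "plain_group_hom L K \<alpha>" and \<beta>: "plain_group_hom L K \<beta>" and T: "T \<lhd> K"
    and cong: "\<And>x. x \<in> carrier L \<Longrightarrow> \<alpha> x \<otimes>\<^bsub>K\<^esub> inv\<^bsub>K\<^esub> \<beta> x \<in> T"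
    and x: "x \<in> iter_commutator L (carrier L) c (carrier L)"
  shows "\<alpha> x \<otimes>\<^bsub>K\<^esub> inv\<^bsub>K\<^esub> \<beta> x \<in> iter_commutator K T c (carrier K)"
  using x
proof (induction c arbitrary: x)
  case 0
  interpret plain_group_hom L K \<alpha> by fact
  show ?case using 0 cong by (simp add: H.icomm_0 G.icomm_0)
next
  case (Suc c)
  interpret a: plain_group_hom L K \<alpha> by fact
  interpret b: plain_group_hom L K \<beta> by fact
  let ?N = "iter_commutator K T (Suc c) (carrier K)"
  let ?M = "iter_commutator K T c (carrier K)"
  let ?L = "iter_commutator L (carrier L) c (carrier L)"
  have N: "?N \<lhd> K" and M: "?M \<lhd> K" by (rule a.H.icomm_normal[OF T])+
  have NM: "?N = commutator_subgroup K ?M (carrier K)" by (rule a.H.icomm_Suc)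
  note n = a.H.normal_closed[OF N] and m = a.H.normal_closed[OF M] and t = a.H.normal_closed[OF T]
  have Lsub: "?L \<subseteq> carrier L"
    by (rule a.G.normal_closed(2)[OF a.G.icomm_normal[OF a.G.carrier_normal]])
  interpret N: normal ?N K by (rule N)
  have sub: "subgroup {x \<in> carrier L. ?N #>\<^bsub>K\<^esub> \<alpha> x = ?N #>\<^bsub>K\<^esub> \<beta> x} L"
  proof (rule a.G.subgroupI)
    show "{x \<in> carrier L. ?N #>\<^bsub>K\<^esub> \<alpha> x = ?N #>\<^bsub>K\<^esub> \<beta> x} \<noteq> {}"
      by (auto intro!: exI[of _ "\<one>\<^bsub>L\<^esub>"])
    show "inv\<^bsub>L\<^esub> y \<in> {x \<in> carrier L. ?N #>\<^bsub>K\<^esub> \<alpha> x = ?N #>\<^bsub>K\<^esub> \<beta> x}" if "y \<in> {x \<in> carrier L. ?N #>\<^bsub>K\<^esub> \<alpha> x = ?N #>\<^bsub>K\<^esub> \<beta> x}" for y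
      using that N.rcos_inv[of "\<alpha> y"] N.rcos_inv[of "\<beta> y"] by auto
    show "y \<otimes>\<^bsub>L\<^esub> z \<in> {x \<in> carrier L. ?N #>\<^bsub>K\<^esub> \<alpha> x = ?N #>\<^bsub>K\<^esub> \<beta> x}" if "y \<in> {x \<in> carrier L. ?N #>\<^bsub>K\<^esub> \<alpha> x = ?N #>\<^bsub>K\<^esub> \<beta> x}"
      "z \<in> {x \<in> carrier L. ?N #>\<^bsub>K\<^esub> \<alpha> x = ?N #>\<^bsub>K\<^esub> \<beta> x}" for y z
      using that N.rcos_sum[of "\<alpha> y" "\<alpha> z"] N.rcos_sum[of "\<beta> y" "\<beta> z"] by auto
  qed auto
  note rcos = a.H.rcos_eq_iff[OF N]
  have "commutator_subgroup L ?L (carrier L) \<subseteq> {x \<in> carrier L. ?N #>\<^bsub>K\<^esub> \<alpha> x = ?N #>\<^bsub>K\<^esub> \<beta> x}"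
  proof (rule a.G.commutator_subgroup_le[OF sub])
    fix x y assume x: "x \<in> ?L" and y: "y \<in> carrier L"
    let ?s = "\<alpha> x \<otimes>\<^bsub>K\<^esub> inv\<^bsub>K\<^esub> \<beta> x" and ?t = "\<alpha> y \<otimes>\<^bsub>K\<^esub> inv\<^bsub>K\<^esub> \<beta> y"
    have xc: "x \<in> carrier L" using x Lsub by auto
    have s: "?s \<in> ?M" by (rule Suc.IH[OF x])
    have t': "?t \<in> T" by (rule cong[OF y])
    have c: "?s \<in> carrier K" "?t \<in> carrier K" using m(2) s t(2) t' by auto
    have "\<beta> x \<in> iter_commutator K (carrier K) c (carrier K)"
      using b.hom_icomm_le[OF a.G.carrier_normal, of c] x
        a.H.icomm_mono[of "\<beta> ` carrier L" "carrier K" c] b.hom_closed by blast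
    then have "commutator K ?t (\<beta> x) \<in> commutator_subgroup K T (iter_commutator K (carrier K) c (carrier K))"
      by (rule a.H.commutator_subgroup_mem[OF t'])
    then have 1: "commutator K ?t (\<beta> x) \<in> ?N" using a.H.comm_lower_central[OF T] by auto
    then have 1: "commutator K (\<beta> x) ?t \<in> ?N" using xc c by (subst a.H.comm_swap_mem[OF N]) auto
    have 2: "commutator K ?s (\<alpha> y) \<in> ?N" unfolding NM using s y by (intro a.H.commutator_subgroup_mem) auto
    have ax: "\<alpha> x = ?s \<otimes>\<^bsub>K\<^esub> \<beta> x" and ay: "\<alpha> y = ?t \<otimes>\<^bsub>K\<^esub> \<beta> y" using xc y by (simp_all add: a.H.group_simps)
    have "commutator K (\<alpha> x) (\<alpha> y) = inv\<^bsub>K\<^esub> \<beta> x \<otimes>\<^bsub>K\<^esub> commutator K ?s (\<alpha> y) \<otimes>\<^bsub>K\<^esub> \<beta> x \<otimes>\<^bsub>K\<^esub> commutator K (\<beta> x) (\<alpha> y)"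
      by (subst ax, rule a.H.comm_mult_left) (use xc y c in auto)
    also have "commutator K (\<beta> x) (\<alpha> y) =
      commutator K (\<beta> x) (\<beta> y) \<otimes>\<^bsub>K\<^esub> (inv\<^bsub>K\<^esub> \<beta> y \<otimes>\<^bsub>K\<^esub> commutator K (\<beta> x) ?t \<otimes>\<^bsub>K\<^esub> \<beta> y)"
      by (subst ay, rule a.H.comm_mult_right) (use xc y c in auto)
    finally have e: "commutator K (\<alpha> x) (\<alpha> y) \<otimes>\<^bsub>K\<^esub> inv\<^bsub>K\<^esub> (commutator K (\<beta> x) (\<beta> y))
      = (inv\<^bsub>K\<^esub> \<beta> x \<otimes>\<^bsub>K\<^esub> commutator K ?s (\<alpha> y) \<otimes>\<^bsub>K\<^esub> \<beta> x) \<otimes>\<^bsub>K\<^esub>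
      (commutator K (\<beta> x) (\<beta> y) \<otimes>\<^bsub>K\<^esub> (inv\<^bsub>K\<^esub> \<beta> y \<otimes>\<^bsub>K\<^esub> commutator K (\<beta> x) ?t \<otimes>\<^bsub>K\<^esub> \<beta> y)
        \<otimes>\<^bsub>K\<^esub> inv\<^bsub>K\<^esub> (commutator K (\<beta> x) (\<beta> y)))"
      using xc y c by (simp add: a.H.m_assoc)
    have "commutator K (\<alpha> x) (\<alpha> y) \<otimes>\<^bsub>K\<^esub> inv\<^bsub>K\<^esub> (commutator K (\<beta> x) (\<beta> y)) \<in> ?N"
      unfolding e using 1 2 xc y by (intro n(4,6,7)) auto
    then show "commutator L x y \<in> {x \<in> carrier L. ?N #>\<^bsub>K\<^esub> \<alpha> x = ?N #>\<^bsub>K\<^esub> \<beta> x}"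
      using xc y by (simp add: a.hom_comm b.hom_comm rcos)
  qed
  then show ?case using Suc.prems rcos unfolding a.G.icomm_Suc by auto
qed

section \<open>Baer's theorem on finite lower central terms\<close>

lemma finite_image_determined:
  assumes "finite (f ` S)" and "\<And>x y. x \<in> S \<Longrightarrow> y \<in> S \<Longrightarrow> f x = f y \<Longrightarrow> h x = h y"
  shows "finite (h ` S)"
proof -
  have "h x = h (inv_into S f (f x))" if "x \<in> S" for x
    using that by (intro assms(2)) (auto simp: inv_into_into f_inv_into_f)
  then have "h ` S \<subseteq> (\<lambda>y. h (inv_into S f y)) ` (f ` S)" by auto
  then show ?thesis by (rule finite_subset) (intro finite_imageI assms(1))
qed

context plain_group
begin

definition lprod :: "'a list \<Rightarrow> 'a" where "lprod xs = foldr (\<otimes>) xs \<one>"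

lemma lprod_simps [simp]: "lprod [] = \<one>" "lprod (x # xs) = x \<otimes> lprod xs"
  by (simp_all add: lprod_def)

lemma lprod_closed [simp]: "set xs \<subseteq> carrier G \<Longrightarrow> lprod xs \<in> carrier G"
  by (induction xs) auto

lemma lprod_append: "set xs \<subseteq> carrier G \<Longrightarrow> set ys \<subseteq> carrier G \<Longrightarrow> lprod (xs @ ys) = lprod xs \<otimes> lprod ys"
  by (induction xs) (auto simp: m_assoc)

lemma lprod_replicate: "x \<in> carrier G \<Longrightarrow> lprod (replicate n x) = x [^] n"
  by (induction n) (simp_all flip: nat_pow_Suc2)

text \<open>
  Moving the first occurrence of \<open>x\<close> to the front conjugates the letters before it.  As these differ from \<open>x\<close>,
  so do their conjugates by \<open>x\<close>, and the number of remaining occurrences is known exactly.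
\<close>
lemma lprod_pull:
  assumes C: "C \<subseteq> carrier G" and conj: "\<And>x y. x \<in> C \<Longrightarrow> y \<in> C \<Longrightarrow> inv y \<otimes> x \<otimes> y \<in> C"
    and "x \<in> set xs" "set xs \<subseteq> C"
  shows "\<exists>ys. set ys \<subseteq> C \<and> length xs = Suc (length ys) \<and> lprod xs = x \<otimes> lprod ys
    \<and> count_list xs x = Suc (count_list ys x)"
  using assms(3,4)
proof (induction xs)
  case (Cons a as)
  show ?case
  proof (cases "a = x")
    case True
    then show ?thesis using Cons by (intro exI[of _ as]) auto
  next
    case False
    then obtain ys where ys: "set ys \<subseteq> C" "length as = Suc (length ys)" "lprod as = x \<otimes> lprod ys"
      "count_list as x = Suc (count_list ys x)"
      using Cons by auto
    have c: "a \<in> carrier G" "x \<in> carrier G" "lprod ys \<in> carrier G" using Cons.prems C ys by auto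
    let ?b = "inv x \<otimes> a \<otimes> x"
    have "?b \<in> C" using Cons.prems by (auto intro: conj)
    moreover have "?b \<noteq> x"
    proof
      assume "?b = x"
      moreover have "x \<otimes> ?b \<otimes> inv x = a" using c by (simp add: group_simps)
      ultimately have "x \<otimes> x \<otimes> inv x = a" by simp
      then show False using c False by (simp add: group_simps)
    qed
    moreover have "a \<otimes> (x \<otimes> lprod ys) = x \<otimes> (?b \<otimes> lprod ys)" using c by (simp add: group_simps)
    ultimately show ?thesis using ys False by (intro exI[of _ "?b # ys"]) auto
  qed
qed simp

lemma lprod_gather:
  assumes C: "C \<subseteq> carrier G" and conj: "\<And>x y. x \<in> C \<Longrightarrow> y \<in> C \<Longrightarrow> inv y \<otimes> x \<otimes> y \<in> C"
    and "k \<le> count_list xs x" "set xs \<subseteq> C" "x \<in> C"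
  shows "\<exists>ys. set ys \<subseteq> C \<and> length xs = k + length ys \<and> lprod xs = x [^] k \<otimes> lprod ys"
  using assms(3,4)
proof (induction k arbitrary: xs)
  case 0
  then show ?case using C by (intro exI[of _ xs]) auto
next
  case (Suc k)
  then have "x \<in> set xs" by (metis count_list_0_iff not_less_eq_eq zero_le)
  then obtain ys where ys: "set ys \<subseteq> C" "length xs = Suc (length ys)" "lprod xs = x \<otimes> lprod ys"
      "count_list xs x = Suc (count_list ys x)"
    using lprod_pull[OF C conj _ Suc.prems(2)] by blast
  then obtain zs where zs: "set zs \<subseteq> C" "length ys = k + length zs" "lprod ys = x [^] k \<otimes> lprod zs"
    using Suc.IH[of ys] Suc.prems by auto
  have "x \<in> carrier G" "lprod zs \<in> carrier G" using C zs assms(5) by auto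
  then have "lprod xs = x [^] Suc k \<otimes> lprod zs"
    using ys(3) zs(3) by (simp only: nat_pow_Suc2 m_assoc nat_pow_closed)
  then show ?case using zs ys by (intro exI[of _ zs]) auto
qed

text \<open>
  Rosenlicht's argument: in a longer word some letter \<open>x\<close> occurs more than \<open>m\<close> times, and after gathering the
  occurrences, \<open>x [^] Suc m\<close> is replaced by \<open>m\<close> letters.
\<close>
lemma lprod_shorten:
  assumes C: "C \<subseteq> carrier G" "finite C" and conj: "\<And>x y. x \<in> C \<Longrightarrow> y \<in> C \<Longrightarrow> inv y \<otimes> x \<otimes> y \<in> C"
    and pow: "\<And>x. x \<in> C \<Longrightarrow> \<exists>ys. set ys \<subseteq> C \<and> length ys = m \<and> x [^] Suc m = lprod ys"
    and "set xs \<subseteq> C"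
  shows "\<exists>ys. set ys \<subseteq> C \<and> length ys \<le> m * card C \<and> lprod ys = lprod xs"
  using assms(5)
proof (induction "length xs" arbitrary: xs rule: less_induct)
  case less
  show ?case
  proof (cases "length xs \<le> m * card C")
    case False
    have "\<exists>x\<in>C. Suc m \<le> count_list xs x"
    proof (rule ccontr)
      assume "\<not> ?thesis"
      then have "sum (count_list xs) C \<le> (\<Sum>x\<in>C. m)" by (intro sum_mono) (auto simp: not_le)
      then show False using False sum_count_set[OF less.prems C(2)] by (simp add: mult.commute)
    qed
    then obtain x where x: "x \<in> C" "Suc m \<le> count_list xs x" by auto
    obtain ys where ys: "set ys \<subseteq> C" "length xs = Suc m + length ys" "lprod xs = x [^] Suc m \<otimes> lprod ys"
      using lprod_gather[OF C(1) conj x(2) less.prems x(1)] by blast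
    obtain zs where zs: "set zs \<subseteq> C" "length zs = m" "x [^] Suc m = lprod zs" using pow[OF x(1)] by blast
    have "\<exists>us. set us \<subseteq> C \<and> length us \<le> m * card C \<and> lprod us = lprod (zs @ ys)"
      using ys zs by (intro less.hyps) auto
    moreover have "lprod (zs @ ys) = lprod xs"
      using ys zs C(1) by (subst lprod_append) auto
    ultimately show ?thesis by simp
  qed (use less in blast)
qed

lemma finite_generate_bounded:
  assumes C: "C \<subseteq> carrier G" "finite C" and conj: "\<And>x y. x \<in> C \<Longrightarrow> y \<in> C \<Longrightarrow> inv y \<otimes> x \<otimes> y \<in> C"
    and inv: "\<And>x. x \<in> C \<Longrightarrow> inv x \<in> C"
    and pow: "\<And>x. x \<in> C \<Longrightarrow> \<exists>ys. set ys \<subseteq> C \<and> length ys = m \<and> x [^] Suc m = lprod ys"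
  shows "finite (generate G C)"
proof (rule finite_subset)
  show "finite (lprod ` {xs. set xs \<subseteq> C \<and> length xs \<le> m * card C})"
    using C by (intro finite_imageI finite_lists_length_le)
  show "generate G C \<subseteq> lprod ` {xs. set xs \<subseteq> C \<and> length xs \<le> m * card C}"
  proof
    fix g assume "g \<in> generate G C"
    then have "\<exists>xs. set xs \<subseteq> C \<and> lprod xs = g"
    proof induction
      case one
      show ?case by (intro exI[of _ "[]"]) auto
    next
      case (incl h)
      then show ?case using C by (intro exI[of _ "[h]"]) auto
    next
      case (inv h)
      then show ?case using C assms(4) by (intro exI[of _ "[inv h]"]) auto
    next
      case (eng h1 h2)
      then obtain xs ys where "set xs \<subseteq> C" "lprod xs = h1" "set ys \<subseteq> C" "lprod ys = h2" by blast
      then show ?case using C by (intro exI[of _ "xs @ ys"]) (auto simp: lprod_append)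
    qed
    then obtain xs where xs: "set xs \<subseteq> C" "lprod xs = g" by blast
    obtain ys where "set ys \<subseteq> C" "length ys \<le> m * card C" "lprod ys = lprod xs"
      using lprod_shorten[OF C conj pow xs(1)] by blast
    then show "g \<in> lprod ` {xs. set xs \<subseteq> C \<and> length xs \<le> m * card C}"
      using xs(2) by (intro image_eqI[of _ _ ys]) auto
  qed
qed

lemma conj_pow:
  assumes "x \<in> carrier G" "l \<in> carrier G" shows "inv l \<otimes> x [^] (n::nat) \<otimes> l = (inv l \<otimes> x \<otimes> l) [^] n"
proof (induction n)
  case (Suc n)
  have "inv l \<otimes> x [^] Suc n \<otimes> l = (inv l \<otimes> x [^] n \<otimes> l) \<otimes> (inv l \<otimes> x \<otimes> l)"
    using assms by (simp add: group_simps)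
  then show ?case using Suc by simp
qed (use assms in simp)

text \<open>
  A relative form of Schur's theorem.  Put \<open>x = [u, g]\<close> and \<open>x' = u\<^sup>-\<^sup>1 x u\<close>, so that \<open>[u\<^sup>2, g] = x' x\<close>.
  Since \<open>x\<^sup>m\<close> is central, it equals \<open>x'\<^sup>m\<close>, whence \<open>x\<^sup>m\<^sup>+\<^sup>1 = x'\<^sup>m\<^sup>-\<^sup>1 [u\<^sup>2, g]\<close> is a product of \<open>m\<close>
  commutators and \<open>finite_generate_bounded\<close> applies.
\<close>
lemma finite_commutator_subgroup:
  assumes L: "L \<lhd> G" and fin: "finite {comm l g |l g. l \<in> L \<and> g \<in> carrier G}"
    and m: "m > 0" and cent: "\<And>l g. l \<in> L \<Longrightarrow> g \<in> carrier G \<Longrightarrow> l [^] (m::nat) \<otimes> g = g \<otimes> l [^] m"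
  shows "finite (commutator_subgroup G L (carrier G))"
proof -
  note l = normal_closed[OF L]
  let ?C = "{comm l g |l g. l \<in> L \<and> g \<in> carrier G}"
  have CL: "?C \<subseteq> L"
    using commutator_subgroup_incl_left[OF L, of "carrier G"] by (auto intro: subsetD commutator_subgroup_mem)
  show ?thesis unfolding commutator_subgroup_def
  proof (rule finite_generate_bounded[OF _ fin])
    show "?C \<subseteq> carrier G" using l(2) by auto
    show "inv y \<otimes> x \<otimes> y \<in> ?C" if xy: "x \<in> ?C" "y \<in> ?C" for x y
    proof -
      obtain u g where u: "x = comm u g" "u \<in> L" "g \<in> carrier G" using xy by auto
      have y: "inv y \<in> carrier G" "y \<in> carrier G" using xy CL l(2) by auto
      have "inv y \<otimes> x \<otimes> y = comm (inv y \<otimes> u \<otimes> y) (inv y \<otimes> g \<otimes> y)"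
        using comm_conj[of u g "inv y"] y u l(2) by (simp add: subset_iff)
      then show ?thesis using y u l(7)[OF y(2) u(2)] by blast
    qed
    show "inv x \<in> ?C" if x: "x \<in> ?C" for x
    proof -
      obtain u g where u: "x = comm u g" "u \<in> L" "g \<in> carrier G" using x by auto
      then have uc: "u \<in> carrier G" using l(2) by auto
      have "inv x = comm (inv u) (inv u \<otimes> g \<otimes> u)"
        using u uc by (simp add: commutator_def group_simps)
      then show ?thesis using u uc l(5) by blast
    qed
    show "\<exists>ys. set ys \<subseteq> ?C \<and> length ys = m \<and> x [^] Suc m = lprod ys" if x: "x \<in> ?C" for x
    proof -
      obtain u g where u: "x = comm u g" "u \<in> L" "g \<in> carrier G" using x by auto
      then have uc: "u \<in> carrier G" and xc: "x \<in> carrier G" using l(2) by auto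
      have xL: "x \<in> L" using x CL by auto
      let ?x' = "inv u \<otimes> x \<otimes> u"
      have x': "?x' = comm u (inv u \<otimes> g \<otimes> u)"
        using u uc by (simp add: commutator_def group_simps)
      have x'c: "?x' \<in> carrier G" using uc xc by auto
      have sq: "comm (u \<otimes> u) g = ?x' \<otimes> x" using comm_mult_left[OF uc uc u(3)] u(1) by simp
      have "x [^] m = inv u \<otimes> x [^] m \<otimes> u" using cent[OF xL uc] uc xc by (simp add: group_simps)
      also have "\<dots> = ?x' [^] m" by (rule conj_pow[OF xc uc])
      also have "\<dots> = ?x' [^] (m - 1) \<otimes> ?x'" using m nat_pow_Suc[of ?x' "m - 1"] by simp
      finally have "x [^] Suc m = ?x' [^] (m - 1) \<otimes> (?x' \<otimes> x)" using x'c xc by (simp add: m_assoc)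
      also have "\<dots> = lprod (replicate (m - 1) ?x' @ [comm (u \<otimes> u) g])"
        using x'c xc by (subst lprod_append) (auto simp: lprod_replicate sq)
      finally have p: "x [^] Suc m = lprod (replicate (m - 1) ?x' @ [comm (u \<otimes> u) g])" .
      have x'C: "?x' \<in> ?C" unfolding x' using u uc by blast
      have sqC: "comm (u \<otimes> u) g \<in> ?C" using u l(4) by blast
      have sub: "set (replicate k a @ [b]) \<subseteq> S" if "a \<in> S" "b \<in> S" for k a b and S :: "'a set"
        using that by auto
      have len: "length (replicate (m - 1) ?x' @ [comm (u \<otimes> u) g]) = m" using m by simp
      show ?thesis by (intro exI conjI, rule sub[OF x'C sqC], rule len, rule p)
    qed
  qed
qed

text \<open>
  Two of the powers \<open>l\<^sup>0, \<dots>, l\<^sup>n\<close> fall into the same coset, \<open>n\<close> being the number of cosets; \<open>n!\<close> is then a common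
  exponent for all \<open>l\<close>.
\<close>
lemma finite_quotient_exponent:
  assumes M: "M \<lhd> G" and L: "subgroup L G" and fin: "finite ((\<lambda>x. M #> x) ` L)"
  shows "\<exists>m>0. \<forall>l\<in>L. l [^] (m::nat) \<in> M"
proof -
  let ?n = "card ((\<lambda>x. M #> x) ` L)"
  have "l [^] (fact ?n :: nat) \<in> M" if l: "l \<in> L" for l
  proof -
    have lc: "l \<in> carrier G" using l L subgroup.subset by blast
    have powL: "l [^] (i::nat) \<in> L" for i
      using l L by (induction i) (auto intro: subgroup.one_closed subgroup.m_closed)
    have "(\<lambda>i. M #> l [^] i) ` {..?n} \<subseteq> (\<lambda>x. M #> x) ` L" using powL by auto
    then have "card ((\<lambda>i. M #> l [^] i) ` {..?n}) \<le> ?n" by (rule card_mono[OF fin])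
    then have "\<not> inj_on (\<lambda>i. M #> l [^] i) {..?n}" by (intro notI) (simp add: card_image)
    then have "\<exists>i j. i < j \<and> j \<le> ?n \<and> M #> l [^] i = M #> l [^] j"
      unfolding inj_on_def by (metis atMost_iff linorder_neqE_nat)
    then obtain i j where ij: "i < j" "j \<le> ?n" "M #> l [^] i = M #> l [^] j" by blast
    then have "l [^] j \<otimes> inv (l [^] i) \<in> M" using rcos_eq_iff[OF M, of "l [^] j" "l [^] i"] lc by simp
    moreover have "l [^] j = l [^] (j - i) \<otimes> l [^] i" using ij lc by (simp add: nat_pow_mult)
    ultimately have "l [^] (j - i) \<in> M" using lc by (simp add: m_assoc)
    then have *: "(l [^] (j - i)) [^] (k::nat) \<in> M" for k
      using normal_closed[OF M] by (induction k) auto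
    have "j - i dvd fact ?n" using ij by (intro dvd_fact) auto
    then obtain k where "fact ?n = (j - i) * k" by (auto simp: dvd_def)
    then show ?thesis using *[of k] lc by (simp add: nat_pow_pow)
  qed
  then show ?thesis by (intro exI[of _ "fact ?n"]) auto
qed

lemma Mod_hom:
  assumes N: "N \<lhd> G"
  shows "plain_group_hom G (G Mod N) (\<lambda>x. N #> x)" and "(\<lambda>x. N #> x) ` carrier G = carrier (G Mod N)"
proof -
  interpret N: normal N G by fact
  show "plain_group_hom G (G Mod N) (\<lambda>x. N #> x)"
    by (rule plain_group_homI[OF group_axioms N.factorgroup_is_group N.r_coset_hom_Mod])
  show "(\<lambda>x. N #> x) ` carrier G = carrier (G Mod N)" by (simp add: carrier_FactGroup)
qed

text \<open>
  Baer's theorem, for \<open>G\<close> modulo \<open>[R, G, \<dots>, G]\<close>.  In the step, let \<open>L = \<gamma>\<^sub>c\<^sub>+\<^sub>1(G)\<close> and \<open>M = [R, G, \<dots>, G]\<close> with \<open>c\<close>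
  copies of \<open>G\<close>.  Modulo the next term, \<open>M\<close> is central and \<open>R\<close> centralises \<open>L\<close>, so \<open>[x, g]\<close> depends only on
  the coset of \<open>x\<close> modulo \<open>M\<close> and that of \<open>g\<close> modulo \<open>R\<close>: there are finitely many commutators.  The statement
  stays in \<open>G\<close>, since an induction over quotients would change the type of the group.
\<close>
lemma finite_lower_central_mod:
  assumes R: "R \<lhd> G" and fin: "finite ((\<lambda>x. R #> x) ` carrier G)"
  shows "finite ((\<lambda>x. icomm R c #> x) ` icomm (carrier G) c)"
proof (induction c)
  case 0
  show ?case using fin by (simp add: icomm_0)
next
  case (Suc c)
  let ?N = "icomm R (Suc c)" and ?M = "icomm R c" and ?L = "icomm (carrier G) c"
  let ?\<pi> = "\<lambda>x. ?N #> x" and ?Q = "G Mod icomm R (Suc c)"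
  have N: "?N \<lhd> G" and M: "?M \<lhd> G" and L: "?L \<lhd> G" by (auto intro: icomm_normal R carrier_normal)
  note n = normal_closed[OF N] and mm = normal_closed[OF M] and l = normal_closed[OF L]
  interpret pi: plain_group_hom G ?Q ?\<pi> by (rule Mod_hom(1)[OF N])
  have surj: "?\<pi> ` carrier G = carrier ?Q" by (rule Mod_hom(2)[OF N])
  have L': "?\<pi> ` ?L \<lhd> ?Q"
    using normal.surj_hom_normal_subgroup[OF L pi.group_hom_axioms surj] .
  obtain m where m: "m > 0" "\<And>l. l \<in> ?L \<Longrightarrow> l [^] (m::nat) \<in> ?M"
    using finite_quotient_exponent[OF M l(1) Suc] by blast
  have MN: "comm a g \<in> ?N" if "a \<in> ?M" "g \<in> carrier G" for a g
    unfolding icomm_Suc using that by (rule commutator_subgroup_mem)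
  have RN: "comm x r \<in> ?N" if "r \<in> R" "x \<in> ?L" for r x
    using that comm_lower_central[OF R, of c] commutator_subgroup_mem[OF that] comm_swap_mem[OF N, of x r]
      normal_closed(2)[OF R] l(2) by blast
  have det: "?\<pi> (comm x g) = ?\<pi> (comm x' g')"
    if x: "x \<in> ?L" "x' \<in> ?L" and g: "g \<in> carrier G" "g' \<in> carrier G" and eq: "?M #> x = ?M #> x'" "R #> g = R #> g'" for x x' g g'
  proof -
    have xc: "x \<in> carrier G" "x' \<in> carrier G" using x l(2) by auto
    let ?a = "x \<otimes> inv x'" and ?r = "g \<otimes> inv g'"
    have a: "?a \<in> ?M" using eq(1) xc rcos_eq_iff[OF M] by auto
    have r: "?r \<in> R" using eq(2) g rcos_eq_iff[OF R] by auto
    have c: "?a \<in> carrier G" "?r \<in> carrier G" using xc g by auto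
    have N1: "?\<pi> z = ?N" if "z \<in> ?N" for z using that n(1) coset_join2 n(2) by blast
    have "x = ?a \<otimes> x'" using xc by (simp add: group_simps)
    then have "comm x g = (inv x' \<otimes> comm ?a g \<otimes> x') \<otimes> comm x' g" using comm_mult_left[OF c(1) xc(2) g(1)] by simp
    moreover have "?\<pi> (inv x' \<otimes> comm ?a g \<otimes> x') = ?N" by (intro N1 n(7) MN a g xc)
    ultimately have 1: "?\<pi> (comm x g) = ?\<pi> (comm x' g)"
      using c xc g pi.hom_mult[of "inv x' \<otimes> comm ?a g \<otimes> x'" "comm x' g"] pi.H.l_one[of "?\<pi> (comm x' g)"] by simp
    have "g = ?r \<otimes> g'" using g by (simp add: group_simps)
    then have "comm x' g = comm x' g' \<otimes> (inv g' \<otimes> comm x' ?r \<otimes> g')" using comm_mult_right[OF xc(2) c(2) g(2)] by simp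
    moreover have "?\<pi> (inv g' \<otimes> comm x' ?r \<otimes> g') = ?N" by (intro N1 n(7) RN r g x)
    ultimately have 2: "?\<pi> (comm x' g) = ?\<pi> (comm x' g')"
      using c xc g pi.hom_mult[of "comm x' g'" "inv g' \<otimes> comm x' ?r \<otimes> g'"] pi.H.r_one[of "?\<pi> (comm x' g')"] by simp
    from 1 2 show ?thesis by simp
  qed
  have "finite ((\<lambda>(x, g). (?M #> x, R #> g)) ` (?L \<times> carrier G))"
    by (rule finite_subset[of _ "((\<lambda>x. ?M #> x) ` ?L) \<times> ((\<lambda>x. R #> x) ` carrier G)"]) (use Suc fin in auto)
  then have "finite ((\<lambda>(x, g). ?\<pi> (comm x g)) ` (?L \<times> carrier G))"
  proof (rule finite_image_determined)
    fix p q assume "p \<in> ?L \<times> carrier G" "q \<in> ?L \<times> carrier G"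
      and eq: "(\<lambda>(x, g). (?M #> x, R #> g)) p = (\<lambda>(x, g). (?M #> x, R #> g)) q"
    then obtain x g x' g' where p: "p = (x, g)" "q = (x', g')"
      and c: "x \<in> ?L" "x' \<in> ?L" "g \<in> carrier G" "g' \<in> carrier G" by blast
    have "?M #> x = ?M #> x'" "R #> g = R #> g'" using eq unfolding p by simp_all
    from det[OF c this] show "(\<lambda>(x, g). ?\<pi> (comm x g)) p = (\<lambda>(x, g). ?\<pi> (comm x g)) q"
      unfolding p by simp
  qed
  moreover have "{commutator ?Q u g |u g. u \<in> ?\<pi> ` ?L \<and> g \<in> carrier ?Q} \<subseteq> (\<lambda>(x, g). ?\<pi> (comm x g)) ` (?L \<times> carrier G)"
  proof clarify
    fix x g assume x: "x \<in> ?L" and "g \<in> carrier ?Q"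
    then obtain g' where "g = ?\<pi> g'" "g' \<in> carrier G" using surj by blast
    then show "commutator ?Q (?\<pi> x) g \<in> (\<lambda>(x, g). ?\<pi> (comm x g)) ` (?L \<times> carrier G)"
      using x l(2) pi.hom_comm[of x g'] by (intro image_eqI[of _ _ "(x, g')"]) auto
  qed
  ultimately have fin': "finite {commutator ?Q u g |u g. u \<in> ?\<pi> ` ?L \<and> g \<in> carrier ?Q}"
    by (rule rev_finite_subset)
  have "finite (commutator_subgroup ?Q (?\<pi> ` ?L) (carrier ?Q))"
  proof (rule pi.H.finite_commutator_subgroup[OF L' fin' m(1)])
    fix u g assume "u \<in> ?\<pi> ` ?L" "g \<in> carrier ?Q"
    then obtain x g' where x: "u = ?\<pi> x" "x \<in> ?L" and g: "g = ?\<pi> g'" "g' \<in> carrier G" using surj by blast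
    have xc: "x \<in> carrier G" using x l(2) by auto
    have "comm (inv (x [^] m)) (inv g') \<in> ?N" using mm(5)[OF m(2)[OF x(2)]] g by (intro MN) auto
    moreover have "(x [^] m \<otimes> g') \<otimes> inv (g' \<otimes> x [^] m) = comm (inv (x [^] m)) (inv g')"
      using xc g by (simp add: commutator_def group_simps)
    ultimately have "?N #> (x [^] m \<otimes> g') = ?N #> (g' \<otimes> x [^] m)"
      using rcos_eq_iff[OF N, of "x [^] m \<otimes> g'" "g' \<otimes> x [^] m"] xc g by simp
    then show "u [^]\<^bsub>?Q\<^esub> m \<otimes>\<^bsub>?Q\<^esub> g = g \<otimes>\<^bsub>?Q\<^esub> u [^]\<^bsub>?Q\<^esub> m"
      using x g xc by (simp only: pi.hom_nat_pow[symmetric] pi.hom_mult[symmetric] nat_pow_closed)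
  qed
  also have "commutator_subgroup ?Q (?\<pi> ` ?L) (carrier ?Q) = ?\<pi> ` icomm (carrier G) (Suc c)"
    using pi.hom_commutator_subgroup[OF l(2) subset_refl] surj unfolding icomm_Suc[of "carrier G" c] by simp
  finally show ?case .
qed

end

section \<open>Quotients of finite abelian groups embed as subgroups\<close>

lemma gcd_prime_eq_1:
  assumes "prime (p::nat)" and "\<not> int p dvd k" shows "gcd k (int p) = 1"
proof -
  have "coprime (int p) k" using assms by (intro prime_imp_coprime) auto
  then show ?thesis by (simp add: coprime_iff_gcd_eq_1 gcd.commute)
qed

lemma (in group) coprime_powers_mem:
  assumes S: "subgroup S G" and z: "z \<in> carrier G" and "z [^] (a::int) \<in> S" "z [^] (b::int) \<in> S"
  shows "z [^] gcd a b \<in> S"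
proof -
  obtain u v where uv: "u * a + v * b = gcd a b" using bezout_int by blast
  have "z [^] (u * a + v * b) = (z [^] a) [^] u \<otimes> (z [^] b) [^] v"
    using z by (simp add: int_pow_mult int_pow_pow mult.commute)
  also have "\<dots> \<in> S"
    by (rule subgroup.m_closed[OF S]; rule subgroup_int_pow_closed[OF S]; fact)
  finally show ?thesis unfolding uv .
qed

text \<open>
  The gcd of \<open>i\<close> and \<open>p\<^sup>h\<^sup>+\<^sup>1\<close> is a power of \<open>p\<close>; unless it is \<open>p\<^sup>h\<^sup>+\<^sup>1\<close>, it divides \<open>p\<^sup>h\<close>.
\<close>
lemma (in group) prime_power_exponent_cases:
  assumes S: "subgroup S G" and y: "y \<in> carrier G" and p: "prime (p::nat)"
    and "y [^] (int p ^ Suc h) \<in> S" and "y [^] (i::int) \<in> S"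
  shows "int p ^ Suc h dvd i \<or> y [^] (int p ^ h) \<in> S"
proof (cases "int p ^ Suc h dvd i")
  case False
  have "prime (int p)" using p by simp
  then obtain t where t: "t \<le> Suc h" "gcd i (int p ^ Suc h) = int p ^ t"
    using divides_primepow[of "int p" "gcd i (int p ^ Suc h)" "Suc h"] by (auto simp: normalize_power)
  have "t \<noteq> Suc h" using t False by (metis gcd_dvd1)
  then have "int p ^ h = int p ^ t * int p ^ (h - t)" using t by (simp flip: power_add)
  then have "y [^] (int p ^ h) = (y [^] gcd i (int p ^ Suc h)) [^] (int p ^ (h - t))"
    using t y by (simp only: int_pow_pow)
  also have "\<dots> \<in> S"
    by (rule subgroup_int_pow_closed[OF S], rule coprime_powers_mem[OF S y]) fact+
  finally show ?thesis by simp
qed simp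

lemma (in comm_group) extend_subgroup:
  assumes C: "subgroup C G" and x: "x \<in> carrier G"
  shows "subgroup {x [^] (i::int) \<otimes> c |i c. c \<in> C} G"
proof (rule subgroupI)
  note C' = subgroup.mem_carrier[OF C]
  show "{x [^] (i::int) \<otimes> c |i c. c \<in> C} \<subseteq> carrier G" using C' x by auto
  show "{x [^] (i::int) \<otimes> c |i c. c \<in> C} \<noteq> {}" using subgroup.one_closed[OF C] by auto
next
  note C' = subgroup.mem_carrier[OF C]
  fix a assume "a \<in> {x [^] (i::int) \<otimes> c |i c. c \<in> C}"
  then obtain i :: int and c where a: "a = x [^] i \<otimes> c" "c \<in> C" by blast
  then have "inv a = x [^] (- i) \<otimes> inv c" using x C' by (simp add: inv_mult int_pow_neg)
  then show "inv a \<in> {x [^] (i::int) \<otimes> c |i c. c \<in> C}" using subgroup.m_inv_closed[OF C] a by blast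
  fix b assume "b \<in> {x [^] (i::int) \<otimes> c |i c. c \<in> C}"
  then obtain j :: int and d where b: "b = x [^] j \<otimes> d" "d \<in> C" by blast
  have "a \<otimes> b = x [^] (i + j) \<otimes> (c \<otimes> d)" using a b x C' by (simp add: int_pow_mult m_ac)
  then show "a \<otimes> b \<in> {x [^] (i::int) \<otimes> c |i c. c \<in> C}" using subgroup.m_closed[OF C] a b by blast
qed

text \<open>
  Choose \<open>h\<close> maximal such that \<open>n\<close> is a \<open>p\<^sup>h\<close>-th power, \<open>n = y [^] p\<^sup>h\<close>, and let \<open>C\<close> be maximal among the
  subgroups that contain all \<open>p\<^sup>h\<^sup>+\<^sup>1\<close>-th powers but not \<open>n\<close>.  Then \<open>y\<close> and \<open>C\<close> generate \<open>G\<close>: otherwise there is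
  \<open>x\<close> outside with \<open>x\<^sup>q\<close> inside, \<open>q\<close> prime, say \<open>x\<^sup>q = y\<^sup>k c\<close>.  If \<open>y\<^sup>k\<close> is a \<open>q\<close>-th power of a power of \<open>y\<close>, one may
  change \<open>x\<close> to get \<open>x\<^sup>q = c\<close>, and adjoining \<open>x\<close> to \<open>C\<close> contradicts maximality.  The remaining case is \<open>q = p\<close>
  with \<open>p\<close> not dividing \<open>k\<close>; then \<open>x [^] p\<^sup>h\<^sup>+\<^sup>1 = n\<^sup>k c'\<close> with \<open>c'\<close> in \<open>C\<close> forces \<open>n\<close> into \<open>C\<close>.
\<close>
lemma (in comm_group) cyclic_complement:
  assumes fin: "finite (carrier G)" and p: "prime (p::nat)" and n: "n \<in> carrier G" "n \<noteq> \<one>" "n [^] int p = \<one>"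
  obtains y C h where "y \<in> carrier G" "n = y [^] (int p ^ h)" "subgroup C G" "n \<notin> C"
    "\<And>g. g \<in> carrier G \<Longrightarrow> \<exists>k::int. g \<otimes> inv (y [^] k) \<in> C"
proof -
  let ?H = "{h. \<exists>y\<in>carrier G. n = y [^] (int p ^ h)}"
  have one: "subgroup {\<one>} G" by (rule triv_subgroup)
  have kill: "y [^] (int p ^ Suc h) = \<one>" if "y \<in> carrier G" "n = y [^] (int p ^ h)" for y h
    using that n(3) by (simp add: int_pow_pow mult.commute)
  have "h \<le> order G" if hH: "h \<in> ?H" for h
  proof -
    obtain y where y: "y \<in> carrier G" "n = y [^] (int p ^ h)" using hH by blast
    have "y [^] int (order G) \<in> {\<one>}" using pow_order_eq_1[OF y(1)] by (simp add: int_pow_int)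
    then have "int p ^ Suc h dvd int (order G)"
      using prime_power_exponent_cases[OF one y(1) p, of h "int (order G)"] kill[OF y] y(2) n(2) by auto
    then have "p ^ Suc h dvd order G" by (metis int_dvd_int_iff of_nat_power)
    then have "p ^ Suc h \<le> order G" using fin order_gt_0_iff_finite by (auto intro: dvd_imp_le)
    moreover have "Suc h < p ^ Suc h" using prime_gt_1_nat[OF p] using power_gt_expt[of p "Suc h"] by simp
    ultimately show ?thesis by simp
  qed
  then have finH: "finite ?H" by (meson finite_nat_set_iff_bounded_le mem_Collect_eq)
  have "n = n [^] (int p ^ 0)" using n(1) by simp
  then have "0 \<in> ?H" using n(1) by blast
  define h where "h = Max ?H"
  have "h \<in> ?H" unfolding h_def using Max_in[OF finH] \<open>0 \<in> ?H\<close> by blast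
  then obtain y where y: "y \<in> carrier G" "n = y [^] (int p ^ h)" by blast
  have "Suc h \<notin> ?H" unfolding h_def using Max_ge[OF finH, of "Suc (Max ?H)"] Suc_n_not_le_n by blast
  then have notpow: "n \<noteq> x [^] (int p ^ Suc h)" if "x \<in> carrier G" for x using that by blast
  let ?P = "(\<lambda>x. x [^] (int p ^ Suc h)) ` carrier G"
  have "group_hom G G (\<lambda>x. x [^] (int p ^ Suc h))"
    by (intro group_hom.intro group_hom_axioms.intro is_group homI) (auto simp: int_pow_distrib)
  then have P: "subgroup ?P G" by (rule group_hom.img_is_subgroup)
  define A where "A = {C. subgroup C G \<and> ?P \<subseteq> C \<and> n \<notin> C}"
  have "A \<subseteq> Pow (carrier G)" by (auto simp: A_def dest: subgroup.mem_carrier)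
  then have "finite A" using fin by (meson finite_Pow_iff finite_subset)
  moreover have "?P \<in> A" using P notpow by (auto simp: A_def)
  ultimately obtain C where CA: "C \<in> A" and max: "\<And>D. D \<in> A \<Longrightarrow> C \<subseteq> D \<Longrightarrow> C = D"
    using finite_has_maximal[of A] by auto
  then have C: "subgroup C G" "?P \<subseteq> C" "n \<notin> C" by (auto simp: A_def)
  note C' = subgroup.mem_carrier[OF C(1)]
  \<comment> \<open>the subgroup generated by \<open>y\<close> and \<open>C\<close>\<close>
  define DD where "DD = {y [^] (i::int) \<otimes> c |i c. c \<in> C}"
  have D: "subgroup DD G" unfolding DD_def by (rule extend_subgroup[OF C(1) y(1)])
  have CD: "C \<subseteq> DD"
  proof
    fix c assume "c \<in> C"
    then have "c = y [^] (0::int) \<otimes> c" using C' by simp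
    then show "c \<in> DD" using \<open>c \<in> C\<close> unfolding DD_def by blast
  qed
  have yD: "y [^] (i::int) \<in> DD" for i
  proof -
    have "y [^] i = y [^] i \<otimes> \<one>" using y by simp
    then show ?thesis using subgroup.one_closed[OF C(1)] unfolding DD_def by blast
  qed
  have "g \<in> DD" if g: "g \<in> carrier G" for g
  proof (rule ccontr)
    assume gD: "g \<notin> DD"
    \<comment> \<open>\<open>m\<close> is the order of \<open>g\<close> modulo \<open>DD\<close>, and \<open>x\<close> below has prime order \<open>q\<close> modulo \<open>DD\<close>.\<close>
    define m where "m = (LEAST m. m > 0 \<and> g [^] (m::nat) \<in> DD)"
    have "order G > 0 \<and> g [^] order G \<in> DD"
      using pow_order_eq_1[OF g] fin order_gt_0_iff_finite subgroup.one_closed[OF D] by simp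
    then have m: "m > 0 \<and> g [^] m \<in> DD" unfolding m_def by (rule LeastI)
    have "m \<noteq> 1" using m gD nat_pow_eone[OF g] by auto
    then obtain q where q: "prime q" "q dvd m" using prime_factor_nat by blast
    then obtain r where r: "m = r * q" by (metis dvd_div_mult_self)
    have "r > 0" "r < m" using m r prime_gt_1_nat[OF q(1)] by auto
    define x where "x = g [^] r"
    have x: "x \<in> carrier G" using g by (simp add: x_def)
    have xD: "x \<notin> DD" using not_less_Least[of r "\<lambda>m. m > 0 \<and> g [^] (m::nat) \<in> DD"] \<open>r > 0\<close> \<open>r < m\<close>
      unfolding x_def m_def by blast
    have "x [^] int q \<in> DD" using m g unfolding x_def r by (simp add: nat_pow_pow int_pow_int)
    then obtain k c where kc: "x [^] int q = y [^] (k::int) \<otimes> c" "c \<in> C" unfolding DD_def by blast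
    have cc: "c \<in> carrier G" using kc C' by blast
    have "\<exists>j::int. y [^] (j * int q) = y [^] k"
    proof (cases "q = p")
      case True
      have "int p dvd k"
      proof (rule ccontr)
        assume "\<not> int p dvd k"
        then have cop: "gcd k (int p) = 1" by (rule gcd_prime_eq_1[OF p])
        have "x [^] (int p ^ Suc h) = (x [^] int q) [^] (int p ^ h)" using x True by (simp add: int_pow_pow)
        also have "\<dots> = n [^] k \<otimes> c [^] (int p ^ h)"
          using kc cc y by (simp add: int_pow_distrib int_pow_pow mult.commute)
        finally have "n [^] k = x [^] (int p ^ Suc h) \<otimes> inv (c [^] (int p ^ h))"
          using x cc n(1) by (simp add: m_assoc)
        moreover have "x [^] (int p ^ Suc h) \<in> C" using C(2) x by blast
        moreover have "inv (c [^] (int p ^ h)) \<in> C"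
          by (rule subgroup.m_inv_closed[OF C(1)], rule subgroup_int_pow_closed[OF C(1) kc(2)])
        ultimately have "n [^] k \<in> C" using subgroup.m_closed[OF C(1)] by simp
        moreover have "n [^] int p \<in> C" using n(3) subgroup.one_closed[OF C(1)] by simp
        ultimately have "n [^] gcd k (int p) \<in> C" by (intro coprime_powers_mem[OF C(1) n(1)])
        then show False using cop C(3) n(1) by simp
      qed
      then show ?thesis using True by (auto elim!: dvdE simp: mult.commute)
    next
      case False
      then have "coprime (int q) (int p ^ Suc h)" using p q(1) by (simp add: primes_coprime)
      then obtain u v where uv: "u * int q + v * int p ^ Suc h = 1"
        using bezout_int[of "int q" "int p ^ Suc h"] by auto
      have "y [^] k = y [^] (k * (u * int q + v * int p ^ Suc h))" unfolding uv by simp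
      also have "k * (u * int q + v * int p ^ Suc h) = (k * u) * int q + int p ^ Suc h * (k * v)"
        by (simp add: algebra_simps)
      also have "y [^] \<dots> = y [^] ((k * u) * int q) \<otimes> (y [^] (int p ^ Suc h)) [^] (k * v)"
        using y(1) by (simp only: int_pow_mult int_pow_pow)
      also have "\<dots> = y [^] ((k * u) * int q)" using y(1) kill[OF y] by simp
      finally show ?thesis by metis
    qed
    then obtain j where j: "y [^] (j * int q) = y [^] k" by blast
    define x' where "x' = x \<otimes> inv (y [^] j)"
    have x': "x' \<in> carrier G" using x y by (simp add: x'_def)
    have x'D: "x' \<notin> DD"
    proof
      assume "x' \<in> DD"
      then have "x' \<otimes> y [^] j \<in> DD" using yD by (intro subgroup.m_closed[OF D])
      then show False using xD x y by (simp add: x'_def m_assoc)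
    qed
    have "x' [^] int q = x [^] int q \<otimes> inv (y [^] (j * int q))"
      unfolding x'_def using x y by (simp add: int_pow_distrib int_pow_inv int_pow_pow)
    also have "\<dots> = c" unfolding j kc(1) using y cc by (simp add: m_ac)
    finally have x'q: "x' [^] int q = c" .
    let ?C' = "{x' [^] (i::int) \<otimes> c |i c. c \<in> C}"
    have CC': "C \<subseteq> ?C'"
    proof
      fix c assume "c \<in> C"
      then have "c = x' [^] (0::int) \<otimes> c" using C' by simp
      then show "c \<in> ?C'" using \<open>c \<in> C\<close> by blast
    qed
    have "x' = x' [^] (1::int) \<otimes> \<one>" using x' by simp
    then have "x' \<in> ?C'" using subgroup.one_closed[OF C(1)] by blast
    then have "C \<noteq> ?C'" using x'D CD by blast
    then have "?C' \<notin> A" using max[of ?C'] CC' by blast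
    then have "n \<in> ?C'" using extend_subgroup[OF C(1) x'] C(2) CC' unfolding A_def by blast
    then obtain i d where id: "n = x' [^] (i::int) \<otimes> d" "d \<in> C" by blast
    have dc: "d \<in> carrier G" using id C' by blast
    show False
    proof (cases "int q dvd i")
      case True
      then obtain l where "i = int q * l" by (auto elim: dvdE)
      then have "x' [^] i = c [^] l" using x'q x' by (metis int_pow_pow)
      then have "n \<in> C" using id kc(2) subgroup_int_pow_closed[OF C(1)] subgroup.m_closed[OF C(1)] by metis
      then show False using C(3) by blast
    next
      case False
      then have cop: "gcd i (int q) = 1" by (rule gcd_prime_eq_1[OF q(1)])
      have "x' [^] i = n \<otimes> inv d" using id dc x' n(1) by (simp add: m_assoc)
      moreover have "n \<in> DD" unfolding y(2) by (rule yD)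
      moreover have "inv d \<in> DD" using id CD by (intro subgroup.m_inv_closed[OF D]) auto
      ultimately have "x' [^] i \<in> DD" using subgroup.m_closed[OF D] by simp
      moreover have "x' [^] int q \<in> DD" using x'q kc(2) CD by blast
      ultimately have "x' [^] gcd i (int q) \<in> DD" by (intro coprime_powers_mem[OF D x'])
      then show False using cop x'D x' by simp
    qed
  qed
  then have "\<exists>k::int. g \<otimes> inv (y [^] k) \<in> C" if g: "g \<in> carrier G" for g
  proof -
    have "g \<in> DD" using g by fact
    then obtain k c where kc: "g = y [^] (k::int) \<otimes> c" "c \<in> C" unfolding DD_def by blast
    then have "g \<otimes> inv (y [^] k) = c" using y C'[OF kc(2)] by (simp add: m_ac)
    then show ?thesis using kc(2) by blast
  qed
  then show thesis by (rule that[OF y C(1,3)])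
qed

lemma (in comm_group) quotient_cancel:
  assumes "g \<in> carrier G" "a \<in> carrier G" "b \<in> carrier G"
  shows "(g \<otimes> inv a) \<otimes> inv (g \<otimes> inv b) = b \<otimes> inv a"
proof -
  have "(g \<otimes> inv a) \<otimes> inv (g \<otimes> inv b) = (inv a \<otimes> g) \<otimes> (inv g \<otimes> b)"
    using assms by (simp add: inv_mult m_comm[of g "inv a"])
  also have "\<dots> = inv a \<otimes> (g \<otimes> (inv g \<otimes> b))" using assms by (simp add: m_assoc)
  also have "g \<otimes> (inv g \<otimes> b) = b" using assms by (simp flip: m_assoc)
  finally show ?thesis using assms by (simp add: m_comm)
qed

text \<open>
  With \<open>G = \<langle>y\<rangle> \<times> C\<close> from \<open>cyclic_complement\<close>, the endomorphism that is the \<open>p\<close>-th power on \<open>\<langle>y\<rangle>\<close> and the identity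
  on \<open>C\<close> kills exactly the elements of order dividing \<open>p\<close> in \<open>\<langle>y\<rangle>\<close>.
\<close>
lemma (in comm_group) endomorphism_kernel_prime:
  assumes fin: "finite (carrier G)" and p: "prime (p::nat)" and n: "n \<in> carrier G" "n \<noteq> \<one>" "n [^] int p = \<one>"
  shows "\<exists>f \<in> hom G G. kernel G G f = generate G {n}"
proof -
  obtain y C h where y: "y \<in> carrier G" "n = y [^] (int p ^ h)" and C: "subgroup C G" "n \<notin> C"
    and cover: "\<And>g. g \<in> carrier G \<Longrightarrow> \<exists>k::int. g \<otimes> inv (y [^] k) \<in> C"
    using cyclic_complement[OF assms] by metis
  note C' = subgroup.mem_carrier[OF C(1)]
  have kill: "y [^] (int p ^ Suc h) = \<one>"
    using y n(3) by (simp add: int_pow_pow mult.commute)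
  have triv: "y [^] k = \<one>" if "y [^] (k::int) \<in> C" for k
  proof -
    have "int p ^ Suc h dvd k"
      using prime_power_exponent_cases[OF C(1) y(1) p, of h k] that kill subgroup.one_closed[OF C(1)] y(2) C(2) by auto
    then obtain l where "k = int p ^ Suc h * l" by (rule dvdE)
    then show ?thesis using kill y(1) by (metis int_pow_pow int_pow_one)
  qed
  \<comment> \<open>\<open>y [^] \<kappa> g\<close> does not depend on the choice, as \<open>\<langle>y\<rangle>\<close> meets \<open>C\<close> trivially; it is the projection of \<open>g\<close> to \<open>\<langle>y\<rangle>\<close>.\<close>
  define \<kappa> where "\<kappa> g = (SOME k::int. g \<otimes> inv (y [^] k) \<in> C)" for g
  have \<kappa>: "g \<otimes> inv (y [^] \<kappa> g) \<in> C" if "g \<in> carrier G" for g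
    unfolding \<kappa>_def using cover[OF that] by (rule someI_ex)
  define \<pi> where "\<pi> g = y [^] \<kappa> g" for g
  have \<pi>c: "\<pi> g \<in> carrier G" for g using y by (simp add: \<pi>_def)
  have uniq: "\<pi> g = y [^] k" if "g \<in> carrier G" "g \<otimes> inv (y [^] (k::int)) \<in> C" for g k
  proof -
    have "(g \<otimes> inv (y [^] \<kappa> g)) \<otimes> inv (g \<otimes> inv (y [^] k)) = y [^] (k - \<kappa> g)"
      using that(1) y(1) by (simp add: quotient_cancel int_pow_diff)
    moreover have "(g \<otimes> inv (y [^] \<kappa> g)) \<otimes> inv (g \<otimes> inv (y [^] k)) \<in> C"
      by (rule subgroup.m_closed[OF C(1) \<kappa>[OF that(1)] subgroup.m_inv_closed[OF C(1) that(2)]])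
    ultimately have "y [^] (k - \<kappa> g) \<in> C" by simp
    then have "y [^] (k - \<kappa> g) = \<one>" by (rule triv)
    then have "y [^] k \<otimes> inv (y [^] \<kappa> g) = \<one>" using y by (simp add: int_pow_diff)
    then show ?thesis using y by (simp add: \<pi>_def inv_solve_right')
  qed
  have \<pi>_mult: "\<pi> (g \<otimes> g') = \<pi> g \<otimes> \<pi> g'" if g: "g \<in> carrier G" "g' \<in> carrier G" for g g'
  proof -
    have "(g \<otimes> g') \<otimes> inv (y [^] (\<kappa> g + \<kappa> g')) = (g \<otimes> inv (y [^] \<kappa> g)) \<otimes> (g' \<otimes> inv (y [^] \<kappa> g'))"
      using g y by (simp add: int_pow_mult inv_mult m_ac)
    also have "\<dots> \<in> C" by (intro subgroup.m_closed[OF C(1)] \<kappa> g)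
    finally have "\<pi> (g \<otimes> g') = y [^] (\<kappa> g + \<kappa> g')" by (intro uniq) (use g in auto)
    then show ?thesis using y by (simp add: \<pi>_def int_pow_mult)
  qed
  have \<pi>y: "\<pi> (y [^] (k::int)) = y [^] k" for k
    using y subgroup.one_closed[OF C(1)] by (intro uniq) auto
  define f where "f g = g \<otimes> \<pi> g [^] (int p - 1)" for g
  have "f \<in> hom G G"
    by (rule homI) (use \<pi>c in \<open>auto simp: f_def \<pi>_mult int_pow_distrib m_ac\<close>)
  moreover have fy: "f (y [^] k) = y [^] (k * int p)" for k :: int
  proof -
    have "k * int p = k + k * (int p - 1)" by (simp add: algebra_simps)
    then show ?thesis using y by (simp add: f_def \<pi>y int_pow_pow int_pow_mult)
  qed
  moreover have "kernel G G f = generate G {n}"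
  proof (intro equalityI subsetI)
    fix g assume "g \<in> kernel G G f"
    then have g: "g \<in> carrier G" "g \<otimes> \<pi> g [^] (int p - 1) = \<one>" by (auto simp: kernel_def f_def)
    then have "g = inv (\<pi> g [^] (int p - 1))" using \<pi>c by (metis inv_equality int_pow_closed inv_inv)
    also have "\<dots> = y [^] (- (\<kappa> g * (int p - 1)))" using y by (simp add: \<pi>_def int_pow_pow int_pow_neg)
    finally obtain j where j: "g = y [^] (j::int)" by blast
    then have "y [^] (j * int p) = \<one>" using fy[of j] g(2) by (simp add: f_def)
    then have "int p ^ Suc h dvd j * int p"
      using prime_power_exponent_cases[OF triv_subgroup y(1) p, of h "j * int p"] kill y(2) n(2) by auto
    then have "int p ^ h dvd j" using prime_gt_0_nat[OF p] by simp
    then obtain l where "j = int p ^ h * l" by (rule dvdE)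
    then have "g = n [^] l" using j y by (metis int_pow_pow)
    then show "g \<in> generate G {n}" using generate_pow[OF n(1)] by blast
  next
    fix g assume "g \<in> generate G {n}"
    then obtain l where "g = n [^] (l::int)" using generate_pow[OF n(1)] by blast
    then have g: "g = y [^] (int p ^ h * l)" using y by (simp add: int_pow_pow)
    have "int p ^ h * l * int p = int p ^ Suc h * l" by simp
    then have "f g = (y [^] (int p ^ Suc h)) [^] l" unfolding g fy using y by (metis int_pow_pow)
    then show "g \<in> kernel G G f" using kill y g by (simp add: kernel_def)
  qed
  ultimately show ?thesis by blast
qed

lemma (in group) exists_prime_order:
  assumes fin: "finite (carrier G)" and N: "subgroup N G" "N \<noteq> {\<one>}"
  obtains p n where "prime (p::nat)" "n \<in> N" "n \<noteq> \<one>" "n [^] int p = \<one>"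
proof -
  obtain a where a: "a \<in> N" "a \<noteq> \<one>" using N subgroup.one_closed[OF N(1)] by blast
  have ac: "a \<in> carrier G" using a N subgroup.mem_carrier by metis
  define m where "m = ord a"
  have "m > 0" using ord_ge_1[OF fin ac] by (simp add: m_def)
  have "m \<noteq> 1" using a ac ord_eq_1 by (simp add: m_def)
  then obtain p where p: "prime p" "p dvd m" using prime_factor_nat by blast
  then obtain r where r: "m = r * p" by (metis dvd_div_mult_self)
  have "r > 0" "r < m" using \<open>m > 0\<close> r prime_gt_1_nat[OF p(1)] by auto
  show thesis
  proof (rule that[of p "a [^] int r"])
    show "prime p" by fact
    show "a [^] int r \<in> N" using a by (intro subgroup_int_pow_closed[OF N(1)])
    show "a [^] int r \<noteq> \<one>"
    proof
      assume "a [^] int r = \<one>"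
      then have "m dvd r" using pow_eq_id[OF ac] by (simp add: m_def int_pow_int)
      then show False using \<open>r > 0\<close> \<open>r < m\<close> by (auto dest: dvd_imp_le)
    qed
    have "a [^] int m = \<one>" using pow_ord_eq_1[OF ac] by (simp add: m_def int_pow_int)
    then show "(a [^] int r) [^] int p = \<one>" using ac r by (simp add: int_pow_pow)
  qed
qed

text \<open>
  Divide out an element of prime order inside \<open>G\<close>: an endomorphism \<open>f\<close> with kernel \<open>\<langle>n\<rangle>\<close> maps \<open>N\<close> to a smaller subgroup,
  which by induction is the kernel of some \<open>g\<close>; then \<open>N\<close> is the kernel of \<open>g \<circ> f\<close>.
\<close>
lemma (in comm_group) endomorphism_with_kernel:
  assumes fin: "finite (carrier G)" and N: "subgroup N G"
  shows "\<exists>f \<in> hom G G. kernel G G f = N"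
  using N
proof (induction "card N" arbitrary: N rule: less_induct)
  case less
  show ?case
  proof (cases "N = {\<one>}")
    case True
    then show ?thesis by (intro bexI[of _ "\<lambda>x. x"]) (auto simp: kernel_def hom_def)
  next
    case False
    obtain p n where n: "prime (p::nat)" "n \<in> N" "n \<noteq> \<one>" "n [^] int p = \<one>"
      using exists_prime_order[OF fin less.prems False] .
    have Nc: "N \<subseteq> carrier G" using less.prems by (rule subgroup.subset)
    obtain f where f: "f \<in> hom G G" "kernel G G f = generate G {n}"
      using endomorphism_kernel_prime[OF fin n(1) _ n(3,4)] n(2) Nc by blast
    interpret f: group_hom G G f using f by (intro group_hom.intro group_hom_axioms.intro is_group)
    have kN: "kernel G G f \<subseteq> N" unfolding f(2) using n(2) less.prems by (intro generate_subgroup_incl) auto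
    have finN: "finite N" using Nc fin by (rule finite_subset)
    have fN: "f n = \<one>" using f(2) generate.incl[of n "{n}" G] by (auto simp: kernel_def)
    have "\<not> inj_on f N"
      using inj_onD[of f N n \<one>] fN n(2,3) subgroup.one_closed[OF less.prems] f.hom_one by metis
    then have "card (f ` N) < card N" using finN card_image_le[OF finN, of f] eq_card_imp_inj_on[OF finN, of f] by linarith
    then obtain g where g: "g \<in> hom G G" "kernel G G g = f ` N"
      using less.hyps[of "f ` N"] f.subgroup_img_is_subgroup[OF less.prems] by blast
    have "kernel G G (g \<circ> f) = N"
    proof (intro equalityI subsetI)
      fix x assume "x \<in> kernel G G (g \<circ> f)"
      then have x: "x \<in> carrier G" "f x \<in> f ` N" using g(2) by (auto simp: kernel_def)
      then obtain z where z: "z \<in> N" "f x = f z" by auto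
      then have "x \<otimes> inv z \<in> kernel G G f" using x Nc by (auto simp: kernel_def)
      then have "x \<otimes> inv z \<otimes> z \<in> N" by (intro subgroup.m_closed[OF less.prems _ z(1)] subsetD[OF kN])
      then show "x \<in> N" using x z Nc by (simp add: m_assoc subset_iff)
    next
      fix x assume x: "x \<in> N"
      then have "f x \<in> kernel G G g" using g(2) by blast
      then show "x \<in> kernel G G (g \<circ> f)" using x Nc by (auto simp: kernel_def)
    qed
    then show ?thesis by (intro bexI[of _ "g \<circ> f"] Group.hom_compose[OF f(1) g(1)])
  qed
qed

text \<open>
  The image of an endomorphism with the same kernel as \<open>\<phi>\<close> is isomorphic to \<open>Q\<close>.
\<close>
lemma quotient_embeds_finite_abelian:
  assumes "comm_group M" "finite (carrier M)" "group Q" "\<phi> \<in> epi M Q"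
  shows "\<exists>H. subgroup H M \<and> M\<lparr>carrier := H\<rparr> \<cong> Q"
proof -
  interpret comm_group M by fact
  have \<phi>: "\<phi> \<in> hom M Q" "\<phi> ` carrier M = carrier Q" using assms(4) by (auto simp: epi_def)
  interpret phi: group_hom M Q \<phi> using \<phi> assms by (intro group_hom.intro group_hom_axioms.intro is_group)
  obtain f where f: "f \<in> hom M M" "kernel M M f = kernel M Q \<phi>"
    using endomorphism_with_kernel[OF assms(2) phi.subgroup_kernel] by blast
  interpret f: group_hom M M f using f by (intro group_hom.intro group_hom_axioms.intro is_group)
  let ?H = "f ` carrier M"
  have H: "subgroup ?H M" by (rule f.img_is_subgroup)
  interpret f': group_hom M "M\<lparr>carrier := ?H\<rparr>" f
    using f(1) subgroup_imp_group[OF H] is_group by (intro group_hom.intro group_hom_axioms.intro) (auto simp: hom_def)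
  have "M Mod kernel M (M\<lparr>carrier := ?H\<rparr>) f \<cong> M\<lparr>carrier := ?H\<rparr>" by (rule f'.FactGroup_iso) simp
  moreover have "kernel M (M\<lparr>carrier := ?H\<rparr>) f = kernel M Q \<phi>" using f(2) by (simp add: kernel_def)
  moreover have "M Mod kernel M Q \<phi> \<cong> Q" by (rule phi.FactGroup_iso) (rule \<phi>(2))
  moreover have "group (M Mod kernel M Q \<phi>)" by (rule normal.factorgroup_is_group[OF phi.normal_kernel])
  ultimately have "M\<lparr>carrier := ?H\<rparr> \<cong> Q" by (metis group.iso_sym iso_trans)
  then show ?thesis using H by blast
qed

section \<open>Normal closures and verbal subgroups\<close>

context plain_group_hom
begin

lemma preimage_subgroup:
  assumes "subgroup S H" shows "subgroup {x \<in> carrier G. h x \<in> S} G"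
proof (rule G.subgroupI)
  show "{x \<in> carrier G. h x \<in> S} \<noteq> {}"
    using subgroup.one_closed[OF assms] by (auto intro!: exI[of _ "\<one>"])
qed (use subgroup.m_closed[OF assms] subgroup.m_inv_closed[OF assms] in auto)

lemma preimage_normal:
  assumes N: "N \<lhd> H" shows "{x \<in> carrier G. h x \<in> N} \<lhd> G"
proof (rule G.normal_invI)
  note n = H.normal_closed[OF N]
  show "subgroup {x \<in> carrier G. h x \<in> N} G" by (rule preimage_subgroup[OF n(1)])
  fix g x assume "g \<in> carrier G" "x \<in> {x \<in> carrier G. h x \<in> N}"
  then show "g \<otimes> x \<otimes> inv g \<in> {x \<in> carrier G. h x \<in> N}" using n(6)[of "h g" "h x"] by simp
qed

lemma hom_generate_subset:
  assumes "X \<subseteq> carrier G" "subgroup S H" "\<And>x. x \<in> X \<Longrightarrow> h x \<in> S" "x \<in> generate G X"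
  shows "h x \<in> S"
proof -
  have "generate G X \<subseteq> {x \<in> carrier G. h x \<in> S}"
    using assms(1,3) by (intro G.generate_subgroup_incl preimage_subgroup assms(2)) auto
  then show ?thesis using assms(4) by blast
qed

lemma hom_lprod: "set xs \<subseteq> carrier G \<Longrightarrow> h (G.lprod xs) = H.lprod (map h xs)"
  by (induction xs) auto

end

context plain_group
begin

lemma conj_gens_subset: "X \<subseteq> carrier G \<Longrightarrow> (\<Union>u\<in>carrier G. conj_set G X u) \<subseteq> carrier G"
  by (auto simp: conj_set_def)

lemma normal_closure_normal:
  assumes X: "X \<subseteq> carrier G" shows "normal_closure G X \<lhd> G"
  unfolding normal_closure_def
proof (rule normal_generateI[OF conj_gens_subset[OF X]])
  fix h g assume "h \<in> (\<Union>u\<in>carrier G. conj_set G X u)" and g: "g \<in> carrier G"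
  then obtain u x where u: "u \<in> carrier G" "x \<in> X" "h = inv u \<otimes> x \<otimes> u" by (auto simp: conj_set_def)
  then have "g \<otimes> h \<otimes> inv g = inv (u \<otimes> inv g) \<otimes> x \<otimes> (u \<otimes> inv g)"
    using g X by (auto simp: group_simps subset_iff)
  then show "g \<otimes> h \<otimes> inv g \<in> (\<Union>u\<in>carrier G. conj_set G X u)"
    using u g by (auto simp: conj_set_def intro!: bexI[of _ "u \<otimes> inv g"])
qed

lemma normal_closure_incl:
  assumes X: "X \<subseteq> carrier G" shows "X \<subseteq> normal_closure G X"
proof
  fix x assume x: "x \<in> X"
  then have "x = inv \<one> \<otimes> x \<otimes> \<one>" using X by auto
  then have "x \<in> conj_set G X \<one>" unfolding conj_set_def using x by (rule image_eqI)
  then have "x \<in> (\<Union>u\<in>carrier G. conj_set G X u)" by blast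
  then show "x \<in> normal_closure G X" unfolding normal_closure_def by (rule generate.incl)
qed

lemma normal_closure_least:
  assumes X: "X \<subseteq> M" and M: "M \<lhd> G" shows "normal_closure G X \<subseteq> M"
  unfolding normal_closure_def
  using normal_closed(7)[OF M] X
  by (intro generate_subgroup_incl[OF _ normal_closed(1)[OF M]]) (auto simp: conj_set_def)

lemma word_eval_closed: "s \<in> UNIV \<rightarrow> carrier G \<Longrightarrow> word_eval G s w \<in> carrier G"
  by (induction w) (auto simp: word_eval_def fp_lift_def)

lemma verbal_gens_subset: "{word_eval G s w |s w. s \<in> UNIV \<rightarrow> carrier G \<and> w \<in> V} \<subseteq> carrier G"
  using word_eval_closed by blast

lemma verbal_subgroup: "subgroup (verbal_subgroup V G) G"
  unfolding verbal_subgroup_def by (rule generate_is_subgroup[OF verbal_gens_subset])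

end

context plain_group_hom
begin

lemma hom_word_eval:
  assumes "s \<in> UNIV \<rightarrow> carrier G"
  shows "h (word_eval G s w) = word_eval H (\<lambda>i. h (s i)) w"
proof (induction w)
  case Nil
  then show ?case by (simp add: word_eval_def fp_lift_def)
next
  case (Cons a w)
  obtain i n where a: "a = (i, n)" by force
  have "word_eval G s (a # w) = s i [^] (n::int) \<otimes> word_eval G s w"
    "word_eval H (\<lambda>i. h (s i)) (a # w) = h (s i) [^]\<^bsub>H\<^esub> (n::int) \<otimes>\<^bsub>H\<^esub> word_eval H (\<lambda>i. h (s i)) w"
    by (simp_all add: word_eval_def fp_lift_def a)
  moreover have "s i \<in> carrier G" using assms by auto
  ultimately show ?case using Cons G.word_eval_closed[OF assms] by (simp add: hom_int_pow)
qed

lemma hom_verbal: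
  assumes "v \<in> verbal_subgroup V G" shows "h v \<in> verbal_subgroup V H"
proof (rule hom_generate_subset[OF G.verbal_gens_subset H.verbal_subgroup])
  show "v \<in> generate G {word_eval G s w |s w. s \<in> UNIV \<rightarrow> carrier G \<and> w \<in> V}"
    using assms by (simp add: verbal_subgroup_def)
  fix x assume "x \<in> {word_eval G s w |s w. s \<in> UNIV \<rightarrow> carrier G \<and> w \<in> V}"
  then obtain s w where s: "x = word_eval G s w" "s \<in> UNIV \<rightarrow> carrier G" "w \<in> V" by blast
  then have "h x = word_eval H (\<lambda>i. h (s i)) w" by (simp add: hom_word_eval)
  moreover have "(\<lambda>i. h (s i)) \<in> UNIV \<rightarrow> carrier H" using s(2) by (auto simp: Pi_iff)
  ultimately show "h x \<in> verbal_subgroup V H"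
    unfolding verbal_subgroup_def using s by (auto intro!: generate.incl)
qed

lemma verbal_lift:
  assumes surj: "h ` carrier G = carrier H" and "v \<in> verbal_subgroup V H"
  shows "\<exists>v' \<in> verbal_subgroup V G. h v' = v"
proof -
  have "verbal_subgroup V H \<subseteq> h ` verbal_subgroup V G"
    unfolding verbal_subgroup_def[of V H]
  proof (rule H.generate_subgroup_incl)
    show "subgroup (h ` verbal_subgroup V G) H" by (rule subgroup_img_is_subgroup[OF G.verbal_subgroup])
    show "{word_eval H s w |s w. s \<in> UNIV \<rightarrow> carrier H \<and> w \<in> V} \<subseteq> h ` verbal_subgroup V G"
    proof clarify
      fix s :: "nat \<Rightarrow> 'b" and w assume s: "s \<in> UNIV \<rightarrow> carrier H" and w: "w \<in> V"
      let ?s = "\<lambda>i. inv_into (carrier G) h (s i)"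
      have s': "?s \<in> UNIV \<rightarrow> carrier G" using s surj by (auto intro!: inv_into_into)
      have "h (?s i) = s i" for i using s surj by (auto intro!: f_inv_into_f)
      then have "word_eval H s w = h (word_eval G ?s w)" using hom_word_eval[OF s'] by simp
      moreover have "word_eval G ?s w \<in> verbal_subgroup V G"
        unfolding verbal_subgroup_def using s' w by (auto intro!: generate.incl)
      ultimately show "word_eval H s w \<in> h ` verbal_subgroup V G" by (rule image_eqI)
    qed
  qed
  then show ?thesis using assms(2) by blast
qed

end

lemma (in plain_group) inner_hom:
  assumes g: "g \<in> carrier G" shows "plain_group_hom G G (\<lambda>x. g \<otimes> x \<otimes> inv g)"
proof (rule plain_group_homI[OF is_group is_group homI])
  fix x y assume "x \<in> carrier G" "y \<in> carrier G"
  then show "g \<otimes> (x \<otimes> y) \<otimes> inv g = g \<otimes> x \<otimes> inv g \<otimes> (g \<otimes> y \<otimes> inv g)" using g by (simp add: group_simps)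
qed (use g in auto)

lemma (in plain_group) verbal_normal: "verbal_subgroup V G \<lhd> G"
  by (rule normal_invI[OF verbal_subgroup]) (rule plain_group_hom.hom_verbal[OF inner_hom])

lemma hom_factor_through_epi:
  assumes \<nu>: "\<nu> \<in> epi F A" and "group F" "group A" "group Q" and g: "g \<in> hom F Q"
    and ker: "\<And>x. x \<in> kernel F A \<nu> \<Longrightarrow> g x = \<one>\<^bsub>Q\<^esub>"
  shows "\<exists>g'\<in>hom A Q. \<forall>x\<in>carrier F. g' (\<nu> x) = g x"
proof -
  have \<nu>': "\<nu> \<in> hom F A" "\<nu> ` carrier F = carrier A" using \<nu> by (auto simp: epi_def)
  interpret nu: group_hom F A \<nu> using assms \<nu>' by (intro group_hom.intro group_hom_axioms.intro)
  interpret g: group_hom F Q g using assms by (intro group_hom.intro group_hom_axioms.intro)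
  define g' where "g' a = g (inv_into (carrier F) \<nu> a)" for a
  have eq: "g x = g y" if "x \<in> carrier F" "y \<in> carrier F" "\<nu> x = \<nu> y" for x y
  proof -
    have "x \<otimes>\<^bsub>F\<^esub> inv\<^bsub>F\<^esub> y \<in> kernel F A \<nu>" using that by (simp add: kernel_def)
    then have "g x \<otimes>\<^bsub>Q\<^esub> inv\<^bsub>Q\<^esub> g y = \<one>\<^bsub>Q\<^esub>" using ker[of "x \<otimes>\<^bsub>F\<^esub> inv\<^bsub>F\<^esub> y"] that by simp
    then show ?thesis using that by (metis g.H.inv_closed g.H.inv_equality g.H.inv_inv g.hom_closed)
  qed
  have g'\<nu>: "g' (\<nu> x) = g x" if "x \<in> carrier F" for x
    unfolding g'_def using that by (intro eq) (auto intro: inv_into_into f_inv_into_f)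
  have "g' \<in> hom A Q"
  proof (rule homI)
    fix a b assume "a \<in> carrier A" "b \<in> carrier A"
    then obtain x y where x: "x \<in> carrier F" "a = \<nu> x" and y: "y \<in> carrier F" "b = \<nu> y" using \<nu>'(2) by blast
    show "g' a \<in> carrier Q" using x g'\<nu> by simp
    have "a \<otimes>\<^bsub>A\<^esub> b = \<nu> (x \<otimes>\<^bsub>F\<^esub> y)" using x y by simp
    then show "g' (a \<otimes>\<^bsub>A\<^esub> b) = g' a \<otimes>\<^bsub>Q\<^esub> g' b" using x y g'\<nu>[of x] g'\<nu>[of y] g'\<nu>[of "x \<otimes>\<^bsub>F\<^esub> y"] by (simp only: g.hom_mult nu.G.m_closed)
  qed
  then show ?thesis using g'\<nu> by blast
qed

section \<open>Free products modulo mixed commutators\<close>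

context group_family
begin

lemma FP_generated:
  assumes "subgroup S FP" "\<And>i g. i \<in> I \<Longrightarrow> g \<in> carrier (G i) \<Longrightarrow> fp_incl G i g \<in> S"
  shows "carrier FP \<subseteq> S"
proof
  fix w assume "w \<in> carrier FP"
  then show "w \<in> S"
    by (induction w rule: FP_induct) (use assms subgroup.one_closed subgroup.m_closed in metis)+
qed

definition proj :: "'i \<Rightarrow> ('i \<times> 'a) list \<Rightarrow> 'a" where
  "proj j = fp_lift (G j) (\<lambda>i g. if i = j then g else \<one>\<^bsub>G j\<^esub>)"

lemma proj_hom:
  assumes "j \<in> I" shows "proj j \<in> hom FP (G j)"
    and "\<And>i g. i \<in> I \<Longrightarrow> g \<in> carrier (G i) \<Longrightarrow> proj j (fp_incl G i g) = (if i = j then g else \<one>\<^bsub>G j\<^esub>)"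
proof -
  have "(\<lambda>g. if i = j then g else \<one>\<^bsub>G j\<^esub>) \<in> hom (G i) (G j)" if "i \<in> I" for i
    using group.is_monoid[OF groups[OF assms]] by (auto simp: hom_def monoid.l_one)
  note lift = fp_lift_hom[OF groups[OF assms] this]
  show "proj j \<in> hom FP (G j)" unfolding proj_def by (rule lift(1))
  show "\<And>i g. i \<in> I \<Longrightarrow> g \<in> carrier (G i) \<Longrightarrow> proj j (fp_incl G i g) = (if i = j then g else \<one>\<^bsub>G j\<^esub>)"
    unfolding proj_def by (rule lift(2))
qed

text \<open>
  Being in the cartesian subgroup can be tested by retractions onto single factors.
\<close>
lemma cartesian_subgroup_eq: "cartesian_subgroup I G = {w \<in> carrier FP. \<forall>j\<in>I. proj j w = \<one>\<^bsub>G j\<^esub>}"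
proof -
  let ?\<phi> = "\<lambda>i g. \<lambda>j\<in>I. if j = i then g else \<one>\<^bsub>G j\<^esub>"
  have eq: "fp_lift (sum_group I G) ?\<phi> w = (\<lambda>j\<in>I. proj j w)" for w
    by (induction w) (auto simp: fp_lift_def proj_def fun_eq_iff)
  show ?thesis
    unfolding cartesian_subgroup_def kernel_def eq one_sum_group
    by (auto simp: fun_eq_iff restrict_def)
qed

lemma cartesian_normal: "cartesian_subgroup I G \<lhd> FP"
proof -
  interpret FP: plain_group FP by (rule plain_group.intro) (rule group_FP)
  have one: "{\<one>\<^bsub>G j\<^esub>} \<lhd> G j" if "j \<in> I" for j
    using group.one_is_normal[OF groups[OF that]] .
  have k: "{w \<in> carrier FP. proj j w \<in> {\<one>\<^bsub>G j\<^esub>}} \<lhd> FP" if "j \<in> I" for j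
    using plain_group_hom.preimage_normal[OF plain_group_homI[OF group_FP groups proj_hom(1)] one] that by blast
  show ?thesis
  proof (rule FP.normal_invI)
    show "subgroup (cartesian_subgroup I G) FP"
    proof (rule FP.subgroupI)
      show "cartesian_subgroup I G \<noteq> {}"
        using FP.normal_closed(3)[OF k] by (auto simp: cartesian_subgroup_eq)
      show "inv\<^bsub>FP\<^esub> a \<in> cartesian_subgroup I G" if "a \<in> cartesian_subgroup I G" for a
        using that FP.normal_closed(5)[OF k, of _ a] by (auto simp: cartesian_subgroup_eq)
      show "a \<otimes>\<^bsub>FP\<^esub> b \<in> cartesian_subgroup I G" if "a \<in> cartesian_subgroup I G" "b \<in> cartesian_subgroup I G" for a b
        using that FP.normal_closed(4)[OF k, of _ a b] by (auto simp: cartesian_subgroup_eq)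
    qed (auto simp: cartesian_subgroup_eq)
    show "g \<otimes>\<^bsub>FP\<^esub> a \<otimes>\<^bsub>FP\<^esub> inv\<^bsub>FP\<^esub> g \<in> cartesian_subgroup I G"
      if "g \<in> carrier FP" "a \<in> cartesian_subgroup I G" for a g
      using that FP.normal_closed(6)[OF k, of _ g a] by (auto simp: cartesian_subgroup_eq)
  qed
qed

definition factor_closure :: "'i \<Rightarrow> ('i \<times> 'a) list set" where
  "factor_closure i = normal_closure FP (fp_incl G i ` carrier (G i))"

abbreviation "mixed_gens \<equiv> {commutator FP x y |x y i j.
   i \<in> I \<and> j \<in> I \<and> i \<noteq> j \<and> x \<in> factor_closure i \<and> y \<in> factor_closure j}"

text \<open>
  The analogue, for the free product, of the group of commutators that enters \<^const>\<open>R_sub\<close>; the two are matched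
  by mapping the factors to conjugates of \<open>F1\<close>.
\<close>
definition mixed_commutators :: "('i \<times> 'a) list set" where
  "mixed_commutators = generate FP mixed_gens"

lemma factor_closure_normal: "i \<in> I \<Longrightarrow> factor_closure i \<lhd> FP"
  unfolding factor_closure_def
  by (intro plain_group.normal_closure_normal plain_group.intro group_FP) (auto intro: fp_incl_closed)

lemma incl_factor_closure: "i \<in> I \<Longrightarrow> g \<in> carrier (G i) \<Longrightarrow> fp_incl G i g \<in> factor_closure i"
  unfolding factor_closure_def
  using plain_group.normal_closure_incl[OF plain_group.intro[OF group_FP], of "fp_incl G i ` carrier (G i)"]
  by (auto intro: fp_incl_closed)

lemma mixed_gens_subset: "mixed_gens \<subseteq> carrier FP"
proof clarify
  interpret FP: plain_group FP by (rule plain_group.intro) (rule group_FP)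
  fix x y i j assume "i \<in> I" "j \<in> I" "x \<in> factor_closure i" "y \<in> factor_closure j"
  then show "commutator FP x y \<in> carrier FP"
    using FP.normal_closed(2)[OF factor_closure_normal] by blast
qed

lemma mixed_commutators_normal: "mixed_commutators \<lhd> FP"
  unfolding mixed_commutators_def
proof (rule group.normal_generateI[OF group_FP mixed_gens_subset])
  interpret FP: plain_group FP by (rule plain_group.intro) (rule group_FP)
  fix h g assume "h \<in> mixed_gens" and g: "g \<in> carrier FP"
  then obtain x y i j where h: "h = commutator FP x y" and ij: "i \<in> I" "j \<in> I" "i \<noteq> j"
    and x: "x \<in> factor_closure i" and y: "y \<in> factor_closure j" by blast
  note n = FP.normal_closed[OF factor_closure_normal]
  have "g \<otimes>\<^bsub>FP\<^esub> h \<otimes>\<^bsub>FP\<^esub> inv\<^bsub>FP\<^esub> g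
    = commutator FP (g \<otimes>\<^bsub>FP\<^esub> x \<otimes>\<^bsub>FP\<^esub> inv\<^bsub>FP\<^esub> g) (g \<otimes>\<^bsub>FP\<^esub> y \<otimes>\<^bsub>FP\<^esub> inv\<^bsub>FP\<^esub> g)"
    unfolding h using n(2) ij x y g by (intro FP.comm_conj) blast+
  then show "g \<otimes>\<^bsub>FP\<^esub> h \<otimes>\<^bsub>FP\<^esub> inv\<^bsub>FP\<^esub> g \<in> mixed_gens"
    using n(6)[OF ij(1) g x] n(6)[OF ij(2) g y] ij by blast
qed

end

lemma (in plain_group) lprod_map_mult_one:
  assumes "distinct bs" "i \<in> set bs" "\<And>b. b \<in> set bs \<Longrightarrow> a b \<in> carrier G" "x \<in> carrier G"
    and "\<And>b. b \<in> set bs \<Longrightarrow> b \<noteq> i \<Longrightarrow> x \<otimes> a b = a b \<otimes> x"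
  shows "lprod (map (\<lambda>b. if b = i then x \<otimes> a b else a b) bs) = x \<otimes> lprod (map a bs)"
  using assms
proof (induction bs)
  case (Cons b bs)
  have c: "lprod (map a bs) \<in> carrier G" "a b \<in> carrier G" using Cons.prems(3) by (auto intro!: lprod_closed)
  show ?case
  proof (cases "b = i")
    case True
    then have "map (\<lambda>b. if b = i then x \<otimes> a b else a b) bs = map a bs" using Cons.prems by auto
    then show ?thesis using True c Cons.prems(4) by (simp add: m_assoc del: map_eq_conv)
  next
    case False
    then have "lprod (map (\<lambda>b. if b = i then x \<otimes> a b else a b) bs) = x \<otimes> lprod (map a bs)"
      using Cons by auto
    moreover have "a b \<otimes> x = x \<otimes> a b" using Cons.prems(5)[of b] False by simp
    ultimately show ?thesis using False c Cons.prems(4) by (simp flip: m_assoc)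
  qed
qed simp

context group_family
begin

definition diagonal_part :: "'i list \<Rightarrow> ('i \<times> 'a) list \<Rightarrow> ('i \<times> 'a) list" where
  "diagonal_part bs v = plain_group.lprod FP (map (\<lambda>b. fp_incl G b (proj b v)) bs)"

text \<open>
  Modulo mixed commutators different factors commute, so the letters of \<open>v\<close> can be sorted by their factors.  The
  induction over words needs the claim for every list of distinct indices that contains a given finite set, since a
  word and its tail have different supports.
\<close>
lemma diagonal_decomposition:
  assumes "v \<in> carrier FP"
  shows "\<exists>bs. set bs \<subseteq> I \<and> v \<otimes>\<^bsub>FP\<^esub> inv\<^bsub>FP\<^esub> diagonal_part bs v \<in> mixed_commutators"
proof -
  interpret FP: plain_group FP by (rule plain_group.intro) (rule group_FP)
  let ?N = mixed_commutators
  let ?\<pi> = "\<lambda>x. ?N #>\<^bsub>FP\<^esub> x" and ?Q = "FP Mod ?N"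
  note N = mixed_commutators_normal
  interpret pi: plain_group_hom FP ?Q ?\<pi> by (rule FP.Mod_hom(1)[OF N])
  have incl: "fp_incl G b (proj b v) \<in> carrier FP" if "b \<in> I" "v \<in> carrier FP" for b v
    using fp_incl_closed hom_in_carrier[OF proj_hom(1)] that by blast
  have dc: "diagonal_part bs v \<in> carrier FP" if "set bs \<subseteq> I" "v \<in> carrier FP" for bs v
    unfolding diagonal_part_def using incl that by (intro FP.lprod_closed) auto
  have \<pi>d: "?\<pi> (diagonal_part bs v) = pi.H.lprod (map (\<lambda>b. ?\<pi> (fp_incl G b (proj b v))) bs)"
    if "set bs \<subseteq> I" "v \<in> carrier FP" for bs v
    unfolding diagonal_part_def using incl that by (subst pi.hom_lprod) (auto simp: comp_def)
  have commute: "?\<pi> (fp_incl G i g) \<otimes>\<^bsub>?Q\<^esub> ?\<pi> (fp_incl G j h) = ?\<pi> (fp_incl G j h) \<otimes>\<^bsub>?Q\<^esub> ?\<pi> (fp_incl G i g)"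
    if ij: "i \<in> I" "j \<in> I" "i \<noteq> j" and g: "g \<in> carrier (G i)" and h: "h \<in> carrier (G j)" for i j g h
  proof -
    let ?x = "fp_incl G i g" and ?y = "fp_incl G j h"
    have c: "?x \<in> carrier FP" "?y \<in> carrier FP" using that fp_incl_closed by auto
    note n = FP.normal_closed[OF factor_closure_normal]
    have "inv\<^bsub>FP\<^esub> ?x \<in> factor_closure i" "inv\<^bsub>FP\<^esub> ?y \<in> factor_closure j"
      using n(5) incl_factor_closure ij g h by blast+
    then have "commutator FP (inv\<^bsub>FP\<^esub> ?x) (inv\<^bsub>FP\<^esub> ?y) \<in> ?N"
      unfolding mixed_commutators_def using ij by (intro generate.incl) blast
    moreover have "commutator FP (inv\<^bsub>FP\<^esub> ?x) (inv\<^bsub>FP\<^esub> ?y) = (?x \<otimes>\<^bsub>FP\<^esub> ?y) \<otimes>\<^bsub>FP\<^esub> inv\<^bsub>FP\<^esub> (?y \<otimes>\<^bsub>FP\<^esub> ?x)"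
      using c by (simp add: commutator_def FP.group_simps)
    ultimately have "?\<pi> (?x \<otimes>\<^bsub>FP\<^esub> ?y) = ?\<pi> (?y \<otimes>\<^bsub>FP\<^esub> ?x)"
      using c FP.rcos_eq_iff[OF N, of "?x \<otimes>\<^bsub>FP\<^esub> ?y" "?y \<otimes>\<^bsub>FP\<^esub> ?x"] by simp
    then show ?thesis using pi.hom_mult[OF c] pi.hom_mult[OF c(2,1)] by simp
  qed
  have "\<exists>X. finite X \<and> X \<subseteq> I \<and> (\<forall>bs. distinct bs \<longrightarrow> set bs \<subseteq> I \<longrightarrow> X \<subseteq> set bs \<longrightarrow> ?\<pi> v = ?\<pi> (diagonal_part bs v))"
    using assms
  proof (induction v rule: FP_induct)
    case one
    have "?\<pi> \<one>\<^bsub>FP\<^esub> = ?\<pi> (diagonal_part bs \<one>\<^bsub>FP\<^esub>)" if "set bs \<subseteq> I" for bs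
    proof -
      have "fp_incl G b (proj b \<one>\<^bsub>FP\<^esub>) = \<one>\<^bsub>FP\<^esub>" if "b \<in> I" for b
        using that hom_one[OF proj_hom(1)] hom_one[OF fp_incl_hom] by simp
      then have "map (\<lambda>b. fp_incl G b (proj b \<one>\<^bsub>FP\<^esub>)) bs = map (\<lambda>b. \<one>\<^bsub>FP\<^esub>) bs" using that by auto
      then have "diagonal_part bs \<one>\<^bsub>FP\<^esub> = FP.lprod (map (\<lambda>b. \<one>\<^bsub>FP\<^esub>) bs)" by (simp only: diagonal_part_def)
      also have "\<dots> = \<one>\<^bsub>FP\<^esub>" by (induction bs) auto
      finally show ?thesis by simp
    qed
    then show ?case by (intro exI[of _ "{}"]) auto
  next
    case (mult i g w)
    then obtain X where X: "finite X" "X \<subseteq> I"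
      and eq: "\<And>bs. distinct bs \<Longrightarrow> set bs \<subseteq> I \<Longrightarrow> X \<subseteq> set bs \<Longrightarrow> ?\<pi> w = ?\<pi> (diagonal_part bs w)" by blast
    let ?x = "fp_incl G i g"
    have x: "?x \<in> carrier FP" using mult fp_incl_closed by blast
    have "?\<pi> (?x \<otimes>\<^bsub>FP\<^esub> w) = ?\<pi> (diagonal_part bs (?x \<otimes>\<^bsub>FP\<^esub> w))"
      if bs: "distinct bs" "set bs \<subseteq> I" "insert i X \<subseteq> set bs" for bs
    proof -
      have incl_x: "?\<pi> (fp_incl G b (proj b (?x \<otimes>\<^bsub>FP\<^esub> w))) =
        (if b = i then ?\<pi> ?x \<otimes>\<^bsub>?Q\<^esub> ?\<pi> (fp_incl G b (proj b w)) else ?\<pi> (fp_incl G b (proj b w)))" if "b \<in> set bs" for b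
      proof -
        have b: "b \<in> I" using that bs by auto
        interpret Gb: group "G b" using b by simp
        have pw: "proj b w \<in> carrier (G b)" using hom_in_carrier[OF proj_hom(1)] b mult by blast
        have "proj b (?x \<otimes>\<^bsub>FP\<^esub> w) = proj b ?x \<otimes>\<^bsub>G b\<^esub> proj b w"
          by (rule hom_mult[OF proj_hom(1)]) (use b x mult in auto)
        also have "proj b ?x = (if i = b then g else \<one>\<^bsub>G b\<^esub>)" using mult b by (intro proj_hom(2))
        finally have p: "proj b (?x \<otimes>\<^bsub>FP\<^esub> w) = (if i = b then g else \<one>\<^bsub>G b\<^esub>) \<otimes>\<^bsub>G b\<^esub> proj b w" .
        show ?thesis
        proof (cases "b = i")
          case True
          have "fp_incl G i (g \<otimes>\<^bsub>G i\<^esub> proj i w) = ?x \<otimes>\<^bsub>FP\<^esub> fp_incl G i (proj i w)"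
            by (rule hom_mult[OF fp_incl_hom]) (use True mult pw in auto)
          moreover have "fp_incl G i (proj i w) \<in> carrier FP" using incl mult by blast
          ultimately show ?thesis using p True x by (simp del: mult_FactGroup)
        next
          case False
          then show ?thesis using p pw by simp
        qed
      qed
      have "?\<pi> (diagonal_part bs (?x \<otimes>\<^bsub>FP\<^esub> w)) =
        pi.H.lprod (map (\<lambda>b. ?\<pi> (fp_incl G b (proj b (?x \<otimes>\<^bsub>FP\<^esub> w)))) bs)"
        using bs x mult by (intro \<pi>d) auto
      also have "map (\<lambda>b. ?\<pi> (fp_incl G b (proj b (?x \<otimes>\<^bsub>FP\<^esub> w)))) bs =
        map (\<lambda>b. if b = i then ?\<pi> ?x \<otimes>\<^bsub>?Q\<^esub> ?\<pi> (fp_incl G b (proj b w)) else ?\<pi> (fp_incl G b (proj b w))) bs"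
        using incl_x by (intro map_cong refl)
      also have "pi.H.lprod \<dots> = ?\<pi> ?x \<otimes>\<^bsub>?Q\<^esub> pi.H.lprod (map (\<lambda>b. ?\<pi> (fp_incl G b (proj b w))) bs)"
      proof (rule pi.H.lprod_map_mult_one)
        show "distinct bs" "i \<in> set bs" using bs by auto
        show "?\<pi> ?x \<in> carrier ?Q" using x by simp
        fix b assume b: "b \<in> set bs"
        then show "?\<pi> (fp_incl G b (proj b w)) \<in> carrier ?Q" using bs mult incl by (intro pi.hom_closed) auto
        show "?\<pi> ?x \<otimes>\<^bsub>?Q\<^esub> ?\<pi> (fp_incl G b (proj b w)) = ?\<pi> (fp_incl G b (proj b w)) \<otimes>\<^bsub>?Q\<^esub> ?\<pi> ?x" if "b \<noteq> i"
          by (rule commute) (use that b bs mult hom_in_carrier[OF proj_hom(1)] in auto)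
      qed
      also have "\<dots> = ?\<pi> ?x \<otimes>\<^bsub>?Q\<^esub> ?\<pi> w"
        using eq[of bs] \<pi>d[of bs w] bs mult by simp
      also have "\<dots> = ?\<pi> (?x \<otimes>\<^bsub>FP\<^esub> w)" using pi.hom_mult[of ?x w] x mult by simp
      finally show ?thesis by simp
    qed
    then show ?case using X mult by (intro exI[of _ "insert i X"]) auto
  qed
  then obtain X where X: "finite X" "X \<subseteq> I" and eq: "\<And>bs. distinct bs \<Longrightarrow> set bs \<subseteq> I \<Longrightarrow> X \<subseteq> set bs \<Longrightarrow> ?\<pi> v = ?\<pi> (diagonal_part bs v)"
    by blast
  obtain bs where bs: "set bs = X" "distinct bs" using finite_distinct_list[OF X(1)] by blast
  then have "?\<pi> v = ?\<pi> (diagonal_part bs v)" using eq X by blast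
  then have "v \<otimes>\<^bsub>FP\<^esub> inv\<^bsub>FP\<^esub> diagonal_part bs v \<in> ?N"
    using FP.rcos_eq_iff[OF N assms dc[of bs v]] assms bs X by simp
  then show ?thesis using bs X by blast
qed

end

section \<open>The verbal wreath product as a quotient of a free product\<close>

lemma group_semidirect_product:
  assumes "group B" "group N" and \<theta>: "\<And>b. b \<in> carrier B \<Longrightarrow> \<theta> b \<in> hom N N"
    and one: "\<And>x. x \<in> carrier N \<Longrightarrow> \<theta> \<one>\<^bsub>B\<^esub> x = x"
    and mult: "\<And>b b' x. b \<in> carrier B \<Longrightarrow> b' \<in> carrier B \<Longrightarrow> x \<in> carrier N \<Longrightarrow> \<theta> (b \<otimes>\<^bsub>B\<^esub> b') x = \<theta> b' (\<theta> b x)"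
  shows "group (semidirect_product B N \<theta>)"
proof -
  interpret B: group B by fact
  interpret N: group N by fact
  have c: "\<theta> b x \<in> carrier N" if "b \<in> carrier B" "x \<in> carrier N" for b x
    using hom_in_carrier[OF \<theta>] that by blast
  have m: "\<theta> b (x \<otimes>\<^bsub>N\<^esub> y) = \<theta> b x \<otimes>\<^bsub>N\<^esub> \<theta> b y" if "b \<in> carrier B" "x \<in> carrier N" "y \<in> carrier N" for b x y
    using hom_mult[OF \<theta>] that by blast
  have m1: "\<theta> b \<one>\<^bsub>N\<^esub> = \<one>\<^bsub>N\<^esub>" if "b \<in> carrier B" for b
    using hom_one[OF \<theta>[OF that]] assms(2) by simp
  show ?thesis
  proof (rule groupI)
    fix x assume "x \<in> carrier (semidirect_product B N \<theta>)"
    then obtain b n where x: "x = (b, n)" "b \<in> carrier B" "n \<in> carrier N" by (auto simp: semidirect_product_def)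
    have "\<theta> b (\<theta> (inv\<^bsub>B\<^esub> b) (inv\<^bsub>N\<^esub> n)) = inv\<^bsub>N\<^esub> n"
      using mult[of "inv\<^bsub>B\<^esub> b" b "inv\<^bsub>N\<^esub> n"] one x by simp
    then show "\<exists>y\<in>carrier (semidirect_product B N \<theta>). y \<otimes>\<^bsub>semidirect_product B N \<theta>\<^esub> x = \<one>\<^bsub>semidirect_product B N \<theta>\<^esub>"
      using x c by (intro bexI[of _ "(inv\<^bsub>B\<^esub> b, \<theta> (inv\<^bsub>B\<^esub> b) (inv\<^bsub>N\<^esub> n))"]) (auto simp: semidirect_product_def)
  qed (auto simp: semidirect_product_def c m m1 one mult B.m_assoc N.m_assoc)
qed

text \<open>
  \<open>P\<close> is the semidirect product of \<open>B\<close> with the free product of copies of \<open>A\<close>, of which the wreath product is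
  the quotient by \<open>CV\<close>.  The maps from \<open>K\<close> and \<open>F\<close> to the wreath product go through \<open>P\<close>, where verbal and cartesian
  subgroups are computed in a free product.
\<close>
locale wreath_presentation =
  fixes V :: "law set" and A :: "'a monoid" and B :: "'b monoid"
    and F1 :: "'f1 monoid" and \<nu>1 :: "'f1 \<Rightarrow> 'a"
    and F2 :: "'f2 monoid" and \<nu>2 :: "'f2 \<Rightarrow> 'b"
  assumes A: "group A" and B: "group B" and F1: "group F1" and F2: "group F2"
    and \<nu>1: "\<nu>1 \<in> epi F1 A" and \<nu>2: "\<nu>2 \<in> epi F2 B"
    and Wr: "group (verbal_wreath V A B)"
begin

sublocale C: group_family "carrier B" "\<lambda>_. A" by (rule group_family.intro) (rule A)
sublocale C1: group_family "carrier B" "\<lambda>_. F1" by (rule group_family.intro) (rule F1)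
sublocale B: plain_group B by (rule plain_group.intro) (rule B)
sublocale A: plain_group A by (rule plain_group.intro) (rule A)

abbreviation "K \<equiv> F1 \<circledast> B"
abbreviation "F \<equiv> F1 \<circledast> F2"
abbreviation "kconj b f \<equiv> inv\<^bsub>K\<^esub> fp_inr F1 B b \<otimes>\<^bsub>K\<^esub> fp_inl F1 B f \<otimes>\<^bsub>K\<^esub> fp_inr F1 B b"
abbreviation "fconj u f \<equiv> inv\<^bsub>F\<^esub> fp_inr F1 F2 u \<otimes>\<^bsub>F\<^esub> fp_inl F1 F2 f \<otimes>\<^bsub>F\<^esub> fp_inr F1 F2 u"
abbreviation "Wreath \<equiv> verbal_wreath V A B"
abbreviation "inA \<equiv> fp_incl (\<lambda>_::'b. A)"
abbreviation "inF1 \<equiv> fp_incl (\<lambda>_::'b. F1)"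
abbreviation "shift \<equiv> wreath_shift A B"
abbreviation "CV \<equiv> verbal_kernel V (carrier B) (\<lambda>_. A)"
abbreviation "P \<equiv> semidirect_product B C.FP shift"

lemma K: "group K" and F: "group F" using F1 F2 B by simp_all

sublocale K: plain_group K by (rule plain_group.intro) (rule K)
sublocale F: plain_group F by (rule plain_group.intro) (rule F)
sublocale C: plain_group C.FP by (rule plain_group.intro) (rule C.group_FP)
sublocale C1: plain_group C1.FP by (rule plain_group.intro) (rule C1.group_FP)

lemmas inl_hom = fp_inl_hom[OF F1 B] fp_inl_hom[OF F1 F2]
lemmas inr_hom = fp_inr_hom[OF F1 B] fp_inr_hom[OF F1 F2]
lemmas inlr_closed [simp] = hom_in_carrier[OF inl_hom(1)] hom_in_carrier[OF inl_hom(2)]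
  hom_in_carrier[OF inr_hom(1)] hom_in_carrier[OF inr_hom(2)]
lemmas inA_closed [simp] = C.fp_incl_closed
lemmas inF1_closed [simp] = C1.fp_incl_closed

lemma \<nu>1_hom: "\<nu>1 \<in> hom F1 A" and \<nu>1_surj: "\<nu>1 ` carrier F1 = carrier A"
  and \<nu>2_hom: "\<nu>2 \<in> hom F2 B" and \<nu>2_surj: "\<nu>2 ` carrier F2 = carrier B"
  using \<nu>1 \<nu>2 by (auto simp: epi_def)

lemmas \<nu>_closed [simp] = hom_in_carrier[OF \<nu>1_hom] hom_in_carrier[OF \<nu>2_hom]

lemma shift_hom: "b \<in> carrier B \<Longrightarrow> shift b \<in> hom C.FP C.FP"
  and shift_inA: "b \<in> carrier B \<Longrightarrow> i \<in> carrier B \<Longrightarrow> a \<in> carrier A \<Longrightarrow> shift b (inA i a) = inA (i \<otimes>\<^bsub>B\<^esub> b) a"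
proof -
  assume b: "b \<in> carrier B"
  have "(\<lambda>a. inA (i \<otimes>\<^bsub>B\<^esub> b) a) \<in> hom A C.FP" if "i \<in> carrier B" for i
    using C.fp_incl_hom[of "i \<otimes>\<^bsub>B\<^esub> b"] that b by simp
  note lift = C.fp_lift_hom[OF C.group_FP this]
  show "shift b \<in> hom C.FP C.FP" unfolding wreath_shift_def by (rule lift(1))
  show "shift b (inA i a) = inA (i \<otimes>\<^bsub>B\<^esub> b) a" if "i \<in> carrier B" "a \<in> carrier A"
    unfolding wreath_shift_def by (rule lift(2)) (use that in auto)
qed

lemma shift_closed [simp]: "b \<in> carrier B \<Longrightarrow> w \<in> carrier C.FP \<Longrightarrow> shift b w \<in> carrier C.FP"
  using hom_in_carrier[OF shift_hom] .

lemma shift_one: "w \<in> carrier C.FP \<Longrightarrow> shift \<one>\<^bsub>B\<^esub> w = w"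
  using C.FP_hom_eqI[OF C.group_FP shift_hom[OF B.one_closed], of "\<lambda>x. x"]
  by (simp add: shift_inA hom_def)

lemma shift_mult:
  assumes b: "b \<in> carrier B" "b' \<in> carrier B" and w: "w \<in> carrier C.FP"
  shows "shift (b \<otimes>\<^bsub>B\<^esub> b') w = shift b' (shift b w)"
proof -
  have h: "shift b' \<circ> shift b \<in> hom C.FP C.FP"
    by (rule Group.hom_compose[OF shift_hom shift_hom]) (use b in auto)
  have "shift (b \<otimes>\<^bsub>B\<^esub> b') w = (shift b' \<circ> shift b) w"
    by (rule C.FP_hom_eqI[OF C.group_FP shift_hom h w])
      (use b in \<open>auto simp: shift_inA B.m_assoc\<close>)
  then show ?thesis by simp
qed

lemma P: "group P"
  by (rule group_semidirect_product[OF B C.group_FP]) (simp_all add: shift_hom shift_one shift_mult)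

sublocale P: plain_group P by (rule plain_group.intro) (rule P)

lemma P_simps: "carrier P = carrier B \<times> carrier C.FP" "\<one>\<^bsub>P\<^esub> = (\<one>\<^bsub>B\<^esub>, \<one>\<^bsub>C.FP\<^esub>)"
  "(b, x) \<otimes>\<^bsub>P\<^esub> (b', x') = (b \<otimes>\<^bsub>B\<^esub> b', shift b' x \<otimes>\<^bsub>C.FP\<^esub> x')"
  by (simp_all add: semidirect_product_def)

lemma shift_one_FP: "b \<in> carrier B \<Longrightarrow> shift b \<one>\<^bsub>C.FP\<^esub> = \<one>\<^bsub>C.FP\<^esub>"
  using hom_one[OF shift_hom] by simp

lemma P_conj:
  assumes b: "b \<in> carrier B" and x: "x \<in> carrier C.FP"
  shows "inv\<^bsub>P\<^esub> (b, \<one>\<^bsub>C.FP\<^esub>) \<otimes>\<^bsub>P\<^esub> (\<one>\<^bsub>B\<^esub>, x) \<otimes>\<^bsub>P\<^esub> (b, \<one>\<^bsub>C.FP\<^esub>) = (\<one>\<^bsub>B\<^esub>, shift b x)"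
proof -
  have c: "(b, \<one>\<^bsub>C.FP\<^esub>) \<in> carrier P" "(\<one>\<^bsub>B\<^esub>, x) \<in> carrier P" "(\<one>\<^bsub>B\<^esub>, shift b x) \<in> carrier P"
    using b x by (simp_all add: P_simps)
  have "(\<one>\<^bsub>B\<^esub>, x) \<otimes>\<^bsub>P\<^esub> (b, \<one>\<^bsub>C.FP\<^esub>) = (b, \<one>\<^bsub>C.FP\<^esub>) \<otimes>\<^bsub>P\<^esub> (\<one>\<^bsub>B\<^esub>, shift b x)"
    using b x by (simp add: P_simps shift_one_FP)
  then show ?thesis using c by (simp add: P.m_assoc P.inv_mult_cancel)
qed

lemma CV_eq: "CV = verbal_subgroup V C.FP \<inter> cartesian_subgroup (carrier B) (\<lambda>_. A)"
  by (simp add: verbal_kernel_def)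

lemma CV_normal: "CV \<lhd> C.FP"
  unfolding CV_eq by (rule C.normal_subgroup_intersect[OF C.verbal_normal C.cartesian_normal])

text \<open>
  \<open>shift b\<close> permutes the factors, hence also the retractions that define the cartesian subgroup.
\<close>
lemma proj_shift:
  assumes b: "b \<in> carrier B" and j: "j \<in> carrier B" and w: "w \<in> carrier C.FP"
  shows "C.proj j (shift b w) = C.proj (j \<otimes>\<^bsub>B\<^esub> inv\<^bsub>B\<^esub> b) w"
proof -
  have h: "C.proj j \<circ> shift b \<in> hom C.FP A" by (rule Group.hom_compose[OF shift_hom C.proj_hom(1)]) (use b j in auto)
  have iff: "i \<otimes>\<^bsub>B\<^esub> b = j \<longleftrightarrow> i = j \<otimes>\<^bsub>B\<^esub> inv\<^bsub>B\<^esub> b" if "i \<in> carrier B" for i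
    using B.inv_solve_right[of i j b] that b j by auto
  have "(C.proj j \<circ> shift b) w = C.proj (j \<otimes>\<^bsub>B\<^esub> inv\<^bsub>B\<^esub> b) w"
    by (rule C.FP_hom_eqI[OF A h C.proj_hom(1) w]) (use b j in \<open>auto simp: shift_inA C.proj_hom(2) iff\<close>)
  then show ?thesis by simp
qed

lemma shift_CV: "b \<in> carrier B \<Longrightarrow> w \<in> CV \<Longrightarrow> shift b w \<in> CV"
  using plain_group_hom.hom_verbal[OF plain_group_homI[OF C.group_FP C.group_FP shift_hom], of b w V]
  by (auto simp: CV_eq C.cartesian_subgroup_eq proj_shift)

lemma shift_coset:
  assumes b: "b \<in> carrier B" and x: "x \<in> carrier C.FP"
  shows "shift b ` (CV #>\<^bsub>C.FP\<^esub> x) = CV #>\<^bsub>C.FP\<^esub> shift b x"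
proof -
  note cv = C.normal_closed[OF CV_normal]
  have mult: "shift b (c \<otimes>\<^bsub>C.FP\<^esub> x) = shift b c \<otimes>\<^bsub>C.FP\<^esub> shift b x" if "c \<in> CV" for c
    using that cv(2) x by (intro hom_mult[OF shift_hom[OF b]]) auto
  have img: "shift b ` CV = CV"
  proof
    show "CV \<subseteq> shift b ` CV"
    proof
      fix c assume c: "c \<in> CV"
      then have "shift b (shift (inv\<^bsub>B\<^esub> b) c) = c"
        using b cv(2) shift_mult[of "inv\<^bsub>B\<^esub> b" b c] by (auto simp: shift_one)
      moreover have "shift (inv\<^bsub>B\<^esub> b) c \<in> CV" using b c by (intro shift_CV) auto
      ultimately show "c \<in> shift b ` CV" by (metis imageI)
    qed
  qed (use shift_CV b in auto)
  have "shift b ` (CV #>\<^bsub>C.FP\<^esub> x) = (\<lambda>c. shift b (c \<otimes>\<^bsub>C.FP\<^esub> x)) ` CV"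
    by (auto simp: r_coset_def)
  also have "\<dots> = (\<lambda>c. c \<otimes>\<^bsub>C.FP\<^esub> shift b x) ` (shift b ` CV)"
    unfolding image_image using mult by (intro image_cong refl)
  also have "\<dots> = CV #>\<^bsub>C.FP\<^esub> shift b x" unfolding img by (auto simp: r_coset_def)
  finally show ?thesis .
qed

text \<open>
  The quotient map from \<open>P\<close> onto the wreath product.
\<close>
definition \<kappa> :: "'b \<times> ('b \<times> 'a) list \<Rightarrow> 'b \<times> ('b \<times> 'a) list set" where
  "\<kappa> = (\<lambda>(b, x). (b, CV #>\<^bsub>C.FP\<^esub> x))"

lemma wreath_simps: "carrier Wreath = carrier B \<times> (\<lambda>x. CV #>\<^bsub>C.FP\<^esub> x) ` carrier C.FP"
  "\<one>\<^bsub>Wreath\<^esub> = (\<one>\<^bsub>B\<^esub>, CV)"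
  "(b, x) \<otimes>\<^bsub>Wreath\<^esub> (b', x') = (b \<otimes>\<^bsub>B\<^esub> b', shift b' ` x <#>\<^bsub>C.FP\<^esub> x')"
  by (simp_all add: verbal_wreath_def semidirect_product_def verbal_product_def carrier_FactGroup)

lemma \<kappa>_epi: "\<kappa> \<in> epi P Wreath"
  unfolding epi_def
proof (intro CollectI conjI)
  show "\<kappa> \<in> hom P Wreath"
  proof (rule homI)
    fix y y' assume "y \<in> carrier P" "y' \<in> carrier P"
    then obtain b x b' x' where y: "y = (b, x)" "y' = (b', x')" "b \<in> carrier B" "b' \<in> carrier B"
      "x \<in> carrier C.FP" "x' \<in> carrier C.FP" by (auto simp: P_simps)
    have "(CV #>\<^bsub>C.FP\<^esub> shift b' x) <#>\<^bsub>C.FP\<^esub> (CV #>\<^bsub>C.FP\<^esub> x') = CV #>\<^bsub>C.FP\<^esub> (shift b' x \<otimes>\<^bsub>C.FP\<^esub> x')"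
      using y by (intro normal.rcos_sum[OF CV_normal]) auto
    then show "\<kappa> (y \<otimes>\<^bsub>P\<^esub> y') = \<kappa> y \<otimes>\<^bsub>Wreath\<^esub> \<kappa> y'"
      using y by (simp add: \<kappa>_def P_simps wreath_simps shift_coset)
  qed (auto simp: \<kappa>_def P_simps wreath_simps)
  show "\<kappa> ` carrier P = carrier Wreath"
    by (force simp: \<kappa>_def P_simps wreath_simps)
qed

lemma \<kappa>_kernel:
  assumes "b \<in> carrier B" "x \<in> carrier C.FP"
  shows "\<kappa> (b, x) = \<one>\<^bsub>Wreath\<^esub> \<longleftrightarrow> b = \<one>\<^bsub>B\<^esub> \<and> x \<in> CV"
proof -
  have "CV #>\<^bsub>C.FP\<^esub> x = CV \<longleftrightarrow> x \<in> CV"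
    using C.rcos_eq_iff[OF CV_normal assms(2) C.one_closed] assms C.normal_closed(2)[OF CV_normal] by simp
  then show ?thesis by (simp add: \<kappa>_def wreath_simps)
qed

definition \<Phi> :: "(bool \<times> ('f1 + 'b)) list \<Rightarrow> 'b \<times> ('b \<times> 'a) list" where
  "\<Phi> = fp_lift2 P (\<lambda>f. (\<one>\<^bsub>B\<^esub>, inA \<one>\<^bsub>B\<^esub> (\<nu>1 f))) (\<lambda>b. (b, \<one>\<^bsub>C.FP\<^esub>))"

definition \<psi> :: "(bool \<times> ('f1 + 'b)) list \<Rightarrow> 'b \<times> ('b \<times> 'a) list set" where
  "\<psi> = \<kappa> \<circ> \<Phi>"

lemma \<Phi>_hom: "\<Phi> \<in> hom K P"
  and \<Phi>_inl: "f \<in> carrier F1 \<Longrightarrow> \<Phi> (fp_inl F1 B f) = (\<one>\<^bsub>B\<^esub>, inA \<one>\<^bsub>B\<^esub> (\<nu>1 f))"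
  and \<Phi>_inr: "b \<in> carrier B \<Longrightarrow> \<Phi> (fp_inr F1 B b) = (b, \<one>\<^bsub>C.FP\<^esub>)"
proof -
  have 1: "(\<lambda>f. (\<one>\<^bsub>B\<^esub>, inA \<one>\<^bsub>B\<^esub> (\<nu>1 f))) \<in> hom F1 P"
    by (rule homI) (auto simp: P_simps shift_one hom_mult[OF \<nu>1_hom] hom_mult[OF C.fp_incl_hom[OF B.one_closed]])
  have 2: "(\<lambda>b. (b, \<one>\<^bsub>C.FP\<^esub>)) \<in> hom B P"
    by (rule homI) (auto simp: P_simps shift_one_FP)
  note lift = fp_lift2_hom[OF F1 B P 1 2]
  show "\<Phi> \<in> hom K P" "f \<in> carrier F1 \<Longrightarrow> \<Phi> (fp_inl F1 B f) = (\<one>\<^bsub>B\<^esub>, inA \<one>\<^bsub>B\<^esub> (\<nu>1 f))"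
    "b \<in> carrier B \<Longrightarrow> \<Phi> (fp_inr F1 B b) = (b, \<one>\<^bsub>C.FP\<^esub>)"
    unfolding \<Phi>_def using lift by auto
qed

sublocale \<Phi>: plain_group_hom K P \<Phi> by (rule plain_group_homI[OF K P \<Phi>_hom])

text \<open>
  Three maps out of the free product of copies of \<open>F1\<close>: \<open>\<iota>\<close> onto the normal closure of \<open>F1\<close> in \<open>K\<close>, \<open>q\<close> onto the
  free product of copies of \<open>A\<close>, and \<open>s\<close>, which lifts \<open>\<iota>\<close> to \<open>F\<close> along the section \<open>sec\<close> of \<open>\<nu>2\<close>.
\<close>
definition \<iota> :: "('b \<times> 'f1) list \<Rightarrow> (bool \<times> ('f1 + 'b)) list" where
  "\<iota> = fp_lift K kconj"

definition q :: "('b \<times> 'f1) list \<Rightarrow> ('b \<times> 'a) list" where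
  "q = fp_lift C.FP (\<lambda>b f. inA b (\<nu>1 f))"

definition sec :: "'b \<Rightarrow> 'f2" where "sec = inv_into (carrier F2) \<nu>2"

definition s :: "('b \<times> 'f1) list \<Rightarrow> (bool \<times> ('f1 + 'f2)) list" where
  "s = fp_lift F (\<lambda>b. fconj (sec b))"

lemma sec: "b \<in> carrier B \<Longrightarrow> sec b \<in> carrier F2" "b \<in> carrier B \<Longrightarrow> \<nu>2 (sec b) = b"
  unfolding sec_def using \<nu>2_surj by (auto intro: inv_into_into f_inv_into_f)

lemma conj_hom:
  fixes G :: "'g monoid"
  assumes "group G" "h \<in> hom X G" "g \<in> carrier G"
  shows "(\<lambda>x. inv\<^bsub>G\<^esub> g \<otimes>\<^bsub>G\<^esub> h x \<otimes>\<^bsub>G\<^esub> g) \<in> hom X G"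
proof -
  interpret plain_group G by (rule plain_group.intro) (rule assms)
  show ?thesis
    by (rule homI) (use assms hom_in_carrier[OF assms(2)] in \<open>auto simp: hom_mult[OF assms(2)] group_simps\<close>)
qed

lemma \<iota>_hom: "\<iota> \<in> hom C1.FP K"
  and \<iota>_inF1: "b \<in> carrier B \<Longrightarrow> f \<in> carrier F1 \<Longrightarrow>
    \<iota> (inF1 b f) = kconj b f"
proof -
  have "kconj b \<in> hom F1 K" if "b \<in> carrier B" for b
    using that by (intro conj_hom K inl_hom) auto
  note lift = C1.fp_lift_hom[OF K this]
  show "\<iota> \<in> hom C1.FP K" unfolding \<iota>_def by (rule lift(1))
  show "\<iota> (inF1 b f) = kconj b f"
    if "b \<in> carrier B" "f \<in> carrier F1"
    unfolding \<iota>_def by (rule lift(2)) (use that in auto)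
qed

lemma s_hom: "s \<in> hom C1.FP F"
  and s_inF1: "b \<in> carrier B \<Longrightarrow> f \<in> carrier F1 \<Longrightarrow>
    s (inF1 b f) = fconj (sec b) f"
proof -
  have "fconj (sec b) \<in> hom F1 F" if "b \<in> carrier B" for b
    using that sec by (intro conj_hom F inl_hom) auto
  note lift = C1.fp_lift_hom[OF F this]
  show "s \<in> hom C1.FP F" unfolding s_def by (rule lift(1))
  show "s (inF1 b f) = fconj (sec b) f"
    if "b \<in> carrier B" "f \<in> carrier F1"
    unfolding s_def by (rule lift(2)) (use that in auto)
qed

lemma q_hom: "q \<in> hom C1.FP C.FP"
  and q_inF1: "b \<in> carrier B \<Longrightarrow> f \<in> carrier F1 \<Longrightarrow> q (inF1 b f) = inA b (\<nu>1 f)"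
proof -
  have "(\<lambda>f. inA b (\<nu>1 f)) \<in> hom F1 C.FP" if "b \<in> carrier B" for b
    using Group.hom_compose[OF \<nu>1_hom C.fp_incl_hom[OF that]] by (simp add: comp_def)
  note lift = C1.fp_lift_hom[OF C.group_FP this]
  show "q \<in> hom C1.FP C.FP" unfolding q_def by (rule lift(1))
  show "q (inF1 b f) = inA b (\<nu>1 f)" if "b \<in> carrier B" "f \<in> carrier F1"
    unfolding q_def by (rule lift(2)) (use that in auto)
qed

sublocale \<iota>: plain_group_hom C1.FP K \<iota> by (rule plain_group_homI[OF C1.group_FP K \<iota>_hom])
sublocale s: plain_group_hom C1.FP F s by (rule plain_group_homI[OF C1.group_FP F s_hom])
sublocale q: plain_group_hom C1.FP C.FP q by (rule plain_group_homI[OF C1.group_FP C.group_FP q_hom])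

lemma q_surj: "q ` carrier C1.FP = carrier C.FP"
proof
  show "carrier C.FP \<subseteq> q ` carrier C1.FP"
  proof (rule C.FP_generated[OF q.img_is_subgroup])
    fix b a assume "b \<in> carrier B" "a \<in> carrier A"
    then obtain f where "f \<in> carrier F1" "a = \<nu>1 f" using \<nu>1_surj by blast
    then show "inA b a \<in> q ` carrier C1.FP"
      using q_inF1[of b f] \<open>b \<in> carrier B\<close> by (metis inF1_closed imageI)
  qed
qed auto

lemma \<Phi>_\<iota>:
  assumes "w \<in> carrier C1.FP" shows "\<Phi> (\<iota> w) = (\<one>\<^bsub>B\<^esub>, q w)"
proof -
  have h: "(\<lambda>w. (\<one>\<^bsub>B\<^esub>, q w)) \<in> hom C1.FP P"
    by (rule homI) (auto simp: P_simps shift_one)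
  have "(\<Phi> \<circ> \<iota>) w = (\<lambda>w. (\<one>\<^bsub>B\<^esub>, q w)) w"
  proof (rule C1.FP_hom_eqI[OF P Group.hom_compose[OF \<iota>_hom \<Phi>_hom] h assms])
    fix b f assume *: "b \<in> carrier B" "f \<in> carrier F1"
    have "\<Phi> (\<iota> (inF1 b f)) = inv\<^bsub>P\<^esub> (b, \<one>\<^bsub>C.FP\<^esub>) \<otimes>\<^bsub>P\<^esub> (\<one>\<^bsub>B\<^esub>, inA \<one>\<^bsub>B\<^esub> (\<nu>1 f)) \<otimes>\<^bsub>P\<^esub> (b, \<one>\<^bsub>C.FP\<^esub>)"
      using * by (simp add: \<iota>_inF1 \<Phi>_inl \<Phi>_inr)
    also have "\<dots> = (\<one>\<^bsub>B\<^esub>, inA b (\<nu>1 f))" using * by (subst P_conj) (auto simp: shift_inA)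
    finally show "(\<Phi> \<circ> \<iota>) (inF1 b f) = (\<one>\<^bsub>B\<^esub>, q (inF1 b f))" using * by (simp add: q_inF1)
  qed
  then show ?thesis by simp
qed

text \<open>
  Letters from \<open>B\<close> move to the left, conjugating the letters from \<open>F1\<close> that they pass.
\<close>
lemma K_decomposition:
  assumes "k \<in> carrier K"
  shows "\<exists>b\<in>carrier B. \<exists>w\<in>carrier C1.FP. k = fp_inr F1 B b \<otimes>\<^bsub>K\<^esub> \<iota> w"
  using F1 B assms
proof (induction k rule: free_product2_induct)
  case one
  have "\<one>\<^bsub>K\<^esub> = fp_inr F1 B \<one>\<^bsub>B\<^esub> \<otimes>\<^bsub>K\<^esub> \<iota> \<one>\<^bsub>C1.FP\<^esub>" using hom_one[OF inr_hom(1) B K] by simp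
  then show ?case by blast
next
  case (inl f k)
  then obtain b w where bw: "b \<in> carrier B" "w \<in> carrier C1.FP" "k = fp_inr F1 B b \<otimes>\<^bsub>K\<^esub> \<iota> w" by blast
  then have "fp_inl F1 B f \<otimes>\<^bsub>K\<^esub> k = fp_inr F1 B b \<otimes>\<^bsub>K\<^esub> \<iota> (inF1 b f \<otimes>\<^bsub>C1.FP\<^esub> w)"
    using inl by (simp add: \<iota>_inF1 K.group_simps)
  moreover have "inF1 b f \<otimes>\<^bsub>C1.FP\<^esub> w \<in> carrier C1.FP" using bw inl by simp
  ultimately show ?case using bw(1) by blast
next
  case (inr b' k)
  then obtain b w where bw: "b \<in> carrier B" "w \<in> carrier C1.FP" "k = fp_inr F1 B b \<otimes>\<^bsub>K\<^esub> \<iota> w" by blast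
  then have "fp_inr F1 B b' \<otimes>\<^bsub>K\<^esub> k = fp_inr F1 B (b' \<otimes>\<^bsub>B\<^esub> b) \<otimes>\<^bsub>K\<^esub> \<iota> w"
    using inr by (simp add: hom_mult[OF inr_hom(1)] K.m_assoc)
  moreover have "b' \<otimes>\<^bsub>B\<^esub> b \<in> carrier B" using bw inr by simp
  ultimately show ?case using bw(2) by blast
qed

lemma \<Phi>_decomposed:
  assumes "b \<in> carrier B" "w \<in> carrier C1.FP"
  shows "\<Phi> (fp_inr F1 B b \<otimes>\<^bsub>K\<^esub> \<iota> w) = (b, q w)"
  using assms by (simp add: \<Phi>_inr \<Phi>_\<iota> P_simps shift_one shift_one_FP)

lemma \<psi>_epi: "\<psi> \<in> epi K Wreath"
proof -
  have "carrier P \<subseteq> \<Phi> ` carrier K"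
  proof
    fix y assume "y \<in> carrier P"
    then obtain b x where "b \<in> carrier B" "x \<in> q ` carrier C1.FP" "y = (b, x)"
      unfolding q_surj by (auto simp: P_simps)
    then obtain w where "b \<in> carrier B" "w \<in> carrier C1.FP" "y = (b, q w)" by blast
    then have "y = \<Phi> (fp_inr F1 B b \<otimes>\<^bsub>K\<^esub> \<iota> w)" "fp_inr F1 B b \<otimes>\<^bsub>K\<^esub> \<iota> w \<in> carrier K"
      using \<Phi>_decomposed by auto
    then show "y \<in> \<Phi> ` carrier K" by blast
  qed
  then have "\<Phi> ` carrier K = carrier P" by auto
  then have "(\<kappa> \<circ> \<Phi>) ` carrier K = carrier Wreath"
    using \<kappa>_epi unfolding image_comp[symmetric] epi_def by simp
  moreover have "\<kappa> \<circ> \<Phi> \<in> hom K Wreath"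
    using \<kappa>_epi by (intro Group.hom_compose[OF \<Phi>_hom]) (simp add: epi_def)
  ultimately show ?thesis unfolding epi_def \<psi>_def by simp
qed

lemma kernel_\<psi>_cases:
  assumes "k \<in> kernel K Wreath \<psi>"
  obtains w where "w \<in> carrier C1.FP" "q w \<in> CV" "k = \<iota> w"
proof -
  obtain b w where bw: "b \<in> carrier B" "w \<in> carrier C1.FP" "k = fp_inr F1 B b \<otimes>\<^bsub>K\<^esub> \<iota> w"
    using K_decomposition[of k] assms unfolding kernel_def by blast
  have "\<psi> k = \<one>\<^bsub>Wreath\<^esub>" using assms by (simp add: kernel_def)
  then have "\<kappa> (b, q w) = \<one>\<^bsub>Wreath\<^esub>" unfolding \<psi>_def comp_apply bw(3) \<Phi>_decomposed[OF bw(1,2)] .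
  then have "b = \<one>\<^bsub>B\<^esub>" "q w \<in> CV" using \<kappa>_kernel[of b "q w"] bw by auto
  moreover have "fp_inr F1 B \<one>\<^bsub>B\<^esub> = \<one>\<^bsub>K\<^esub>" using hom_one[OF inr_hom(1) B K] .
  ultimately show thesis using that bw by simp
qed

abbreviation "\<delta> \<equiv> delta_map B F1 \<nu>2"

lemma \<delta>_hom: "\<delta> \<in> hom F K"
  and \<delta>_inl: "f \<in> carrier F1 \<Longrightarrow> \<delta> (fp_inl F1 F2 f) = fp_inl F1 B f"
  and \<delta>_inr: "u \<in> carrier F2 \<Longrightarrow> \<delta> (fp_inr F1 F2 u) = fp_inr F1 B (\<nu>2 u)"
  unfolding delta_map_def
  using fp_lift2_hom[OF F1 F2 K inl_hom(1) Group.hom_compose[OF \<nu>2_hom inr_hom(1)]] by auto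

sublocale \<delta>: plain_group_hom F K \<delta> by (rule plain_group_homI[OF F K \<delta>_hom])

lemma \<delta>_surj: "\<delta> ` carrier F = carrier K"
proof
  show "carrier K \<subseteq> \<delta> ` carrier F"
  proof (rule free_product2_generated[OF F1 B \<delta>.img_is_subgroup])
    show "fp_inl F1 B f \<in> \<delta> ` carrier F" if "f \<in> carrier F1" for f
      using that \<delta>_inl[OF that] by (intro image_eqI[of _ _ "fp_inl F1 F2 f"]) auto
    show "fp_inr F1 B b \<in> \<delta> ` carrier F" if "b \<in> carrier B" for b
      using that \<delta>_inr[OF sec(1)[OF that]] sec[OF that] by (intro image_eqI[of _ _ "fp_inr F1 F2 (sec b)"]) auto
  qed
qed auto

lemma \<delta>_s:
  assumes "w \<in> carrier C1.FP" shows "\<delta> (s w) = \<iota> w"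
proof -
  have "(\<delta> \<circ> s) w = \<iota> w"
    by (rule C1.FP_hom_eqI[OF K Group.hom_compose[OF s_hom \<delta>_hom] \<iota>_hom assms])
      (auto simp: s_inF1 \<iota>_inF1 \<delta>_inl \<delta>_inr sec)
  then show ?thesis by simp
qed

text \<open>
  \<open>H0\<close> is the normal closure of \<open>F1\<close> in \<open>F\<close>, and \<open>Ncl u\<close> the normal closure of the conjugate by \<open>u\<close> in it.
\<close>
abbreviation "H0 \<equiv> base_subgroup F1 F2"
abbreviation "H \<equiv> F\<lparr>carrier := H0\<rparr>"
abbreviation "conjF1 u \<equiv> conj_set F (fp_inl F1 F2 ` carrier F1) (fp_inr F1 F2 u)"
abbreviation "Ncl u \<equiv> normal_closure H (conjF1 u)"
abbreviation "mixed_gens \<equiv> {commutator F x y |x y u v. u \<in> carrier F2 \<and> v \<in> carrier F2 \<and> \<nu>2 u \<noteq> \<nu>2 v \<and>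
    x \<in> Ncl u \<and> y \<in> Ncl v}"
definition "mixed = generate F mixed_gens"

lemma R_sub_eq: "R_sub V F1 F2 \<nu>2 = verbal_subgroup V H \<inter> mixed"
  by (simp add: R_sub_def Let_def mixed_def)

lemma conjF1_subset: "u \<in> carrier F2 \<Longrightarrow> conjF1 u \<subseteq> carrier F" by (auto simp: conj_set_def)

lemma H0_gens: "(\<Union>u\<in>fp_inr F1 F2 ` carrier F2. conj_set F (fp_inl F1 F2 ` carrier F1) u) \<subseteq> carrier F"
  using conjF1_subset by blast

lemma H0_subgroup: "subgroup H0 F"
  unfolding base_subgroup_def by (rule F.generate_is_subgroup[OF H0_gens])

lemma H: "group H" by (rule F.subgroup_imp_group[OF H0_subgroup])

sublocale H: plain_group H by (rule plain_group.intro) (rule H)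

lemma H0_subset: "H0 \<subseteq> carrier F" using H0_subgroup by (rule subgroup.subset)

lemma conjF1_H0: "u \<in> carrier F2 \<Longrightarrow> conjF1 u \<subseteq> H0"
  unfolding base_subgroup_def by (auto intro!: generate.incl)

lemma Ncl_normal: "u \<in> carrier F2 \<Longrightarrow> Ncl u \<lhd> H"
  by (rule H.normal_closure_normal) (use conjF1_H0 in simp)

lemma mixed_gens_subset: "mixed_gens \<subseteq> carrier F"
proof clarify
  fix x y u v assume "u \<in> carrier F2" "v \<in> carrier F2" "x \<in> Ncl u" "y \<in> Ncl v"
  then have "x \<in> carrier F" "y \<in> carrier F" using H.normal_closed(2)[OF Ncl_normal] H0_subset by auto
  then show "commutator F x y \<in> carrier F" by simp
qed

lemma inv_H: "x \<in> H0 \<Longrightarrow> inv\<^bsub>H\<^esub> x = inv\<^bsub>F\<^esub> x" using F.m_inv_consistent[OF H0_subgroup] by simp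

lemma comm_H: "x \<in> H0 \<Longrightarrow> y \<in> H0 \<Longrightarrow> commutator H x y = commutator F x y"
  by (simp add: commutator_def inv_H)

lemma s_H0: "w \<in> carrier C1.FP \<Longrightarrow> s w \<in> H0"
proof -
  have "carrier C1.FP \<subseteq> {w \<in> carrier C1.FP. s w \<in> H0}"
  proof (rule C1.FP_generated[OF s.preimage_subgroup[OF H0_subgroup]])
    fix b f assume *: "b \<in> carrier B" "f \<in> carrier F1"
    then have "s (inF1 b f) \<in> conjF1 (sec b)" by (auto simp: s_inF1 conj_set_def)
    then show "inF1 b f \<in> {w \<in> carrier C1.FP. s w \<in> H0}" using * conjF1_H0[OF sec(1)] by auto
  qed
  then show "w \<in> carrier C1.FP \<Longrightarrow> s w \<in> H0" by blast
qed

lemma sH_hom: "s \<in> hom C1.FP H"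
  by (rule homI) (simp_all add: s_H0)

sublocale sH: plain_group_hom C1.FP H s by (rule plain_group_homI[OF C1.group_FP H sH_hom])

lemma s_factor_closure:
  assumes b: "b \<in> carrier B" and w: "w \<in> C1.factor_closure b"
  shows "s w \<in> Ncl (sec b)"
proof -
  have N: "Ncl (sec b) \<lhd> H" by (rule Ncl_normal[OF sec(1)[OF b]])
  have "C1.factor_closure b \<subseteq> {w \<in> carrier C1.FP. s w \<in> Ncl (sec b)}"
    unfolding C1.factor_closure_def
  proof (rule C1.normal_closure_least[OF _ sH.preimage_normal[OF N]])
    have "conjF1 (sec b) \<subseteq> Ncl (sec b)"
      by (rule H.normal_closure_incl) (use conjF1_H0 sec b in simp)
    moreover have "s (inF1 b f) \<in> conjF1 (sec b)" if "f \<in> carrier F1" for f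
      using that b by (auto simp: s_inF1 conj_set_def)
    ultimately show "inF1 b ` carrier F1 \<subseteq> {w \<in> carrier C1.FP. s w \<in> Ncl (sec b)}" using b by auto
  qed
  then show ?thesis using w by blast
qed

lemma s_mixed:
  assumes "d \<in> C1.mixed_commutators" shows "s d \<in> mixed"
proof (rule s.hom_generate_subset[OF C1.mixed_gens_subset _ _ assms[unfolded C1.mixed_commutators_def]])
  show "subgroup mixed F" unfolding mixed_def by (rule F.generate_is_subgroup[OF mixed_gens_subset])
  fix z assume "z \<in> C1.mixed_gens"
  then obtain x y i j where z: "z = commutator C1.FP x y" and ij: "i \<in> carrier B" "j \<in> carrier B" "i \<noteq> j"
    and x: "x \<in> C1.factor_closure i" and y: "y \<in> C1.factor_closure j" by blast
  have "x \<in> carrier C1.FP" "y \<in> carrier C1.FP"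
    using C1.normal_closed(2)[OF C1.factor_closure_normal] ij x y by blast+
  then have "s z = commutator F (s x) (s y)" unfolding z by (rule s.hom_comm)
  moreover have "s x \<in> Ncl (sec i)" "s y \<in> Ncl (sec j)" using s_factor_closure ij x y by auto
  moreover have "sec i \<in> carrier F2" "sec j \<in> carrier F2" "\<nu>2 (sec i) \<noteq> \<nu>2 (sec j)" using sec ij by auto
  ultimately show "s z \<in> mixed" unfolding mixed_def by (intro generate.incl) blast
qed

text \<open>
  Since \<open>s\<close> sends the factor at \<open>b\<close> to the conjugate of \<open>F1\<close> by \<open>sec b\<close>, factors with different indices
  go to conjugates by elements with different images under \<open>\<nu>2\<close>.
\<close>
lemma s_R_sub:
  assumes "d \<in> C1.mixed_commutators" "d \<in> verbal_subgroup V C1.FP"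
  shows "s d \<in> R_sub V F1 F2 \<nu>2"
  unfolding R_sub_eq using assms s_mixed sH.hom_verbal by blast

text \<open>
  On \<open>H0\<close> the map to \<open>P\<close> takes values in the normal factor; \<open>\<sigma>\<close> is that component.
\<close>
definition \<sigma> where "\<sigma> z = snd (\<Phi> (\<delta> z))"

lemma fst_hom: "fst \<in> hom P B" by (rule homI) (auto simp: P_simps)

lemma \<Phi>\<delta>_conj:
  assumes "u \<in> carrier F2" "f \<in> carrier F1"
  shows "\<Phi> (\<delta> (fconj u f)) = (\<one>\<^bsub>B\<^esub>, inA (\<nu>2 u) (\<nu>1 f))"
proof -
  have "\<Phi> (\<delta> (fconj u f)) =
    inv\<^bsub>P\<^esub> (\<nu>2 u, \<one>\<^bsub>C.FP\<^esub>) \<otimes>\<^bsub>P\<^esub> (\<one>\<^bsub>B\<^esub>, inA \<one>\<^bsub>B\<^esub> (\<nu>1 f)) \<otimes>\<^bsub>P\<^esub> (\<nu>2 u, \<one>\<^bsub>C.FP\<^esub>)"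
    using assms by (simp add: \<delta>_inl \<delta>_inr \<Phi>_inl \<Phi>_inr)
  also have "\<dots> = (\<one>\<^bsub>B\<^esub>, inA (\<nu>2 u) (\<nu>1 f))" using assms by (subst P_conj) (auto simp: shift_inA)
  finally show ?thesis .
qed

lemma \<Phi>\<delta>_H0:
  assumes "z \<in> H0" shows "\<Phi> (\<delta> z) = (\<one>\<^bsub>B\<^esub>, \<sigma> z)"
proof -
  have "fst \<circ> \<Phi> \<circ> \<delta> \<in> hom F B"
    by (rule Group.hom_compose[OF \<delta>_hom Group.hom_compose[OF \<Phi>_hom fst_hom]])
  then interpret f: plain_group_hom F B "fst \<circ> \<Phi> \<circ> \<delta>" by (rule plain_group_homI[OF F B])
  have "(fst \<circ> \<Phi> \<circ> \<delta>) z \<in> {\<one>\<^bsub>B\<^esub>}"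
  proof (rule f.hom_generate_subset[OF H0_gens B.triv_subgroup _ assms[unfolded base_subgroup_def]])
    fix x assume "x \<in> (\<Union>u\<in>fp_inr F1 F2 ` carrier F2. conj_set F (fp_inl F1 F2 ` carrier F1) u)"
    then obtain u f where "u \<in> carrier F2" "f \<in> carrier F1"
      "x = fconj u f" by (auto simp: conj_set_def)
    then show "(fst \<circ> \<Phi> \<circ> \<delta>) x \<in> {\<one>\<^bsub>B\<^esub>}" using \<Phi>\<delta>_conj by simp
  qed
  then show ?thesis by (simp add: \<sigma>_def prod_eq_iff)
qed

lemma \<sigma>_hom: "\<sigma> \<in> hom H C.FP"
proof (rule homI)
  have c: "\<sigma> x \<in> carrier C.FP" if "x \<in> H0" for x
  proof -
    have "\<Phi> (\<delta> x) \<in> carrier P" using that H0_subset by auto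
    then show ?thesis by (auto simp: \<sigma>_def P_simps)
  qed
  then show "\<sigma> x \<in> carrier C.FP" if "x \<in> carrier H" for x using that by simp
  fix x y assume "x \<in> carrier H" "y \<in> carrier H"
  then have xy: "x \<in> H0" "y \<in> H0" by auto
  then have "(\<one>\<^bsub>B\<^esub>, \<sigma> (x \<otimes>\<^bsub>F\<^esub> y)) = \<Phi> (\<delta> (x \<otimes>\<^bsub>F\<^esub> y))" using H0_subgroup by (simp add: \<Phi>\<delta>_H0 subgroup.m_closed)
  also have "\<dots> = \<Phi> (\<delta> x) \<otimes>\<^bsub>P\<^esub> \<Phi> (\<delta> y)" using xy H0_subset by (simp add: subset_iff)
  also have "\<dots> = (\<one>\<^bsub>B\<^esub>, \<sigma> x \<otimes>\<^bsub>C.FP\<^esub> \<sigma> y)" using xy c by (simp add: \<Phi>\<delta>_H0 P_simps shift_one)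
  finally show "\<sigma> (x \<otimes>\<^bsub>H\<^esub> y) = \<sigma> x \<otimes>\<^bsub>C.FP\<^esub> \<sigma> y" by simp
qed

sublocale \<sigma>: plain_group_hom H C.FP \<sigma> by (rule plain_group_homI[OF H C.group_FP \<sigma>_hom])

text \<open>
  The conjugate of \<open>F1\<close> by \<open>u\<close> is mapped into the factor at \<open>\<nu>2 u\<close>.
\<close>
lemma proj_\<sigma>_Ncl:
  assumes u: "u \<in> carrier F2" and j: "j \<in> carrier B" "j \<noteq> \<nu>2 u" and x: "x \<in> Ncl u"
  shows "C.proj j (\<sigma> x) = \<one>\<^bsub>A\<^esub>"
proof -
  have "C.proj j \<circ> \<sigma> \<in> hom H A" by (rule Group.hom_compose[OF \<sigma>_hom C.proj_hom(1)[OF j(1)]])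
  then interpret h: plain_group_hom H A "C.proj j \<circ> \<sigma>" by (rule plain_group_homI[OF H A])
  have "Ncl u \<subseteq> {z \<in> carrier H. (C.proj j \<circ> \<sigma>) z \<in> {\<one>\<^bsub>A\<^esub>}}"
  proof (rule H.normal_closure_least[OF _ h.preimage_normal[OF A.one_is_normal]])
    show "conjF1 u \<subseteq> {z \<in> carrier H. (C.proj j \<circ> \<sigma>) z \<in> {\<one>\<^bsub>A\<^esub>}}"
    proof
      fix z assume z: "z \<in> conjF1 u"
      then obtain f where f: "f \<in> carrier F1"
        "z = fconj u f" by (auto simp: conj_set_def)
      then have "\<sigma> z = inA (\<nu>2 u) (\<nu>1 f)" using \<Phi>\<delta>_conj[OF u f(1)] by (simp add: \<sigma>_def)
      then have "C.proj j (\<sigma> z) = \<one>\<^bsub>A\<^esub>" using u j f by (simp add: C.proj_hom(2))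
      moreover have "z \<in> H0" using z conjF1_H0[OF u] by blast
      ultimately show "z \<in> {z \<in> carrier H. (C.proj j \<circ> \<sigma>) z \<in> {\<one>\<^bsub>A\<^esub>}}" by simp
    qed
  qed
  then show ?thesis using x by auto
qed

lemma mixed_\<sigma>:
  assumes z: "z \<in> mixed" shows "z \<in> H0" "j \<in> carrier B \<Longrightarrow> C.proj j (\<sigma> z) = \<one>\<^bsub>A\<^esub>"
proof -
  have gens: "z \<in> H0 \<and> C.proj j (\<sigma> z) = \<one>\<^bsub>A\<^esub>" if j: "j \<in> carrier B" and zin: "z \<in> mixed_gens" for z j
  proof -
    obtain x y u v where z: "z = commutator F x y" and uv: "u \<in> carrier F2" "v \<in> carrier F2" "\<nu>2 u \<noteq> \<nu>2 v"
      and xy: "x \<in> Ncl u" "y \<in> Ncl v" using zin by blast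
    have "C.proj j \<circ> \<sigma> \<in> hom H A" by (rule Group.hom_compose[OF \<sigma>_hom C.proj_hom(1)[OF j]])
    then interpret h: plain_group_hom H A "C.proj j \<circ> \<sigma>" by (rule plain_group_homI[OF H A])
    have H0: "x \<in> H0" "y \<in> H0" using H.normal_closed(2)[OF Ncl_normal] uv xy by auto
    then have zH: "z = commutator H x y" using z comm_H by simp
    have c: "(C.proj j \<circ> \<sigma>) x \<in> carrier A" "(C.proj j \<circ> \<sigma>) y \<in> carrier A" using H0 h.hom_closed by auto
    have "(C.proj j \<circ> \<sigma>) x = \<one>\<^bsub>A\<^esub> \<or> (C.proj j \<circ> \<sigma>) y = \<one>\<^bsub>A\<^esub>"
      using proj_\<sigma>_Ncl[OF uv(1) j _ xy(1)] proj_\<sigma>_Ncl[OF uv(2) j _ xy(2)] uv(3) by auto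
    then have "commutator A ((C.proj j \<circ> \<sigma>) x) ((C.proj j \<circ> \<sigma>) y) = \<one>\<^bsub>A\<^esub>"
      using c by (auto simp: commutator_def)
    then have "(C.proj j \<circ> \<sigma>) z = \<one>\<^bsub>A\<^esub>" unfolding zH using h.hom_comm[of x y] H0 by simp
    moreover have "z \<in> H0" unfolding zH using H.comm_closed[of x y] H0 by simp
    ultimately show ?thesis by simp
  qed
  have *: "mixed \<subseteq> {z \<in> carrier H. (C.proj j \<circ> \<sigma>) z \<in> {\<one>\<^bsub>A\<^esub>}}" if j: "j \<in> carrier B" for j
  proof -
    have "C.proj j \<circ> \<sigma> \<in> hom H A" by (rule Group.hom_compose[OF \<sigma>_hom C.proj_hom(1)[OF j]])
    then interpret h: plain_group_hom H A "C.proj j \<circ> \<sigma>" by (rule plain_group_homI[OF H A])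
    have "subgroup {z \<in> carrier H. (C.proj j \<circ> \<sigma>) z \<in> {\<one>\<^bsub>A\<^esub>}} F"
      using F.incl_subgroup[OF H0_subgroup h.preimage_subgroup[OF A.triv_subgroup]] .
    then show ?thesis unfolding mixed_def
    proof (rule F.generate_subgroup_incl[rotated], intro subsetI)
      fix z assume "z \<in> mixed_gens"
      then have "z \<in> H0 \<and> C.proj j (\<sigma> z) = \<one>\<^bsub>A\<^esub>" by (rule gens[OF j])
      then show "z \<in> {z \<in> carrier H. (C.proj j \<circ> \<sigma>) z \<in> {\<one>\<^bsub>A\<^esub>}}" by simp
    qed
  qed
  show "z \<in> H0" using *[OF B.one_closed] z by auto
  show "j \<in> carrier B \<Longrightarrow> C.proj j (\<sigma> z) = \<one>\<^bsub>A\<^esub>" using *[of j] z by auto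
qed

lemma \<psi>_R_sub:
  assumes "z \<in> R_sub V F1 F2 \<nu>2" shows "\<psi> (\<delta> z) = \<one>\<^bsub>Wreath\<^esub>" "z \<in> carrier F"
proof -
  have z: "z \<in> verbal_subgroup V H" "z \<in> mixed" using assms by (auto simp: R_sub_eq)
  have zH: "z \<in> H0" by (rule mixed_\<sigma>(1)[OF z(2)])
  have c: "\<sigma> z \<in> carrier C.FP" using zH \<sigma>.hom_closed by simp
  have "\<sigma> z \<in> CV"
    unfolding CV_eq C.cartesian_subgroup_eq using \<sigma>.hom_verbal[OF z(1)] mixed_\<sigma>(2)[OF z(2)] c by blast
  then show "\<psi> (\<delta> z) = \<one>\<^bsub>Wreath\<^esub>" using \<Phi>\<delta>_H0[OF zH] \<kappa>_kernel[OF B.one_closed c] by (simp add: \<psi>_def)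
  show "z \<in> carrier F" using zH H0_subset by blast
qed

sublocale \<psi>: plain_group_hom K Wreath \<psi>
  using \<psi>_epi by (intro plain_group_homI[OF K Wr]) (auto simp: epi_def)

lemma T_sub_subset: "T_sub V A B F1 \<nu>1 F2 \<nu>2 \<subseteq> kernel K Wreath \<psi>"
proof
  have h: "\<psi> \<circ> \<delta> \<in> hom F Wreath" by (rule Group.hom_compose[OF \<delta>_hom \<psi>.homh])
  then interpret h: plain_group_hom F Wreath "\<psi> \<circ> \<delta>" by (rule plain_group_homI[OF F Wr])
  let ?M = "{z \<in> carrier F. (\<psi> \<circ> \<delta>) z \<in> {\<one>\<^bsub>Wreath\<^esub>}}"
  let ?R1 = "fp_inl F1 F2 ` kernel F1 A \<nu>1" and ?R2 = "fp_inr F1 F2 ` kernel F2 B \<nu>2"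
  have M: "?M \<lhd> F" by (rule h.preimage_normal[OF group.one_is_normal[OF Wr]])
  have R2: "commutator_subgroup F ?R2 (fp_inl F1 F2 ` carrier F1) \<subseteq> ?M"
  proof (rule F.commutator_subgroup_le[OF F.normal_closed(1)[OF M]])
    fix x y assume "x \<in> ?R2" "y \<in> fp_inl F1 F2 ` carrier F1"
    then obtain u f where u: "u \<in> carrier F2" "\<nu>2 u = \<one>\<^bsub>B\<^esub>" "x = fp_inr F1 F2 u" and f: "f \<in> carrier F1" "y = fp_inl F1 F2 f"
      by (auto simp: kernel_def)
    have "\<delta> x = \<one>\<^bsub>K\<^esub>" using u hom_one[OF inr_hom(1) B K] by (simp add: \<delta>_inr)
    moreover have xy: "x \<in> carrier F" "y \<in> carrier F" using u f by auto
    ultimately have "\<delta> (commutator F x y) = \<one>\<^bsub>K\<^esub>" using \<delta>.hom_comm[of x y] by (simp add: commutator_def)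
    then show "commutator F x y \<in> ?M" using xy by simp
  qed
  have 1: "normal_closure F (commutator_subgroup F ?R2 (fp_inl F1 F2 ` carrier F1)) \<subseteq> ?M"
    by (rule F.normal_closure_least[OF R2 M])
  have "?R1 \<subseteq> ?M"
  proof
    fix x assume "x \<in> ?R1"
    then obtain f where f: "f \<in> carrier F1" "\<nu>1 f = \<one>\<^bsub>A\<^esub>" "x = fp_inl F1 F2 f" by (auto simp: kernel_def)
    have "inA \<one>\<^bsub>B\<^esub> \<one>\<^bsub>A\<^esub> = \<one>\<^bsub>C.FP\<^esub>" using hom_one[OF C.fp_incl_hom] A C.group_FP B.one_closed by blast
    then have "\<Phi> (\<delta> x) = \<one>\<^bsub>P\<^esub>" using f by (simp add: \<delta>_inl \<Phi>_inl P_simps)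
    then have "\<psi> (\<delta> x) = \<one>\<^bsub>Wreath\<^esub>" using \<kappa>_kernel[of "\<one>\<^bsub>B\<^esub>" "\<one>\<^bsub>C.FP\<^esub>"] C.normal_closed(3)[OF CV_normal] by (simp add: \<psi>_def P_simps)
    then show "x \<in> ?M" using f by simp
  qed
  then have 2: "normal_closure F ?R1 \<subseteq> ?M" by (rule F.normal_closure_least[OF _ M])
  have 3: "R_sub V F1 F2 \<nu>2 \<subseteq> ?M" using \<psi>_R_sub by auto
  fix t assume "t \<in> T_sub V A B F1 \<nu>1 F2 \<nu>2"
  then obtain x y z where xyz: "x \<in> normal_closure F (commutator_subgroup F ?R2 (fp_inl F1 F2 ` carrier F1))"
    "y \<in> normal_closure F ?R1" "z \<in> R_sub V F1 F2 \<nu>2" "t = \<delta> (x \<otimes>\<^bsub>F\<^esub> y \<otimes>\<^bsub>F\<^esub> z)"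
    unfolding T_sub_def S_sub_def Let_def set_mult_def by auto
  have "x \<otimes>\<^bsub>F\<^esub> y \<otimes>\<^bsub>F\<^esub> z \<in> ?M"
    using F.normal_closed(4)[OF M F.normal_closed(4)[OF M]] 1 2 3 xyz by blast
  then show "t \<in> kernel K Wreath \<psi>" using xyz(4) by (simp add: kernel_def)
qed

text \<open>
  The part of \<open>T_sub\<close> that comes from the relations of \<open>A\<close>.
\<close>
definition "N0 = \<delta> ` normal_closure F (fp_inl F1 F2 ` kernel F1 A \<nu>1)"

lemma ker1_subset: "fp_inl F1 F2 ` kernel F1 A \<nu>1 \<subseteq> carrier F" by (auto simp: kernel_def)

lemma N0_normal: "N0 \<lhd> K"
  unfolding N0_def
  using normal.surj_hom_normal_subgroup[OF F.normal_closure_normal[OF ker1_subset] \<delta>.group_hom_axioms \<delta>_surj] .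

lemma N0_incl: "f \<in> kernel F1 A \<nu>1 \<Longrightarrow> fp_inl F1 B f \<in> N0"
proof -
  assume f: "f \<in> kernel F1 A \<nu>1"
  then have "fp_inl F1 F2 f \<in> normal_closure F (fp_inl F1 F2 ` kernel F1 A \<nu>1)"
    using F.normal_closure_incl[OF ker1_subset] by blast
  moreover have "\<delta> (fp_inl F1 F2 f) = fp_inl F1 B f" using f by (simp add: \<delta>_inl kernel_def)
  ultimately show ?thesis unfolding N0_def by (metis imageI)
qed

text \<open>
  Modulo \<open>N0\<close>, each conjugate of \<open>F1\<close> in \<open>K\<close> factors through \<open>A\<close>.  These maps from the copies of \<open>A\<close> together define
  a map on their free product through which \<open>\<iota>\<close> modulo \<open>N0\<close> factors.
\<close>
lemma \<iota>_kernel_q: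
  assumes "w \<in> carrier C1.FP" "q w = \<one>\<^bsub>C.FP\<^esub>"
  shows "\<iota> w \<in> N0"
proof -
  let ?Q = "K Mod N0" and ?\<pi> = "\<lambda>x. N0 #>\<^bsub>K\<^esub> x"
  interpret pi: plain_group_hom K ?Q ?\<pi> by (rule K.Mod_hom(1)[OF N0_normal])
  note n = K.normal_closed[OF N0_normal]
  let ?c = kconj
  have one: "?\<pi> x = \<one>\<^bsub>?Q\<^esub>" if "x \<in> N0" for x
    using that n(2) K.rcos_eq_iff[OF N0_normal, of x "\<one>\<^bsub>K\<^esub>"] by (simp add: subset_iff)
  have "\<exists>g'\<in>hom A ?Q. \<forall>f\<in>carrier F1. g' (\<nu>1 f) = (?\<pi> \<circ> ?c b) f" if b: "b \<in> carrier B" for b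
  proof (rule hom_factor_through_epi[OF \<nu>1 F1 A pi.H.is_group])
    show "?\<pi> \<circ> ?c b \<in> hom F1 ?Q"
      by (rule Group.hom_compose[OF conj_hom[OF K inl_hom(1)] pi.homh]) (use b in simp)
    show "(?\<pi> \<circ> ?c b) f = \<one>\<^bsub>?Q\<^esub>" if "f \<in> kernel F1 A \<nu>1" for f
      using one[OF n(7)[OF inlr_closed(3)[OF b] N0_incl[OF that]]] by simp
  qed
  then have "\<exists>g. \<forall>b\<in>carrier B. g b \<in> hom A ?Q \<and> (\<forall>f\<in>carrier F1. g b (\<nu>1 f) = (?\<pi> \<circ> ?c b) f)"
    by (intro bchoice) blast
  then obtain g where g: "\<And>b. b \<in> carrier B \<Longrightarrow> g b \<in> hom A ?Q"
    "\<And>b f. b \<in> carrier B \<Longrightarrow> f \<in> carrier F1 \<Longrightarrow> g b (\<nu>1 f) = ?\<pi> (?c b f)" by auto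
  note lift = C.fp_lift_hom[OF pi.H.is_group g(1)]
  have "(fp_lift ?Q g \<circ> q) w = (?\<pi> \<circ> \<iota>) w"
  proof (rule C1.FP_hom_eqI[OF pi.H.is_group Group.hom_compose[OF q_hom lift(1)] Group.hom_compose[OF \<iota>_hom pi.homh] assms(1)])
    fix b f assume bf: "b \<in> carrier B" "f \<in> carrier F1"
    have "fp_lift ?Q g (inA b (\<nu>1 f)) = g b (\<nu>1 f)" by (rule lift(2)) (use bf in auto)
    then show "(fp_lift ?Q g \<circ> q) (inF1 b f) = (?\<pi> \<circ> \<iota>) (inF1 b f)"
      using bf by (simp add: q_inF1 \<iota>_inF1 g(2))
  qed simp
  moreover have "fp_lift ?Q g \<one>\<^bsub>C.FP\<^esub> = \<one>\<^bsub>?Q\<^esub>" by (rule hom_one[OF lift(1) C.group_FP pi.H.is_group]) simp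
  ultimately have "N0 #>\<^bsub>K\<^esub> \<iota> w = N0 #>\<^bsub>K\<^esub> \<one>\<^bsub>K\<^esub>" using assms(2) one[OF n(3)] by simp
  then show ?thesis using K.rcos_eq_iff[OF N0_normal, of "\<iota> w" "\<one>\<^bsub>K\<^esub>"] assms(1) by simp
qed

lemma diagonal_part_verbal:
  assumes v: "v \<in> verbal_subgroup V C1.FP" and bs: "set bs \<subseteq> carrier B"
  shows "C1.diagonal_part bs v \<in> verbal_subgroup V C1.FP"
proof -
  have vc: "v \<in> carrier C1.FP" using v C1.normal_closed(2)[OF C1.verbal_normal] by blast
  have el: "inF1 b (C1.proj b v) \<in> verbal_subgroup V C1.FP" if "b \<in> carrier B" for b
    using plain_group_hom.hom_verbal[OF plain_group_homI[OF C1.group_FP C1.group_FP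
        Group.hom_compose[OF C1.proj_hom(1) C1.fp_incl_hom]], OF that that v] by simp
  have lp: "set xs \<subseteq> verbal_subgroup V C1.FP \<Longrightarrow> C1.lprod xs \<in> verbal_subgroup V C1.FP" for xs
    by (induction xs) (auto intro: subgroup.m_closed[OF C1.verbal_subgroup] subgroup.one_closed[OF C1.verbal_subgroup])
  then show ?thesis unfolding C1.diagonal_part_def using el bs by (intro lp) auto
qed

lemma proj_q:
  assumes "b \<in> carrier B" "v \<in> carrier C1.FP" shows "\<nu>1 (C1.proj b v) = C.proj b (q v)"
proof -
  have \<nu>1_one: "\<nu>1 \<one>\<^bsub>F1\<^esub> = \<one>\<^bsub>A\<^esub>" by (rule hom_one[OF \<nu>1_hom F1 A])
  have "(\<nu>1 \<circ> C1.proj b) v = (C.proj b \<circ> q) v"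
    by (rule C1.FP_hom_eqI[OF A Group.hom_compose[OF C1.proj_hom(1) \<nu>1_hom] Group.hom_compose[OF q_hom C.proj_hom(1)] assms(2)])
      (use assms \<nu>1_one in \<open>auto simp: C1.proj_hom(2) C.proj_hom(2) q_inF1\<close>)
  then show ?thesis by simp
qed

lemma diagonal_part_closed:
  assumes "v \<in> carrier C1.FP" "set bs \<subseteq> carrier B" shows "C1.diagonal_part bs v \<in> carrier C1.FP"
proof -
  have "inF1 b (C1.proj b v) \<in> carrier C1.FP" if "b \<in> set bs" for b
    using that assms hom_in_carrier[OF C1.proj_hom(1)] by auto
  then show ?thesis unfolding C1.diagonal_part_def by (intro C1.lprod_closed) auto
qed

lemma q_diagonal_part:
  assumes v: "v \<in> carrier C1.FP" and bs: "set bs \<subseteq> carrier B" and car: "q v \<in> cartesian_subgroup (carrier B) (\<lambda>_. A)"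
  shows "q (C1.diagonal_part bs v) = \<one>\<^bsub>C.FP\<^esub>"
proof -
  have c: "C1.proj b v \<in> carrier F1" if "b \<in> carrier B" for b
    using that v hom_in_carrier[OF C1.proj_hom(1)] by auto
  have "q (inF1 b (C1.proj b v)) = \<one>\<^bsub>C.FP\<^esub>" if "b \<in> carrier B" for b
  proof -
    have "q (inF1 b (C1.proj b v)) = inA b (C.proj b (q v))" using that v c by (simp add: q_inF1 proj_q)
    also have "C.proj b (q v) = \<one>\<^bsub>A\<^esub>" using car that by (simp add: C.cartesian_subgroup_eq)
    finally show ?thesis using hom_one[OF C.fp_incl_hom[OF that] A C.group_FP] by simp
  qed
  then have "map (q \<circ> (\<lambda>b. inF1 b (C1.proj b v))) bs = map (\<lambda>b. \<one>\<^bsub>C.FP\<^esub>) bs" using bs by auto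
  moreover have "C.lprod (map (\<lambda>b. \<one>\<^bsub>C.FP\<^esub>) bs) = \<one>\<^bsub>C.FP\<^esub>" by (induction bs) auto
  moreover have "set (map (\<lambda>b. inF1 b (C1.proj b v)) bs) \<subseteq> carrier C1.FP" using c bs by auto
  ultimately show ?thesis unfolding C1.diagonal_part_def by (simp only: q.hom_lprod map_map)
qed

text \<open>
  Write \<open>w = (w v\<^sup>-\<^sup>1) d e\<close>, where \<open>v\<close> is a verbal lift of \<open>q w\<close>, \<open>e\<close> its diagonal part and \<open>d = v e\<^sup>-\<^sup>1\<close>.  The
  outer factors map into \<open>N0\<close>, and \<open>d\<close> lifts into \<^const>\<open>R_sub\<close>.
\<close>
lemma kernel_subset_T_sub: "kernel K Wreath \<psi> \<subseteq> T_sub V A B F1 \<nu>1 F2 \<nu>2"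
proof
  fix k assume "k \<in> kernel K Wreath \<psi>"
  then obtain w where w: "w \<in> carrier C1.FP" "q w \<in> CV" "k = \<iota> w" by (rule kernel_\<psi>_cases)
  obtain v where v: "v \<in> verbal_subgroup V C1.FP" "q v = q w"
    using q.verbal_lift[OF q_surj, of "q w" V] w(2) by (auto simp: CV_eq)
  have vc: "v \<in> carrier C1.FP" using v C1.normal_closed(2)[OF C1.verbal_normal] by blast
  obtain bs where bs: "set bs \<subseteq> carrier B" "v \<otimes>\<^bsub>C1.FP\<^esub> inv\<^bsub>C1.FP\<^esub> C1.diagonal_part bs v \<in> C1.mixed_commutators"
    using C1.diagonal_decomposition[OF vc] by blast
  define e where "e = C1.diagonal_part bs v"
  define d where "d = v \<otimes>\<^bsub>C1.FP\<^esub> inv\<^bsub>C1.FP\<^esub> e"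
  have ec: "e \<in> carrier C1.FP" unfolding e_def by (rule diagonal_part_closed[OF vc bs(1)])
  have dc: "d \<in> carrier C1.FP" using vc ec by (simp add: d_def)
  have "d \<in> verbal_subgroup V C1.FP"
    unfolding d_def e_def
    by (intro subgroup.m_closed[OF C1.verbal_subgroup] subgroup.m_inv_closed[OF C1.verbal_subgroup]
        diagonal_part_verbal v(1) bs(1))
  then have sd: "s d \<in> R_sub V F1 F2 \<nu>2" using bs(2) by (intro s_R_sub) (simp_all add: d_def e_def)
  have n1: "\<iota> (w \<otimes>\<^bsub>C1.FP\<^esub> inv\<^bsub>C1.FP\<^esub> v) \<in> N0"
    using w vc v(2) by (intro \<iota>_kernel_q) auto
  have n2: "\<iota> e \<in> N0"
    using w(2) v(2) unfolding e_def
    by (intro \<iota>_kernel_q diagonal_part_closed q_diagonal_part vc bs(1)) (auto simp: CV_eq)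
  have "w = (w \<otimes>\<^bsub>C1.FP\<^esub> inv\<^bsub>C1.FP\<^esub> v) \<otimes>\<^bsub>C1.FP\<^esub> (d \<otimes>\<^bsub>C1.FP\<^esub> e)"
    using w vc ec by (simp add: d_def C1.group_simps)
  then have "k = \<iota> (w \<otimes>\<^bsub>C1.FP\<^esub> inv\<^bsub>C1.FP\<^esub> v) \<otimes>\<^bsub>K\<^esub> (\<iota> d \<otimes>\<^bsub>K\<^esub> \<iota> e)"
    using w vc dc ec by (metis \<iota>.hom_mult C1.inv_closed C1.m_closed)
  also have "\<dots> = (\<iota> (w \<otimes>\<^bsub>C1.FP\<^esub> inv\<^bsub>C1.FP\<^esub> v) \<otimes>\<^bsub>K\<^esub> (\<iota> d \<otimes>\<^bsub>K\<^esub> \<iota> e \<otimes>\<^bsub>K\<^esub> inv\<^bsub>K\<^esub> \<iota> d)) \<otimes>\<^bsub>K\<^esub> \<iota> d"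
    using w vc dc ec by (simp add: K.m_assoc)
  finally have k: "k = (\<iota> (w \<otimes>\<^bsub>C1.FP\<^esub> inv\<^bsub>C1.FP\<^esub> v) \<otimes>\<^bsub>K\<^esub> (\<iota> d \<otimes>\<^bsub>K\<^esub> \<iota> e \<otimes>\<^bsub>K\<^esub> inv\<^bsub>K\<^esub> \<iota> d)) \<otimes>\<^bsub>K\<^esub> \<iota> d" .
  have "\<iota> (w \<otimes>\<^bsub>C1.FP\<^esub> inv\<^bsub>C1.FP\<^esub> v) \<otimes>\<^bsub>K\<^esub> (\<iota> d \<otimes>\<^bsub>K\<^esub> \<iota> e \<otimes>\<^bsub>K\<^esub> inv\<^bsub>K\<^esub> \<iota> d) \<in> N0"
    by (intro K.normal_closed(4)[OF N0_normal n1] K.normal_closed(6)[OF N0_normal] n2 \<iota>.hom_closed dc)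
  then obtain y where y: "y \<in> normal_closure F (fp_inl F1 F2 ` kernel F1 A \<nu>1)"
    "\<iota> (w \<otimes>\<^bsub>C1.FP\<^esub> inv\<^bsub>C1.FP\<^esub> v) \<otimes>\<^bsub>K\<^esub> (\<iota> d \<otimes>\<^bsub>K\<^esub> \<iota> e \<otimes>\<^bsub>K\<^esub> inv\<^bsub>K\<^esub> \<iota> d) = \<delta> y" unfolding N0_def by blast
  have yc: "y \<in> carrier F" using y(1) F.normal_closed(2)[OF F.normal_closure_normal[OF ker1_subset]] by blast
  have sdc: "s d \<in> carrier F" using dc by simp
  have "k = \<delta> y \<otimes>\<^bsub>K\<^esub> \<delta> (s d)" unfolding k y(2) using dc by (simp add: \<delta>_s)
  also have "\<dots> = \<delta> (\<one>\<^bsub>F\<^esub> \<otimes>\<^bsub>F\<^esub> y \<otimes>\<^bsub>F\<^esub> s d)" using yc sdc by simp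
  finally have k': "k = \<delta> (\<one>\<^bsub>F\<^esub> \<otimes>\<^bsub>F\<^esub> y \<otimes>\<^bsub>F\<^esub> s d)" .
  have "\<one>\<^bsub>F\<^esub> \<in> normal_closure F (commutator_subgroup F (fp_inr F1 F2 ` kernel F2 B \<nu>2) (fp_inl F1 F2 ` carrier F1))"
    unfolding normal_closure_def by (rule generate.one)
  then have "\<one>\<^bsub>F\<^esub> \<otimes>\<^bsub>F\<^esub> y \<otimes>\<^bsub>F\<^esub> s d \<in> S_sub V A B F1 \<nu>1 F2 \<nu>2"
    unfolding S_sub_def Let_def set_mult_def using y(1) sd by blast
  then show "k \<in> T_sub V A B F1 \<nu>1 F2 \<nu>2" unfolding T_sub_def k' by (rule imageI)
qed

theorem kernel_eq_T_sub: "kernel K Wreath \<psi> = T_sub V A B F1 \<nu>1 F2 \<nu>2"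
  using T_sub_subset kernel_subset_T_sub by (rule equalityI[rotated])

end

section \<open>Baer invariants with respect to nilpotent groups\<close>

context plain_group
begin

lemma rcos_restrict: "(G\<lparr>carrier := S\<rparr>) Mod N = \<lparr>carrier = (\<lambda>x. N #> x) ` S, monoid.mult = set_mult G, one = N\<rparr>"
  by (auto simp: FactGroup_def RCOSETS_def r_coset_def set_mult_def fun_eq_iff)

lemma gamma_quotient_simps:
  "carrier (gamma_quotient c G R) = (\<lambda>x. icomm R c #> x) ` (R \<inter> icomm (carrier G) c)"
  "X \<otimes>\<^bsub>gamma_quotient c G R\<^esub> Y = X <#> Y" "\<one>\<^bsub>gamma_quotient c G R\<^esub> = icomm R c"
  by (simp_all add: gamma_quotient_def rcos_restrict lower_central_def)

lemma gamma_quotient_subgroup: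
  assumes R: "R \<lhd> G"
  shows "subgroup (R \<inter> icomm (carrier G) c) G" "icomm R c \<subseteq> R \<inter> icomm (carrier G) c"
    "icomm R c \<lhd> G\<lparr>carrier := R \<inter> icomm (carrier G) c\<rparr>"
proof -
  show S: "subgroup (R \<inter> icomm (carrier G) c) G"
    by (intro normal_closed(1) normal_subgroup_intersect R icomm_normal carrier_normal)
  show N: "icomm R c \<subseteq> R \<inter> icomm (carrier G) c"
    using icomm_le[OF R] icomm_mono[OF normal_closed(2)[OF R]] by auto
  show "icomm R c \<lhd> G\<lparr>carrier := R \<inter> icomm (carrier G) c\<rparr>"
    by (rule normal_restrict_supergroup[OF S icomm_normal[OF R] N])
qed

text \<open>
  For \<open>x\<close> in \<open>R\<close> and \<open>y\<close> in \<open>\<gamma>\<^sub>c\<^sub>+\<^sub>1(G)\<close>, the commutator lies in \<open>[R, G, \<dots>, G]\<close> with \<open>c + 1\<close>, hence also with \<open>c\<close>, copies of \<open>G\<close>.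
\<close>
lemma gamma_quotient_comm_group:
  assumes R: "R \<lhd> G" shows "comm_group (gamma_quotient c G R)"
proof -
  let ?N = "icomm R c"
  have N: "?N \<lhd> G" by (rule icomm_normal[OF R])
  note r = normal_closed[OF R] and l = normal_closed[OF icomm_normal[OF carrier_normal, of c]]
  have "group (gamma_quotient c G R)"
    using normal.factorgroup_is_group[OF gamma_quotient_subgroup(3)[OF R]]
    by (simp add: gamma_quotient_def lower_central_def)
  then show ?thesis
  proof (rule group.group_comm_groupI)
    fix X Y assume "X \<in> carrier (gamma_quotient c G R)" "Y \<in> carrier (gamma_quotient c G R)"
    then obtain x y where x: "X = ?N #> x" "x \<in> R" and y: "Y = ?N #> y" "y \<in> icomm (carrier G) c"
      by (auto simp: gamma_quotient_simps)
    have c: "x \<in> carrier G" "y \<in> carrier G" using x y r(2) l(2) by auto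
    have "comm (inv x) (inv y) \<in> icomm R (Suc c)"
      by (rule subsetD[OF comm_lower_central[OF R]], rule commutator_subgroup_mem[OF r(5)[OF x(2)] l(5)[OF y(2)]])
    also have "\<dots> \<subseteq> ?N" unfolding icomm_Suc by (rule commutator_subgroup_incl_left[OF N]) simp
    finally have "comm (inv x) (inv y) \<in> ?N" .
    moreover have "comm (inv x) (inv y) = (x \<otimes> y) \<otimes> inv (y \<otimes> x)" using c by (simp add: commutator_def group_simps)
    ultimately have "?N #> (x \<otimes> y) = ?N #> (y \<otimes> x)" using rcos_eq_iff[OF N, of "x \<otimes> y" "y \<otimes> x"] c by simp
    then show "X \<otimes>\<^bsub>gamma_quotient c G R\<^esub> Y = Y \<otimes>\<^bsub>gamma_quotient c G R\<^esub> X"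
      using c by (simp add: gamma_quotient_simps x y normal.rcos_sum[OF N])
  qed
qed

lemma gamma_quotient_proj:
  assumes R: "R \<lhd> G"
  shows "(\<lambda>x. icomm R c #> x) \<in> hom (G\<lparr>carrier := R \<inter> icomm (carrier G) c\<rparr>) (gamma_quotient c G R)"
  using normal_closed(2)[OF R]
  by (intro homI) (auto simp: gamma_quotient_simps normal.rcos_sum[OF icomm_normal[OF R]] subset_iff)

lemma finite_gamma_quotient:
  assumes R: "R \<lhd> G" and "finite ((\<lambda>x. R #> x) ` carrier G)"
  shows "finite (carrier (gamma_quotient c G R))"
  unfolding gamma_quotient_simps
  by (rule finite_subset[OF _ finite_lower_central_mod[OF assms, of c]]) auto

end

lemma (in plain_group_hom) hom_icomm_mem:
  assumes "R \<lhd> G" "\<And>x. x \<in> R \<Longrightarrow> h x \<in> R'" "x \<in> G.icomm R c"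
  shows "h x \<in> H.icomm R' c"
proof -
  have "h ` R \<subseteq> R'" using assms(2) by blast
  then show ?thesis using H.icomm_mono[of "h ` R" R' c] hom_icomm_le[OF assms(1), of c] assms(3) by blast
qed

lemma (in plain_group_hom) hom_gamma_mem:
  "x \<in> G.icomm (carrier G) c \<Longrightarrow> h x \<in> H.icomm (carrier H) c"
  by (rule hom_icomm_mem[OF G.carrier_normal hom_closed])

lemma finite_kernel_cosets:
  assumes "plain_group_hom G Q h" and "finite (carrier Q)"
  shows "finite ((\<lambda>x. kernel G Q h #>\<^bsub>G\<^esub> x) ` carrier G)"
proof -
  interpret plain_group_hom G Q h by fact
  have "finite (h ` carrier G)" by (rule finite_subset[OF _ assms(2)]) auto
  then show ?thesis
  proof (rule finite_image_determined)
    fix x y assume *: "x \<in> carrier G" "y \<in> carrier G" "h x = h y"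
    then have "x \<otimes>\<^bsub>G\<^esub> inv\<^bsub>G\<^esub> y \<in> kernel G Q h" by (simp add: kernel_def)
    then show "kernel G Q h #>\<^bsub>G\<^esub> x = kernel G Q h #>\<^bsub>G\<^esub> y"
      using G.rcos_eq_iff[OF normal_kernel] * by simp
  qed
qed

lemma homs_cong_kernel:
  assumes \<psi>: "plain_group_hom K Q \<psi>" and \<alpha>: "plain_group_hom L K \<alpha>" and \<beta>: "plain_group_hom L K \<beta>"
    and eq: "\<And>x. x \<in> carrier L \<Longrightarrow> \<psi> (\<alpha> x) = \<psi> (\<beta> x)"
    and x: "x \<in> iter_commutator L (carrier L) c (carrier L)"
  shows "iter_commutator K (kernel K Q \<psi>) c (carrier K) #>\<^bsub>K\<^esub> \<alpha> x = iter_commutator K (kernel K Q \<psi>) c (carrier K) #>\<^bsub>K\<^esub> \<beta> x"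
proof -
  interpret p: plain_group_hom K Q \<psi> by fact
  interpret a: plain_group_hom L K \<alpha> by fact
  interpret b: plain_group_hom L K \<beta> by fact
  have xc: "x \<in> carrier L"
    using x a.G.normal_closed(2)[OF a.G.icomm_normal[OF a.G.carrier_normal]] by blast
  have "\<alpha> x \<otimes>\<^bsub>K\<^esub> inv\<^bsub>K\<^esub> \<beta> x \<in> iter_commutator K (kernel K Q \<psi>) c (carrier K)"
    by (rule homs_cong_lower_central[OF \<alpha> \<beta> p.normal_kernel _ x]) (simp add: kernel_def eq)
  then show ?thesis using p.G.rcos_eq_iff[OF p.G.icomm_normal[OF p.normal_kernel]] xc by simp
qed

text \<open>
  Put \<open>K = P * B\<close>.  \<open>\<kappa>\<close> lifts \<open>\<omega>\<close> along \<open>\<psi>\<close>, and \<open>\<tau>\<close> lifts \<open>\<rho> \<circ> \<omega>\<close> along \<open>\<epsilon>\<close>.  For surjectivity, \<open>\<delta>\<close>, \<open>p\<close> and \<open>\<Lambda>\<close> map \<open>P * E\<close> to \<open>K\<close>,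
  \<open>E\<close> and \<open>W\<close>.  The homomorphisms \<open>\<kappa> \<circ> \<Lambda>\<close> and \<open>\<delta>\<close> agree modulo the kernel of \<open>\<psi>\<close>, and \<open>\<tau> \<circ> \<Lambda>\<close> and \<open>p\<close> agree
  modulo the kernel of \<open>\<epsilon>\<close>, so on \<open>\<gamma>\<^sub>c\<^sub>+\<^sub>1\<close> they induce the same maps to the two summands.
\<close>
lemma baer_invariant_epi:
  fixes W :: "'w monoid" and G :: "'g monoid" and E :: "'e monoid" and B :: "'b monoid" and P :: "'p monoid"
  assumes W: "free_presentation W \<omega> G" and E: "free_presentation E \<epsilon> B" and P: "is_free_group P" "group P"
    and \<psi>: "\<psi> \<in> epi (P \<circledast> B) G" and \<rho>: "\<rho> \<in> hom G B"
    and \<rho>_inl: "\<And>p. p \<in> carrier P \<Longrightarrow> \<rho> (\<psi> (fp_inl P B p)) = \<one>\<^bsub>B\<^esub>"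
    and \<rho>_inr: "\<And>b. b \<in> carrier B \<Longrightarrow> \<rho> (\<psi> (fp_inr P B b)) = b"
  shows "\<exists>f. f \<in> epi (nilpotent_baer_invariant c W \<omega> G)
    (nilpotent_baer_invariant c E \<epsilon> B \<times>\<times> gamma_quotient c (P \<circledast> B) (kernel (P \<circledast> B) G \<psi>))"
proof -
  let ?K = "P \<circledast> B" and ?L = "P \<circledast> E"
  have Wf: "is_free_group W" "group G" "\<omega> \<in> epi W G" and Ef: "is_free_group E" "group B" "\<epsilon> \<in> epi E B"
    using W E by (auto simp: free_presentation_def)
  have gW: "group W" and gE: "group E" using Wf(1) Ef(1) by (auto simp: is_free_group_def free_basis_def)
  have gK: "group ?K" and gL: "group ?L" using P(2) Ef(2) gE by simp_all
  have \<omega>: "\<omega> \<in> hom W G" "\<omega> ` carrier W = carrier G" and \<epsilon>: "\<epsilon> \<in> hom E B" "\<epsilon> ` carrier E = carrier B"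
    and \<psi>': "\<psi> \<in> hom ?K G" "\<psi> ` carrier ?K = carrier G"
    using Wf Ef \<psi> by (auto simp: epi_def)
  note inl = fp_inl_hom[OF P(2) Ef(2)] fp_inl_hom[OF P(2) gE] and inr = fp_inr_hom[OF P(2) Ef(2)] fp_inr_hom[OF P(2) gE]
  obtain \<kappa> where \<kappa>: "\<kappa> \<in> hom W ?K" "\<And>x. x \<in> carrier W \<Longrightarrow> \<psi> (\<kappa> x) = \<omega> x"
    using free_group_lift[OF Wf(1) gK \<psi> Wf(2) \<omega>(1)] by blast
  obtain \<tau> where \<tau>: "\<tau> \<in> hom W E" "\<And>x. x \<in> carrier W \<Longrightarrow> \<epsilon> (\<tau> x) = (\<rho> \<circ> \<omega>) x"
    using free_group_lift[OF Wf(1) gE Ef(3) Ef(2) Group.hom_compose[OF \<omega>(1) \<rho>]] by blast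
  obtain l1 where l1: "l1 \<in> hom P W" "\<And>p. p \<in> carrier P \<Longrightarrow> \<omega> (l1 p) = (\<psi> \<circ> fp_inl P B) p"
    using free_group_lift[OF P(1) gW Wf(3,2) Group.hom_compose[OF inl(1) \<psi>'(1)]] by blast
  obtain l2 where l2: "l2 \<in> hom E W" "\<And>e. e \<in> carrier E \<Longrightarrow> \<omega> (l2 e) = (\<psi> \<circ> (fp_inr P B \<circ> \<epsilon>)) e"
    using free_group_lift[OF Ef(1) gW Wf(3,2) Group.hom_compose[OF Group.hom_compose[OF \<epsilon>(1) inr(1)] \<psi>'(1)]] by blast
  define \<Lambda> where "\<Lambda> = fp_lift2 W l1 l2"
  define \<delta> where "\<delta> = fp_lift2 ?K (fp_inl P B) (fp_inr P B \<circ> \<epsilon>)"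
  define p where "p = fp_lift2 E (\<lambda>_::'p. \<one>\<^bsub>E\<^esub>) (\<lambda>e. e)"
  note \<Lambda> = fp_lift2_hom[OF P(2) gE gW l1(1) l2(1), folded \<Lambda>_def]
  note \<delta> = fp_lift2_hom[OF P(2) gE gK inl(1) Group.hom_compose[OF \<epsilon>(1) inr(1)], folded \<delta>_def]
  have "(\<lambda>_. \<one>\<^bsub>E\<^esub>) \<in> hom P E" "(\<lambda>e. e) \<in> hom E E" using group.is_monoid[OF gE] by (auto simp: hom_def)
  note p = fp_lift2_hom[OF P(2) gE gE this, folded p_def]
  interpret W: plain_group_hom W G \<omega> by (rule plain_group_homI[OF gW Wf(2) \<omega>(1)])
  interpret Eh: plain_group_hom E B \<epsilon> by (rule plain_group_homI[OF gE Ef(2) \<epsilon>(1)])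
  interpret K: plain_group_hom ?K G \<psi> by (rule plain_group_homI[OF gK Wf(2) \<psi>'(1)])
  interpret \<kappa>: plain_group_hom W ?K \<kappa> by (rule plain_group_homI[OF gW gK \<kappa>(1)])
  interpret \<tau>: plain_group_hom W E \<tau> by (rule plain_group_homI[OF gW gE \<tau>(1)])
  interpret \<Lambda>: plain_group_hom ?L W \<Lambda> by (rule plain_group_homI[OF gL gW \<Lambda>(1)])
  interpret \<delta>: plain_group_hom ?L ?K \<delta> by (rule plain_group_homI[OF gL gK \<delta>(1)])
  interpret p: plain_group_hom ?L E p by (rule plain_group_homI[OF gL gE p(1)])
  interpret inr: plain_group_hom E ?L "fp_inr P E" by (rule plain_group_homI[OF gE gL inr(2)])
  interpret \<rho>: plain_group_hom G B \<rho> by (rule plain_group_homI[OF Wf(2) Ef(2) \<rho>])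
  have inl_c: "fp_inl P B x \<in> carrier ?K" if "x \<in> carrier P" for x using hom_in_carrier[OF inl(1) that] .
  have inr_c: "fp_inr P B x \<in> carrier ?K" if "x \<in> carrier B" for x using hom_in_carrier[OF inr(1) that] .
  have \<omega>\<Lambda>: "\<omega> (\<Lambda> x) = \<psi> (\<delta> x)" if "x \<in> carrier ?L" for x
  proof -
    have "(\<omega> \<circ> \<Lambda>) x = (\<psi> \<circ> \<delta>) x"
      by (rule free_product2_hom_eqI[OF P(2) gE Wf(2) Group.hom_compose[OF \<Lambda>(1) \<omega>(1)] Group.hom_compose[OF \<delta>(1) \<psi>'(1)] that])
        (simp_all add: \<Lambda> \<delta> l1 l2)
    then show ?thesis by simp
  qed
  have \<epsilon>p: "\<epsilon> (p x) = \<rho> (\<psi> (\<delta> x))" if "x \<in> carrier ?L" for x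
  proof -
    have "(\<epsilon> \<circ> p) x = (\<rho> \<circ> (\<psi> \<circ> \<delta>)) x"
      by (rule free_product2_hom_eqI[OF P(2) gE Ef(2) Group.hom_compose[OF p(1) \<epsilon>(1)]
            Group.hom_compose[OF Group.hom_compose[OF \<delta>(1) \<psi>'(1)] \<rho>] that])
        (simp_all add: p \<delta> \<rho>_inl \<rho>_inr)
    then show ?thesis by simp
  qed
  have \<delta>_surj: "\<delta> ` carrier ?L = carrier ?K"
  proof
    show "carrier ?K \<subseteq> \<delta> ` carrier ?L"
    proof (rule free_product2_generated[OF P(2) Ef(2) \<delta>.img_is_subgroup])
      show "fp_inl P B x \<in> \<delta> ` carrier ?L" if "x \<in> carrier P" for x
        using that \<delta>(2)[OF that] hom_in_carrier[OF inl(2) that] by (metis imageI)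
      fix b assume "b \<in> carrier B"
      then obtain e where e: "e \<in> carrier E" "b = \<epsilon> e" using \<epsilon>(2) by blast
      then have "fp_inr P B b = \<delta> (fp_inr P E e)" using \<delta>(3)[OF e(1)] by simp
      then show "fp_inr P B b \<in> \<delta> ` carrier ?L" using e(1) inr.hom_closed by (metis imageI)
    qed
  qed auto
  let ?RW = "kernel W G \<omega>" and ?RE = "kernel E B \<epsilon>" and ?T = "kernel ?K G \<psi>"
  let ?gW = "iter_commutator W (carrier W) c (carrier W)" and ?gE = "iter_commutator E (carrier E) c (carrier E)"
    and ?gK = "iter_commutator ?K (carrier ?K) c (carrier ?K)" and ?gL = "iter_commutator ?L (carrier ?L) c (carrier ?L)"
  let ?NW = "iter_commutator W ?RW c (carrier W)" and ?NE = "iter_commutator E ?RE c (carrier E)"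
    and ?NK = "iter_commutator ?K ?T c (carrier ?K)"
  note RW = W.normal_kernel and RE = Eh.normal_kernel and T = K.normal_kernel
  let ?MW = "gamma_quotient c W ?RW" and ?ME = "gamma_quotient c E ?RE" and ?MK = "gamma_quotient c ?K ?T"
  let ?S = "?RW \<inter> ?gW" and ?SE = "?RE \<inter> ?gE" and ?SK = "?T \<inter> ?gK"
  let ?WS = "W\<lparr>carrier := ?S\<rparr>"
  have gc: "?gW \<subseteq> carrier W" "?gE \<subseteq> carrier E" "?gK \<subseteq> carrier ?K" "?gL \<subseteq> carrier ?L"
    using W.G.normal_closed(2)[OF W.G.icomm_normal[OF W.G.carrier_normal]]
      Eh.G.normal_closed(2)[OF Eh.G.icomm_normal[OF Eh.G.carrier_normal]]
      K.G.normal_closed(2)[OF K.G.icomm_normal[OF K.G.carrier_normal]]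
      \<Lambda>.G.normal_closed(2)[OF \<Lambda>.G.icomm_normal[OF \<Lambda>.G.carrier_normal]] by auto
  have \<tau>R: "\<tau> x \<in> ?RE" if "x \<in> ?RW" for x using that \<tau>(2)[of x] by (simp add: kernel_def)
  have \<kappa>R: "\<kappa> x \<in> ?T" if "x \<in> ?RW" for x using that \<kappa>(2)[of x] by (simp add: kernel_def)
  have \<tau>S: "\<tau> x \<in> ?SE" and \<kappa>S: "\<kappa> x \<in> ?SK" if "x \<in> ?S" for x
    using that \<tau>R[of x] \<kappa>R[of x] \<tau>.hom_gamma_mem[of x c] \<kappa>.hom_gamma_mem[of x c] by simp_all
  have \<tau>N: "\<tau> x \<in> ?NE" and \<kappa>N: "\<kappa> x \<in> ?NK" if "x \<in> ?NW" for x
    using \<tau>.hom_icomm_mem[OF RW \<tau>R that] \<kappa>.hom_icomm_mem[OF RW \<kappa>R that] by simp_all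
  define f0 where "f0 x = (?NE #>\<^bsub>E\<^esub> \<tau> x, ?NK #>\<^bsub>?K\<^esub> \<kappa> x)" for x
  have "(\<lambda>x. ?NE #>\<^bsub>E\<^esub> \<tau> x) \<in> hom ?WS ?ME"
    using Group.hom_compose[OF _ Eh.G.gamma_quotient_proj[OF RE], of \<tau> ?WS c] \<tau>S \<tau>(1) gc(1)
    by (auto simp: hom_def comp_def subset_iff)
  moreover have "(\<lambda>x. ?NK #>\<^bsub>?K\<^esub> \<kappa> x) \<in> hom ?WS ?MK"
    using Group.hom_compose[OF _ K.G.gamma_quotient_proj[OF T], of \<kappa> ?WS c] \<kappa>S \<kappa>(1) gc(1)
    by (auto simp: hom_def comp_def subset_iff)
  ultimately have f0: "f0 \<in> hom ?WS (?ME \<times>\<times> ?MK)"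
    unfolding f0_def by (auto simp: hom_def DirProd_def)
  have cong: "f0 x = f0 y" if x: "x \<in> carrier ?WS" and y: "y \<in> carrier ?WS" and eq: "?NW #>\<^bsub>?WS\<^esub> x = ?NW #>\<^bsub>?WS\<^esub> y" for x y
  proof -
    have c: "x \<in> carrier W" "y \<in> carrier W" using x y gc(1) by auto
    have "?NW #>\<^bsub>W\<^esub> x = ?NW #>\<^bsub>W\<^esub> y" using eq by (simp add: r_coset_def)
    then have xy: "x \<otimes>\<^bsub>W\<^esub> inv\<^bsub>W\<^esub> y \<in> ?NW" using W.G.rcos_eq_iff[OF W.G.icomm_normal[OF RW]] c by simp
    have "\<tau> x \<otimes>\<^bsub>E\<^esub> inv\<^bsub>E\<^esub> \<tau> y \<in> ?NE" "\<kappa> x \<otimes>\<^bsub>?K\<^esub> inv\<^bsub>?K\<^esub> \<kappa> y \<in> ?NK"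
      using \<tau>N[OF xy] \<kappa>N[OF xy] c by simp_all
    then show ?thesis unfolding f0_def
      using Eh.G.rcos_eq_iff[OF Eh.G.icomm_normal[OF RE]] K.G.rcos_eq_iff[OF K.G.icomm_normal[OF T]] c by simp
  qed
  obtain f where f: "f \<in> hom (?WS Mod ?NW) (?ME \<times>\<times> ?MK)" "\<And>x. x \<in> carrier ?WS \<Longrightarrow> f (?NW #>\<^bsub>?WS\<^esub> x) = f0 x"
    using FactGroup_universal[OF f0 W.G.gamma_quotient_subgroup(3)[OF RW] cong] by metis
  have MW: "?WS Mod ?NW = ?MW" by (simp add: gamma_quotient_def lower_central_def)
  have f': "f (?NW #>\<^bsub>W\<^esub> x) = f0 x" if "x \<in> ?S" for x using f(2)[of x] that by (simp add: r_coset_def)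
  have surj: "\<exists>x\<in>?S. f0 x = (?NE #>\<^bsub>E\<^esub> e, ?NK #>\<^bsub>?K\<^esub> t)" if e: "e \<in> ?SE" and t: "t \<in> ?SK" for e t
  proof -
    have "t \<in> \<delta> ` ?gL" using t \<delta>.hom_icomm[OF \<Lambda>.G.carrier_normal \<delta>_surj, of c] \<delta>_surj by simp
    then obtain g where g: "g \<in> ?gL" "\<delta> g = t" by blast
    have gL': "g \<in> carrier ?L" using g(1) gc(4) by blast
    \<comment> \<open>\<open>g\<close> has the right image in \<open>K\<close> but the wrong one in \<open>E\<close>; multiplying by an element of \<open>E\<close> over \<open>1\<close> in \<open>B\<close>
      corrects the latter and leaves the former alone.\<close>
    define y where "y = inv\<^bsub>E\<^esub> p g \<otimes>\<^bsub>E\<^esub> e"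
    have ec: "e \<in> carrier E" using e gc(2) by blast
    have yc: "y \<in> carrier E" using gL' ec by (simp add: y_def)
    have pg: "p g \<in> ?gE" by (rule p.hom_gamma_mem[OF g(1)])
    have "\<epsilon> (p g) = \<one>\<^bsub>B\<^esub>" using \<epsilon>p[OF gL'] g(2) t by (simp add: kernel_def)
    then have \<epsilon>y: "\<epsilon> y = \<one>\<^bsub>B\<^esub>" using gL' ec e by (simp add: y_def kernel_def)
    note gen = Eh.G.normal_closed[OF Eh.G.icomm_normal[OF Eh.G.carrier_normal, of c]]
    note gln = \<Lambda>.G.normal_closed[OF \<Lambda>.G.icomm_normal[OF \<Lambda>.G.carrier_normal, of c]]
    have "y \<in> ?gE" unfolding y_def using e by (intro gen(4) gen(5) pg) auto
    then have iy: "fp_inr P E y \<in> ?gL" by (rule inr.hom_gamma_mem)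
    define x where "x = g \<otimes>\<^bsub>?L\<^esub> fp_inr P E y"
    have x: "x \<in> ?gL" unfolding x_def by (rule gln(4)[OF g(1) iy])
    have xc: "x \<in> carrier ?L" using x gc(4) by blast
    have "\<delta> (fp_inr P E y) = fp_inr P B \<one>\<^bsub>B\<^esub>" using \<delta>(3)[OF yc] \<epsilon>y by simp
    then have \<delta>y: "\<delta> (fp_inr P E y) = \<one>\<^bsub>?K\<^esub>" using hom_one[OF inr(1) Ef(2) gK] by simp
    have \<delta>x: "\<delta> x = t" using g(2) \<delta>y yc gL' K.G.r_one[OF \<delta>.hom_closed[OF gL']] by (simp add: x_def)
    have px: "p x = e" using p(3)[OF yc] yc gL' ec by (simp add: x_def y_def Eh.G.inv_mult_cancel)
    have \<Lambda>x: "\<Lambda> x \<in> ?S"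
    proof -
      have "\<omega> (\<Lambda> x) = \<one>\<^bsub>G\<^esub>" using \<omega>\<Lambda>[OF xc] \<delta>x t by (simp add: kernel_def)
      moreover have "\<Lambda> x \<in> ?gW" by (rule \<Lambda>.hom_gamma_mem[OF x])
      ultimately show ?thesis using xc by (simp add: kernel_def)
    qed
    have "?NK #>\<^bsub>?K\<^esub> (\<kappa> \<circ> \<Lambda>) x = ?NK #>\<^bsub>?K\<^esub> \<delta> x"
      by (rule homs_cong_kernel[OF K.plain_group_hom_axioms plain_group_homI[OF gL gK Group.hom_compose[OF \<Lambda>(1) \<kappa>(1)]] \<delta>.plain_group_hom_axioms _ x])
        (simp add: \<kappa>(2) \<omega>\<Lambda>)
    moreover have "?NE #>\<^bsub>E\<^esub> (\<tau> \<circ> \<Lambda>) x = ?NE #>\<^bsub>E\<^esub> p x"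
      by (rule homs_cong_kernel[OF Eh.plain_group_hom_axioms plain_group_homI[OF gL gE Group.hom_compose[OF \<Lambda>(1) \<tau>(1)]] p.plain_group_hom_axioms _ x])
        (simp add: \<tau>(2) \<omega>\<Lambda> \<epsilon>p)
    ultimately have "f0 (\<Lambda> x) = (?NE #>\<^bsub>E\<^esub> e, ?NK #>\<^bsub>?K\<^esub> t)" unfolding f0_def using \<delta>x px by simp
    then show ?thesis using \<Lambda>x by blast
  qed
  have "carrier (?ME \<times>\<times> ?MK) \<subseteq> f ` carrier ?MW"
  proof
    fix z assume "z \<in> carrier (?ME \<times>\<times> ?MK)"
    then obtain e t where z: "z = (?NE #>\<^bsub>E\<^esub> e, ?NK #>\<^bsub>?K\<^esub> t)" "e \<in> ?SE" "t \<in> ?SK"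
      by (auto simp: DirProd_def Eh.G.gamma_quotient_simps K.G.gamma_quotient_simps)
    then obtain x where "x \<in> ?S" "f0 x = z" using surj by blast
    then show "z \<in> f ` carrier ?MW" using f'[of x] by (force simp: W.G.gamma_quotient_simps)
  qed
  then have "f \<in> epi ?MW (?ME \<times>\<times> ?MK)" using f(1) unfolding MW epi_iff_subset by blast
  then show ?thesis unfolding nilpotent_baer_invariant_def by blast
qed

theorem theorem4p5:
  fixes A :: "'a monoid" and B :: "'b monoid"
    and F1 :: "'f1 monoid" and \<nu>1 :: "'f1 \<Rightarrow> 'a"
    and F2 :: "'f2 monoid" and \<nu>2 :: "'f2 \<Rightarrow> 'b"
    and E :: "'e monoid" and \<epsilon> :: "'e \<Rightarrow> 'b"
    and W :: "'w monoid" and \<omega> :: "'w \<Rightarrow> 'b \<times> ('b \<times> 'a) list set"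
    and c :: nat and V :: "law set"
  assumes "c \<ge> 1"
    and "V \<subseteq> carrier (free_group UNIV)"
    and "free_presentation F1 \<nu>1 A"
    and "free_presentation F2 \<nu>2 B"
    and "free_presentation E \<epsilon> B"
    and "free_presentation W \<omega> (verbal_wreath V A B)"
  shows
    "let M_wreath = nilpotent_baer_invariant c W \<omega> (verbal_wreath V A B);
         M_sum = nilpotent_baer_invariant c E \<epsilon> B
                 \<times>\<times> gamma_quotient c (F1 \<circledast> B) (T_sub V A B F1 \<nu>1 F2 \<nu>2)
     in (\<exists>f. f \<in> epi M_wreath M_sum) \<and>
        (finite (carrier (verbal_wreath V A B)) \<longrightarrow>
           (\<exists>H. subgroup H M_wreath \<and> M_wreath\<lparr>carrier := H\<rparr> \<cong> M_sum))"
proof -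
  let ?G = "verbal_wreath V A B"
  have free: "is_free_group F1" "is_free_group F2" "is_free_group E" "is_free_group W"
    and A: "group A" and B: "group B" and G: "group ?G"
    and epi: "\<nu>1 \<in> epi F1 A" "\<nu>2 \<in> epi F2 B" "\<epsilon> \<in> epi E B" "\<omega> \<in> epi W ?G"
    using assms by (auto simp: free_presentation_def)
  have gr: "group F1" "group F2" "group E" "group W"
    using free by (auto simp: is_free_group_def free_basis_def)
  interpret wreath_presentation V A B F1 \<nu>1 F2 \<nu>2
    by (rule wreath_presentation.intro) (rule A B gr epi G)+
  interpret \<omega>: plain_group_hom W ?G \<omega>
    using epi(4) by (intro plain_group_homI[OF gr(4) G]) (simp add: epi_def)
  interpret \<epsilon>: plain_group_hom E B \<epsilon>
    using epi(3) by (intro plain_group_homI[OF gr(3) B]) (simp add: epi_def)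
  have \<rho>: "fst \<in> hom ?G B" by (rule homI) (auto simp: wreath_simps)
  have "fst (\<psi> (fp_inl F1 B f)) = \<one>\<^bsub>B\<^esub>" if "f \<in> carrier F1" for f
    using that by (simp add: \<psi>_def \<Phi>_inl \<kappa>_def)
  moreover have "fst (\<psi> (fp_inr F1 B b)) = b" if "b \<in> carrier B" for b
    using that by (simp add: \<psi>_def \<Phi>_inr \<kappa>_def)
  ultimately have "\<exists>f. f \<in> epi (nilpotent_baer_invariant c W \<omega> ?G)
    (nilpotent_baer_invariant c E \<epsilon> B \<times>\<times> gamma_quotient c K (kernel K ?G \<psi>))"
    by (rule baer_invariant_epi[OF assms(6,5) free(1) gr(1) \<psi>_epi \<rho>])
  then obtain f where f: "f \<in> epi (nilpotent_baer_invariant c W \<omega> ?G)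
    (nilpotent_baer_invariant c E \<epsilon> B \<times>\<times> gamma_quotient c K (T_sub V A B F1 \<nu>1 F2 \<nu>2))"
    unfolding kernel_eq_T_sub by blast
  have comm: "comm_group (nilpotent_baer_invariant c W \<omega> ?G)"
    unfolding nilpotent_baer_invariant_def by (rule \<omega>.G.gamma_quotient_comm_group[OF \<omega>.normal_kernel])
  have grp: "group (nilpotent_baer_invariant c E \<epsilon> B \<times>\<times> gamma_quotient c K (T_sub V A B F1 \<nu>1 F2 \<nu>2))"
    unfolding nilpotent_baer_invariant_def kernel_eq_T_sub[symmetric]
    by (intro DirProd_group comm_group.axioms(2) \<epsilon>.G.gamma_quotient_comm_group[OF \<epsilon>.normal_kernel]
        K.gamma_quotient_comm_group[OF \<psi>.normal_kernel])
  have "\<exists>H. subgroup H (nilpotent_baer_invariant c W \<omega> ?G) \<and> (nilpotent_baer_invariant c W \<omega> ?G)\<lparr>carrier := H\<rparr> \<cong>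
    nilpotent_baer_invariant c E \<epsilon> B \<times>\<times> gamma_quotient c K (T_sub V A B F1 \<nu>1 F2 \<nu>2)"
    if fin: "finite (carrier ?G)"
  proof (rule quotient_embeds_finite_abelian[OF comm _ grp f])
    show "finite (carrier (nilpotent_baer_invariant c W \<omega> ?G))"
      unfolding nilpotent_baer_invariant_def
      by (rule \<omega>.G.finite_gamma_quotient[OF \<omega>.normal_kernel finite_kernel_cosets[OF \<omega>.plain_group_hom_axioms fin]])
  qed
  then show ?thesis unfolding Let_def using f by blast
qed

end
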